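(* Let $\mathbb{F}$ be a finite field and let $N=(t-\lambda_1)\cdots(t-\lambda_n)\in\mathbb{F}[t]$ be a square-free polynomial with all its roots $\lambda_i$ in $\mathbb{F}$. Let $\mathfrak{s}$ be the smallest subtree of the Bruhat–Tits tree $\mathfrak{t}$ of $K_\infty=\mathbb{F}((t^{-1}))$ containing the ends $0$, $\infty$ and $1/M$ for every proper monic divisor $M$ of $N$ (i.e. every monic $M\mid N$ with $0<\deg M<\deg N$). Then the congruence subgroup $$\Gamma_N=\left\{\begin{pmatrix}a&b\\c&d\end{pmatrix}\in\mathrm{GL}_2(\mathbb{F}[t]) : c\equiv 0 \pmod N\right\}$$ has a fundamental domain of the form $\mathfrak{s}\cup\mathfrak{f}$ for some finite graph $\mathfrak{f}$.
   Context: The Bruhat–Tits tree $\mathfrak{t}$ of $K_\infty=\mathbb{F}((t^{-1}))$ (valuation $\nu=-\deg$) is identified with the ball tree: its vertices are the closed balls $B_x^{r}=\{y\in K_\infty:\nu(y-x)\ge r\}$ ($x\in K_\infty$, $r\in\mathbb{Z}$), two balls being adjacent when one is a maximal proper sub-ball of the other; its ends are identified with $\mathbb{P}^1(K_\infty)$, and $\mathrm{GL}_2(K_\infty)\supseteq \mathrm{GL}_2(\mathbb{F}[t])$ acts on it by the standard action on the Bruhat–Tits tree, compatible with Möbius transformations on ends. A subgraph contains an end if it contains a ray in the corresponding class; the smallest subtree containing a set of ends is the union of the lines joining pairs of them. Fundamental domain: let $\mathfrak{t}'$ be the barycentric subdivision of $\mathfrak{t}$ (so $\Gamma_N$ acts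 without inversions) and $\Gamma_N\backslash\mathfrak{t}'$ the quotient graph; choose a maximal tree in this quotient, replacing each removed edge (a path of length two through a barycenter) by two half-edges ending at new nonvertices; a fundamental domain is any lifting of the resulting tree to a subtree of $\mathfrak{t}'$. In particular, its vertices coming from vertices of $\mathfrak{t}$ form a set of representatives of the $\Gamma_N$-orbits of vertices of $\mathfrak{t}$. *)

theory Defs
  imports
    "HOL-Analysis.Analysis"
    "HOL-Computational_Algebra.Computational_Algebra"
begin

section \<open>Undirected multigraphs\<close>

text \<open>
  The ends of an edge form a set with two elements, or with one element if the edge is a loop.
\<close>

record ('v, 'e) mgraph =
  gverts :: "'v set"
  gedges :: "'e set"
  gends :: "'e \<Rightarrow> 'v set"

text \<open>
  A subgraph carries the same incidence map as the ambient graph (also outside of its own edges),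
  so subgraphs of a fixed graph are determined by their vertex and edge sets.
\<close>

definition subgraph :: "('v, 'e) mgraph \<Rightarrow> ('v, 'e) mgraph \<Rightarrow> bool" where
  "subgraph H G \<longleftrightarrow> gverts H \<subseteq> gverts G \<and> gedges H \<subseteq> gedges G \<and> gends H = gends G \<and>
     (\<forall>e\<in>gedges H. gends G e \<subseteq> gverts H)"

text \<open>Union of two subgraphs of a common graph.\<close>

definition graph_union :: "('v, 'e) mgraph \<Rightarrow> ('v, 'e) mgraph \<Rightarrow> ('v, 'e) mgraph" where
  "graph_union H H' =
     \<lparr>gverts = gverts H \<union> gverts H', gedges = gedges H \<union> gedges H', gends = gends H\<rparr>"

definition finite_graph :: "('v, 'e) mgraph \<Rightarrow> bool" where
  "finite_graph G \<longleftrightarrow> finite (gverts G) \<and> finite (gedges G)"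

text \<open>A walk is given by its initial vertex and the list of its steps (edge, next vertex).\<close>

fun walk :: "('v, 'e) mgraph \<Rightarrow> 'v \<Rightarrow> ('e \<times> 'v) list \<Rightarrow> 'v \<Rightarrow> bool" where
  "walk G u [] v \<longleftrightarrow> u = v \<and> u \<in> gverts G"
| "walk G u ((e, w) # p) v \<longleftrightarrow>
     u \<in> gverts G \<and> e \<in> gedges G \<and> gends G e = {u, w} \<and> walk G w p v"

definition graph_connected :: "('v, 'e) mgraph \<Rightarrow> bool" where
  "graph_connected G \<longleftrightarrow>
     gverts G \<noteq> {} \<and> (\<forall>u\<in>gverts G. \<forall>v\<in>gverts G. \<exists>p. walk G u p v)"

text \<open>Loops and pairs of parallel edges are circuits; going back along the same edge is not.\<close>

definition circuit :: "('v, 'e) mgraph \<Rightarrow> 'v \<Rightarrow> ('e \<times> 'v) list \<Rightarrow> bool" where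
  "circuit G u p \<longleftrightarrow>
     p \<noteq> [] \<and> walk G u p u \<and> distinct (map fst p) \<and> distinct (map snd p)"

definition is_tree :: "('v, 'e) mgraph \<Rightarrow> bool" where
  "is_tree G \<longleftrightarrow> graph_connected G \<and> (\<nexists>u p. circuit G u p)"

definition maximal_tree :: "('v, 'e) mgraph \<Rightarrow> ('v, 'e) mgraph \<Rightarrow> bool" where
  "maximal_tree T G \<longleftrightarrow> subgraph T G \<and> is_tree T \<and>
     (\<forall>T'. subgraph T' G \<and> is_tree T' \<and> subgraph T T' \<longrightarrow> T' = T)"


section \<open>Rays and ends\<close>

definition ray :: "('v, 'e) mgraph \<Rightarrow> (nat \<Rightarrow> 'v) \<Rightarrow> bool" where
  "ray G \<rho> \<longleftrightarrow> inj \<rho> \<and> range \<rho> \<subseteq> gverts G \<and>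
     (\<forall>k. \<exists>e\<in>gedges G. gends G e = {\<rho> k, \<rho> (Suc k)})"

text \<open>The end of a tree represented by a ray: all rays that eventually coincide with it.\<close>

definition end_class :: "('v, 'e) mgraph \<Rightarrow> (nat \<Rightarrow> 'v) \<Rightarrow> (nat \<Rightarrow> 'v) set" where
  "end_class G \<rho> = {\<rho>'. ray G \<rho>' \<and> (\<exists>m n. \<forall>k. \<rho>' (k + m) = \<rho> (k + n))}"

definition contains_end :: "('v, 'e) mgraph \<Rightarrow> (nat \<Rightarrow> 'v) set \<Rightarrow> bool" where
  "contains_end H \<epsilon> \<longleftrightarrow> (\<exists>\<rho>\<in>\<epsilon>. ray H \<rho>)"

definition smallest_subtree ::
    "('v, 'e) mgraph \<Rightarrow> (nat \<Rightarrow> 'v) set set \<Rightarrow> ('v, 'e) mgraph \<Rightarrow> bool" where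
  "smallest_subtree G E S \<longleftrightarrow>
     subgraph S G \<and> is_tree S \<and> (\<forall>\<epsilon>\<in>E. contains_end S \<epsilon>) \<and>
     (\<forall>S'. subgraph S' G \<and> is_tree S' \<and> (\<forall>\<epsilon>\<in>E. contains_end S' \<epsilon>) \<longrightarrow> subgraph S S')"


section \<open>Barycentric subdivision, quotients and fundamental domains\<close>

text \<open>
  Barycentric subdivision of a graph without loops. The original vertices are tagged with
  \<open>Inl\<close>; the barycenter of an edge \<open>e\<close> is \<open>Inr e\<close>. The edge \<open>(v, e)\<close> is the half of \<open>e\<close> at \<open>v\<close>.
\<close>

definition subdivide :: "('v, 'e) mgraph \<Rightarrow> ('v + 'e, 'v \<times> 'e) mgraph" where
  "subdivide G =
     \<lparr>gverts = Inl ` gverts G \<union> Inr ` gedges G,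
      gedges = {(v, e). e \<in> gedges G \<and> v \<in> gends G e},
      gends = (\<lambda>(v, e). {Inl v, Inr e})\<rparr>"

definition orbit_of :: "'g set \<Rightarrow> ('g \<Rightarrow> 'x \<Rightarrow> 'x) \<Rightarrow> 'x \<Rightarrow> 'x set" where
  "orbit_of \<Gamma> act x = (\<lambda>g. act g x) ` \<Gamma>"

text \<open>
  \<open>\<Gamma>\<close> acts on vertices by \<open>av\<close> and on edges by \<open>ae\<close>. The quotient is in general a multigraph;
  the ends of an orbit of edges are the orbits of the ends of its members.
\<close>

definition quotient_graph ::
    "'g set \<Rightarrow> ('g \<Rightarrow> 'v \<Rightarrow> 'v) \<Rightarrow> ('g \<Rightarrow> 'e \<Rightarrow> 'e) \<Rightarrow> ('v, 'e) mgraph \<Rightarrow>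
     ('v set, 'e set) mgraph" where
  "quotient_graph \<Gamma> av ae G =
     \<lparr>gverts = orbit_of \<Gamma> av ` gverts G,
      gedges = orbit_of \<Gamma> ae ` gedges G,
      gends = (\<lambda>h. \<Union>e\<in>h. orbit_of \<Gamma> av ` gends G e)\<rparr>"

text \<open>
  Cutting a graph \<open>Q\<close> at the vertices in \<open>R\<close>: each \<open>b \<in> R\<close> is deleted, and every edge \<open>h\<close> that
  ended at \<open>b\<close> now ends at a new vertex \<open>Inr h\<close> of its own (no edge of \<open>Q\<close> is to have two
  ends in \<open>R\<close>).
\<close>

definition cut_graph :: "('v, 'e) mgraph \<Rightarrow> 'v set \<Rightarrow> ('v + 'e, 'e) mgraph" where
  "cut_graph Q R =
     \<lparr>gverts = Inl ` (gverts Q - R) \<union> Inr ` {h \<in> gedges Q. gends Q h \<inter> R \<noteq> {}},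
      gedges = gedges Q,
      gends = (\<lambda>h. Inl ` (gends Q h - R) \<union> (if gends Q h \<inter> R = {} then {} else {Inr h}))\<rparr>"

text \<open>
  For a quotient \<open>Q\<close> of a subdivided graph and a maximal tree \<open>T\<close> in \<open>Q\<close>: the barycenters of the
  removed edges, an edge being removed if one of its two halves is not in \<open>T\<close>.
\<close>

definition removed_barycenters ::
    "(('v + 'e) set, 'h) mgraph \<Rightarrow> (('v + 'e) set, 'h) mgraph \<Rightarrow> ('v + 'e) set set" where
  "removed_barycenters Q T =
     {b \<in> gverts Q. b \<subseteq> range Inr \<and> (\<exists>h\<in>gedges Q - gedges T. b \<in> gends Q h)}"

text \<open>
  \<open>D\<close> is the image of a lifting \<open>(\<phi>, \<psi>)\<close> of \<open>cut_graph Q R\<close> to a subtree of \<open>G\<close>, where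
  \<open>Q\<close> is a quotient of \<open>G\<close>. A vertex or edge of \<open>Q\<close> is an orbit, so it is lifted to one of its
  elements; a new vertex \<open>Inr h\<close> is lifted to an element of the vertex of \<open>Q\<close> it was cut off from.
\<close>

definition lifted_subtree ::
    "('v, 'e) mgraph \<Rightarrow> ('v set, 'e set) mgraph \<Rightarrow> 'v set set \<Rightarrow> ('v, 'e) mgraph \<Rightarrow> bool" where
  "lifted_subtree G Q R D \<longleftrightarrow>
     subgraph D G \<and> is_tree D \<and>
     (\<exists>\<phi> \<psi>. bij_betw \<phi> (gverts (cut_graph Q R)) (gverts D) \<and>
            bij_betw \<psi> (gedges (cut_graph Q R)) (gedges D) \<and>
            (\<forall>h\<in>gedges (cut_graph Q R). gends G (\<psi> h) = \<phi> ` gends (cut_graph Q R) h) \<and>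
            (\<forall>v\<in>gverts Q - R. \<phi> (Inl v) \<in> v) \<and>
            (\<forall>h. Inr h \<in> gverts (cut_graph Q R) \<longrightarrow> \<phi> (Inr h) \<in> \<Union> (gends Q h \<inter> R)) \<and>
            (\<forall>h\<in>gedges Q. \<psi> h \<in> h))"

text \<open>
  The action on vertices and edges of the subdivision induced by an action \<open>av\<close>, \<open>ae\<close> on a graph.
\<close>

definition sub_vact :: "('g \<Rightarrow> 'v \<Rightarrow> 'v) \<Rightarrow> ('g \<Rightarrow> 'e \<Rightarrow> 'e) \<Rightarrow> 'g \<Rightarrow> 'v + 'e \<Rightarrow> 'v + 'e" where
  "sub_vact av ae g = map_sum (av g) (ae g)"

definition sub_eact :: "('g \<Rightarrow> 'v \<Rightarrow> 'v) \<Rightarrow> ('g \<Rightarrow> 'e \<Rightarrow> 'e) \<Rightarrow> 'g \<Rightarrow> 'v \<times> 'e \<Rightarrow> 'v \<times> 'e" where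
  "sub_eact av ae g = map_prod (av g) (ae g)"

definition subdivision_quotient ::
    "'g set \<Rightarrow> ('g \<Rightarrow> 'v \<Rightarrow> 'v) \<Rightarrow> ('g \<Rightarrow> 'e \<Rightarrow> 'e) \<Rightarrow> ('v, 'e) mgraph \<Rightarrow>
     (('v + 'e) set, ('v \<times> 'e) set) mgraph" where
  "subdivision_quotient \<Gamma> av ae G =
     quotient_graph \<Gamma> (sub_vact av ae) (sub_eact av ae) (subdivide G)"

definition fundamental_domain ::
    "'g set \<Rightarrow> ('g \<Rightarrow> 'v \<Rightarrow> 'v) \<Rightarrow> ('g \<Rightarrow> 'e \<Rightarrow> 'e) \<Rightarrow> ('v, 'e) mgraph \<Rightarrow>
     ('v + 'e, 'v \<times> 'e) mgraph \<Rightarrow> bool" where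
  "fundamental_domain \<Gamma> av ae G D \<longleftrightarrow>
     (\<exists>T. maximal_tree T (subdivision_quotient \<Gamma> av ae G) \<and>
          lifted_subtree (subdivide G) (subdivision_quotient \<Gamma> av ae G)
            (removed_barycenters (subdivision_quotient \<Gamma> av ae G) T) D)"


section \<open>The Bruhat--Tits tree as a ball tree\<close>

text \<open>
  \<open>K\<^sub>\<infinity>\<close> is \<open>'a fls\<close> with \<open>fls_X\<close> in the role of \<open>1/t\<close>, so that the valuation (minus the degree
  in \<open>t\<close>) is \<open>fls_subdegree\<close>, except that \<open>fls_subdegree 0 = 0\<close> instead of \<open>\<infinity>\<close>.
\<close>

definition poly_to_Kinf :: "'a::field poly \<Rightarrow> 'a fls" where
  "poly_to_Kinf p = poly (map_poly fls_const p) fls_X_inv"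

definition vball :: "'a::field fls \<Rightarrow> int \<Rightarrow> 'a fls set" where
  "vball x r = {y. y = x \<or> r \<le> fls_subdegree (y - x)}"

definition vballs :: "'a::field fls set set" where
  "vballs = {vball x r | x r. True}"

definition maximal_subball :: "'a::field fls set \<Rightarrow> 'a fls set \<Rightarrow> bool" where
  "maximal_subball B B' \<longleftrightarrow> B \<in> vballs \<and> B' \<in> vballs \<and> B \<subset> B' \<and>
     (\<nexists>C. C \<in> vballs \<and> B \<subset> C \<and> C \<subset> B')"

definition bt_tree :: "('a::field fls set, 'a fls set set) mgraph" where
  "bt_tree = \<lparr>gverts = vballs, gedges = {{B, B'} | B B'. maximal_subball B B'}, gends = (\<lambda>e. e)\<rparr>"

datatype 'k proj_line = Affine 'k | Infinity

text \<open>
  The balls shrinking to \<open>x\<close> represent the end \<open>x\<close>, increasing balls the end \<open>\<infinity>\<close>.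
\<close>

fun bt_end :: "'a::field fls proj_line \<Rightarrow> (nat \<Rightarrow> 'a fls set) set" where
  "bt_end (Affine x) = end_class bt_tree (\<lambda>k. vball x (int k))"
| "bt_end Infinity = end_class bt_tree (\<lambda>k. vball 0 (- int k))"

text \<open>
  The vertices of the Bruhat--Tits tree are the homothety classes of lattices in \<open>K\<^sub>\<infinity>\<^sup>2\<close>, with the
  linear action on column vectors. The ball \<open>B\<close> is identified with the class of the lattice
  generated by the vectors \<open>(y, 1)\<close>, \<open>y \<in> B\<close>; for \<open>B = vball x r\<close> this is the lattice with basis
  \<open>(fls_X\<^sup>r, 0), (x, 1)\<close>. As the vector \<open>(z, 1)\<close> represents \<open>z\<close>, the action is compatible
  with Moebius transformations on the ends.
\<close>

definition integral_submodule :: "('a::field fls ^ 2) set \<Rightarrow> bool" where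
  "integral_submodule L \<longleftrightarrow> 0 \<in> L \<and> (\<forall>v\<in>L. \<forall>w\<in>L. v + w \<in> L) \<and> (\<forall>a\<in>vball 0 0. \<forall>v\<in>L. a *s v \<in> L)"

definition ball_lattice :: "'a::field fls set \<Rightarrow> ('a fls ^ 2) set" where
  "ball_lattice B = integral_submodule hull {vector [y, 1] | y. y \<in> B}"

definition homothetic :: "('a::field fls ^ 2) set \<Rightarrow> ('a fls ^ 2) set \<Rightarrow> bool" where
  "homothetic L L' \<longleftrightarrow> (\<exists>c. c \<noteq> 0 \<and> L' = (\<lambda>v. c *s v) ` L)"

definition ball_act :: "'a::field fls ^ 2 ^ 2 \<Rightarrow> 'a fls set \<Rightarrow> 'a fls set" where
  "ball_act g B =
     (THE B'. B' \<in> vballs \<and> homothetic ((\<lambda>v. g *v v) ` ball_lattice B) (ball_lattice B'))"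

definition edge_act :: "'a::field fls ^ 2 ^ 2 \<Rightarrow> 'a fls set set \<Rightarrow> 'a fls set set" where
  "edge_act g e = ball_act g ` e"

text \<open>The congruence subgroup, as a subgroup of \<open>GL\<^sub>2(K\<^sub>\<infinity>)\<close>.\<close>

definition congruence_subgroup :: "'a::field poly \<Rightarrow> ('a fls ^ 2 ^ 2) set" where
  "congruence_subgroup N =
     map_matrix poly_to_Kinf ` {A :: 'a poly ^ 2 ^ 2. invertible A \<and> N dvd A $ 2 $ 1}"

end

theory Submission
  imports Defs
begin

text \<open>
  A connected subtree of the Bruhat--Tits tree whose vertices are pairwise inequivalent, and which meets all but finitely many
  orbits of half-edges, grows by finitely many vertices to a connected set of orbit representatives;
  adding one half-edge for each remaining orbit gives a fundamental domain. So two facts about the balls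
  around \<open>0\<close> and the \<open>1/M\<close> are needed. Each such ball is \<open>u\<^sub>M B\<close>, with \<open>B\<close> a ball around \<open>0\<close> and
  \<open>u\<^sub>M = (1 0; M 1)\<close>. If \<open>g\<close> maps \<open>u\<^sub>M B\<close> to \<open>u\<^sub>M\<^sub>' B'\<close>, then \<open>u\<^sub>M\<^sub>'\<^sup>-\<^sup>1 g u\<^sub>M\<close> maps \<open>B\<close> to \<open>B'\<close>, which
  bounds the degrees of its entries, and \<open>N\<close> dividing the lower left entry of \<open>g\<close> forces the balls to agree.
  Conversely, every half-edge is a \<open>GL\<^sub>2(F[t])\<close>-translate \<open>A h\<close> of a half-edge \<open>h\<close> on the line from \<open>0\<close> to
  \<open>\<infinity>\<close> at a ball of radius \<open>-m \<le> 0\<close>. There are finitely many classes \<open>\<Gamma>\<^sub>N A\<close>, hence finitely many orbits with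
  \<open>m < deg N\<close>. Modulo \<open>\<Gamma>\<^sub>N\<close>, \<open>A\<close> is \<open>u\<^sub>M\<close> or the swap times an upper unipotent matrix of degree below \<open>deg N\<close>;
  for \<open>m \<ge> deg N\<close> the latter fixes \<open>h\<close>.
\<close>

unbundle no Formal_Power_Series.fps_syntax

section \<open>Walks and bridges\<close>

text \<open>The ends \<open>1/M\<close> suffice because \<open>N\<close> is square-free. If the
  monic gcd \<open>M\<close> of \<open>N\<close> and the lower left entry \<open>c\<close> is not
  constant, an upper unipotent column operation makes the bottom row \<open>(c, d)\<close>
  proportional to \<open>(M, 1)\<close> modulo \<open>N\<close> once \<open>c\<close> is invertible
  modulo \<open>N/M\<close>, and this needs \<open>M\<close> coprime to \<open>N/M\<close>.
  Half-edges are counted rather than vertices because a fundamental domain also has to represent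
  every edge orbit: finitely many missing vertex orbits alone would not make \<open>f\<close>
  finite. The lines to \<open>1/M\<close> and \<open>1/M'\<close> may share balls outside the line
  from \<open>0\<close> to infinity, so inequivalence is about balls and must tolerate distinct
  \<open>M\<close> and \<open>M'\<close>. A maximal tree of the quotient has to reach the
  barycenters of removed edges as well, so exactly one half of each such edge stays in it. Circuits
  of the quotient are never inspected: its maximal tree is the injective image of a subtree of the
  subdivision, and acyclicity is expressed by cuts, which are easy to transport.\<close>

definition crosses :: "('v, 'e) mgraph \<Rightarrow> 'v set \<Rightarrow> 'e \<Rightarrow> bool" where
  "crosses G W e \<longleftrightarrow> gends G e \<inter> W \<noteq> {} \<and> \<not> gends G e \<subseteq> W"

text \<open>Every edge is a bridge, witnessed by a cut that it alone crosses. This form of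
  acyclicity passes to subgraphs, injective images and subdivisions by transporting
  \<open>W\<close>, without touching walks.\<close>

definition bridged :: "('v, 'e) mgraph \<Rightarrow> bool" where
  "bridged G \<longleftrightarrow> (\<forall>e\<in>gedges G. \<exists>W. \<forall>f\<in>gedges G. crosses G W f \<longleftrightarrow> f = e)"

lemma walk_crosses:
  assumes "walk G u p v" "u \<in> W \<longleftrightarrow> v \<notin> W"
  shows "\<exists>e\<in>set (map fst p). e \<in> gedges G \<and> crosses G W e"
  using assms
proof (induction p arbitrary: u)
  case (Cons a p)
  obtain e w where a: "a = (e, w)" by (cases a)
  show ?case
  proof (cases "w \<in> W \<longleftrightarrow> v \<notin> W")
    case True
    then show ?thesis using Cons.IH[of w] Cons.prems a by auto
  next
    case False
    then show ?thesis using Cons.prems a by (auto simp: crosses_def)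
  qed
qed auto

text \<open>The part of a circuit after its first edge \<open>e\<close> has to return across the cut
  that only \<open>e\<close> crosses, so it would use \<open>e\<close> a second time.\<close>

lemma bridged_no_circuit:
  assumes "bridged G"
  shows "\<not> circuit G u p"
proof
  assume c: "circuit G u p"
  then obtain e w q where p: "p = (e, w) # q"
    unfolding circuit_def by (cases p) auto
  have e: "e \<in> gedges G" "gends G e = {u, w}" and q: "walk G w q u" and d: "e \<notin> set (map fst q)"
    using c p by (auto simp: circuit_def)
  obtain W where W: "\<And>f. f \<in> gedges G \<Longrightarrow> crosses G W f \<longleftrightarrow> f = e"
    using assms e unfolding bridged_def by blast
  have "w \<in> W \<longleftrightarrow> u \<notin> W"
    using W[OF e(1)] e(2) by (auto simp: crosses_def)
  from walk_crosses[OF q this] W d show False by blast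
qed

lemma bridged_subgraph:
  assumes "bridged G" "subgraph H G"
  shows "bridged H"
proof -
  have "gedges H \<subseteq> gedges G" "\<And>W f. crosses H W f \<longleftrightarrow> crosses G W f"
    using assms(2) by (auto simp: subgraph_def crosses_def)
  then show ?thesis using assms(1) unfolding bridged_def by (metis subsetD)
qed

lemma bridged_image:
  assumes "bridged G"
    and edges: "\<And>e. e \<in> gedges G \<Longrightarrow> gends G e \<subseteq> gverts G"
    and inj: "inj_on \<pi> (gverts G)"
    and surj: "gedges H = \<psi> ` gedges G"
    and ends: "\<And>e. e \<in> gedges G \<Longrightarrow> gends H (\<psi> e) = \<pi> ` gends G e"
    and inje: "inj_on \<psi> (gedges G)"
  shows "bridged H"
  unfolding bridged_def
proof
  fix e' assume "e' \<in> gedges H"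
  then obtain e where e: "e \<in> gedges G" "e' = \<psi> e" using surj by auto
  obtain W where W: "\<And>f. f \<in> gedges G \<Longrightarrow> crosses G W f \<longleftrightarrow> f = e"
    using assms(1) e unfolding bridged_def by blast
  \<comment> \<open>Since \<open>\<pi>\<close> is injective only on \<open>gverts G\<close>, the cut
    is restricted to vertices before it is mapped.\<close>
  have "crosses H (\<pi> ` (W \<inter> gverts G)) (\<psi> f) \<longleftrightarrow> \<psi> f = \<psi> e" if f: "f \<in> gedges G" for f
  proof -
    have "crosses H (\<pi> ` (W \<inter> gverts G)) (\<psi> f) \<longleftrightarrow> crosses G W f"
      using edges[OF f] inj ends[OF f] unfolding crosses_def
      by (auto simp: inj_on_def) blast+
    then show ?thesis using W[OF f] inje f e(1) by (auto dest: inj_onD)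
  qed
  then show "\<exists>W. \<forall>f\<in>gedges H. crosses H W f \<longleftrightarrow> f = e'"
    unfolding surj e(2) by (intro exI[of _ "\<pi> ` (W \<inter> gverts G)"] ballI) auto
qed

lemma bridged_subdivide:
  assumes "bridged G" and two: "\<And>e. e \<in> gedges G \<Longrightarrow> \<exists>u v. u \<noteq> v \<and> gends G e = {u, v}"
  shows "bridged (subdivide G)"
  unfolding bridged_def
proof
  fix h assume "h \<in> gedges (subdivide G)"
  then obtain v e where h: "h = (v, e)" "e \<in> gedges G" "v \<in> gends G e"
    by (auto simp: subdivide_def)
  obtain W where W: "\<And>f. f \<in> gedges G \<Longrightarrow> crosses G W f \<longleftrightarrow> f = e"
    using assms(1) h(2) unfolding bridged_def by blast
  \<comment> \<open>Only the half of \<open>e\<close> at \<open>v\<close> may cross. The barycenter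
    of any other edge joins the common side of its two ends; that of \<open>e\<close> is put on the
    side opposite to \<open>v\<close>, where the other end of \<open>e\<close> lies.\<close>
  define W' where "W' = Inl ` W \<union> Inr ` {f. f \<noteq> e \<and> gends G f \<subseteq> W} \<union> (if v \<in> W then {} else {Inr e})"
  have "crosses (subdivide G) W' k \<longleftrightarrow> k = h" if k: "k \<in> gedges (subdivide G)" for k
  proof -
    obtain w f where f: "k = (w, f)" "f \<in> gedges G" "w \<in> gends G f"
      using k by (auto simp: subdivide_def)
    have cr: "crosses (subdivide G) W' k \<longleftrightarrow> (Inl w \<in> W' \<longleftrightarrow> Inr f \<notin> W')"
      using f by (auto simp: crosses_def subdivide_def)
    have w: "Inl w \<in> W' \<longleftrightarrow> w \<in> W" by (auto simp: W'_def)
    show ?thesis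
    proof (cases "f = e")
      case False
      then have "\<not> crosses G W f" using W f(2) by blast
      then have "w \<in> W \<longleftrightarrow> gends G f \<subseteq> W" using f(3) by (auto simp: crosses_def)
      moreover have "Inr f \<in> W' \<longleftrightarrow> gends G f \<subseteq> W" using False by (auto simp: W'_def)
      ultimately show ?thesis using cr w False f h by auto
    next
      case True
      have "Inr f \<in> W' \<longleftrightarrow> v \<notin> W" using True by (auto simp: W'_def)
      moreover obtain x y where xy: "gends G e = {x, y}" using two[OF h(2)] by blast
      moreover have "crosses G W e" using W h(2) by blast
      ultimately show ?thesis using cr w True f h unfolding crosses_def by auto
    qed
  qed
  then show "\<exists>W. \<forall>f\<in>gedges (subdivide G). crosses (subdivide G) W f \<longleftrightarrow> f = h" by blast
qed

section \<open>Reachability, connectedness and maximal trees\<close>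

definition reachable :: "('v, 'e) mgraph \<Rightarrow> 'v \<Rightarrow> 'v \<Rightarrow> bool" where
  "reachable G u v \<longleftrightarrow> (\<exists>p. walk G u p v)"

lemma reachable_refl: "u \<in> gverts G \<Longrightarrow> reachable G u u"
  unfolding reachable_def by (rule exI[of _ "[]"]) simp

lemma reachable_Cons:
  assumes "u \<in> gverts G" "e \<in> gedges G" "gends G e = {u, w}" "reachable G w v"
  shows "reachable G u v"
proof -
  obtain p where "walk G w p v" using assms(4) by (auto simp: reachable_def)
  then have "walk G u ((e, w) # p) v" using assms by simp
  then show ?thesis unfolding reachable_def by blast
qed

lemma walk_append: "walk G u p v \<Longrightarrow> walk G v q w \<Longrightarrow> walk G u (p @ q) w"
  by (induction G u p v rule: walk.induct) auto

lemma walk_verts: "walk G u p v \<Longrightarrow> u \<in> gverts G \<and> v \<in> gverts G \<and> snd ` set p \<subseteq> gverts G"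
  by (induction G u p v rule: walk.induct) (auto split: if_splits elim: walk.elims)

lemma reachable_verts: "reachable G u v \<Longrightarrow> u \<in> gverts G \<and> v \<in> gverts G"
  using walk_verts by (fastforce simp: reachable_def)

lemma reachable_trans: "reachable G u v \<Longrightarrow> reachable G v w \<Longrightarrow> reachable G u w"
  unfolding reachable_def using walk_append by metis

lemma reachable_sym: "reachable G u v \<Longrightarrow> reachable G v u"
proof -
  assume "reachable G u v"
  then obtain p where "walk G u p v" by (auto simp: reachable_def)
  then show ?thesis
  proof (induction p arbitrary: u)
    case Nil
    then show ?case by (auto intro: reachable_refl)
  next
    case (Cons a p)
    obtain e w where a: "a = (e, w)" by (cases a)
    with Cons have vw: "reachable G v w" by auto
    have "reachable G w u"
      using Cons.prems a reachable_verts[OF vw]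
      by (intro reachable_Cons[of w G e u]) (auto intro: reachable_refl)
    with vw show ?case by (rule reachable_trans)
  qed
qed

lemma reachable_edge:
  assumes "u \<in> gverts G" "w \<in> gverts G" "e \<in> gedges G" "gends G e = {u, w}"
  shows "reachable G u w"
  using assms by (intro reachable_Cons[of u G e w]) (auto intro: reachable_refl)

lemma graph_connectedI:
  assumes "r \<in> gverts G" "\<And>v. v \<in> gverts G \<Longrightarrow> reachable G v r"
  shows "graph_connected G"
  unfolding graph_connected_def
  using assms by (metis empty_iff reachable_def reachable_sym reachable_trans)

lemma graph_connected_reachable:
  "graph_connected G \<Longrightarrow> u \<in> gverts G \<Longrightarrow> v \<in> gverts G \<Longrightarrow> reachable G u v"
  by (auto simp: graph_connected_def reachable_def)

lemma reachable_image:
  assumes "reachable G u v"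
    and verts: "\<And>v. v \<in> gverts G \<Longrightarrow> \<pi> v \<in> gverts H"
    and edges: "\<And>u v e. e \<in> gedges G \<Longrightarrow> gends G e = {u, v} \<Longrightarrow> u \<in> gverts G \<Longrightarrow> v \<in> gverts G \<Longrightarrow>
       reachable H (\<pi> u) (\<pi> v)"
  shows "reachable H (\<pi> u) (\<pi> v)"
proof -
  obtain p where "walk G u p v" using assms by (auto simp: reachable_def)
  then show ?thesis
  proof (induction p arbitrary: u)
    case Nil
    then show ?case by (auto intro: reachable_refl verts)
  next
    case (Cons a p)
    obtain e w where a: "a = (e, w)" by (cases a)
    from Cons a have "reachable H (\<pi> w) (\<pi> v)" "walk G w p v" by auto
    then show ?case
      using edges[of e u w] Cons.prems a walk_verts[of G w p v] reachable_trans by fastforce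
  qed
qed

lemma reachable_subgraph:
  assumes "reachable H u v" "subgraph H G"
  shows "reachable G u v"
proof -
  have "reachable G (id u) (id v)"
    using assms(1)
  proof (rule reachable_image)
    fix u v e assume "e \<in> gedges H" "gends H e = {u, v}" "u \<in> gverts H" "v \<in> gverts H"
    then show "reachable G (id u) (id v)"
      using assms(2) by (auto simp: subgraph_def intro!: reachable_edge[of _ _ _ e])
  qed (use assms(2) in \<open>auto simp: subgraph_def\<close>)
  then show ?thesis by simp
qed

lemma walk_simple:
  assumes "walk G u p v"
  shows "\<exists>q. walk G u q v \<and> distinct (u # map snd q) \<and> distinct (map fst q)"
  using assms
proof (induction p arbitrary: u)
  case Nil
  then show ?case by (intro exI[of _ "[]"]) auto
next
  case (Cons a p)
  obtain e w where a: "a = (e, w)" by (cases a)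
  with Cons obtain q where q: "walk G w q v" "distinct (w # map snd q)" "distinct (map fst q)"
    by fastforce
  have u: "u \<in> gverts G" "e \<in> gedges G" "gends G e = {u, w}" using Cons.prems a by auto
  \<comment> \<open>The ends of the edges of \<open>q\<close> are all vertices of \<open>q\<close>.
    When \<open>u\<close> is not one of these, the edge \<open>e\<close> at \<open>u\<close> cannot
    occur in \<open>q\<close>.\<close>
  have ends: "\<And>f. f \<in> fst ` set q \<Longrightarrow> gends G f \<subseteq> insert w (snd ` set q)"
    using q(1)
  proof (induction q arbitrary: w)
    case (Cons b q)
    then show ?case by (cases b) fastforce
  qed auto
  show ?case
  proof (cases "u \<in> set (w # map snd q)")
    case False
    then have "e \<notin> fst ` set q" using ends u(3) by fastforce
    then show ?thesis using q u False by (intro exI[of _ "(e, w) # q"]) auto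
  next
    case True
    show ?thesis
    proof (cases "u = w")
      case True
      then show ?thesis using q by auto
    next
      case False
      with True obtain f where "(f, u) \<in> set q" by auto
      then obtain xs ys where s: "q = xs @ (f, u) # ys" by (auto dest: split_list)
      have "walk G u ys v" using q(1) unfolding s
        by (induction xs arbitrary: w) auto
      then show ?thesis using q(2,3) s by (intro exI[of _ ys]) auto
    qed
  qed
qed

text \<open>An additional edge closes a circuit with the simple walk in \<open>T\<close> between its
  ends. For a loop this walk is empty and the loop itself is the circuit.\<close>

lemma spanning_tree_maximal:
  assumes tree: "is_tree T" and sub: "subgraph T G" and span: "gverts T = gverts G"
    and ends: "\<And>e. e \<in> gedges G \<Longrightarrow> \<exists>u v. gends G e = {u, v} \<and> u \<in> gverts G \<and> v \<in> gverts G"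
  shows "maximal_tree T G"
  unfolding maximal_tree_def
proof (intro conjI allI impI tree sub)
  fix T' assume T': "subgraph T' G \<and> is_tree T' \<and> subgraph T T'"
  have "gedges T' \<subseteq> gedges T"
  proof
    fix e assume e: "e \<in> gedges T'"
    show "e \<in> gedges T"
    proof (rule ccontr)
      assume ne: "e \<notin> gedges T"
      have "e \<in> gedges G" using T' e by (auto simp: subgraph_def)
      then obtain u w where uw: "gends G e = {u, w}" "u \<in> gverts T" "w \<in> gverts T"
        using ends span by metis
      then obtain p where "walk T w p u"
        using tree unfolding is_tree_def graph_connected_def by blast
      then obtain q where q: "walk T w q u" "distinct (w # map snd q)" "distinct (map fst q)"
        using walk_simple by metis
      have mono: "walk T x q y \<Longrightarrow> walk T' x q y \<and> fst ` set q \<subseteq> gedges T" for x q y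
      proof (induction q arbitrary: x)
        case Nil
        then show ?case using T' by (auto simp: subgraph_def)
      next
        case (Cons b q)
        then show ?case using T' by (cases b) (auto simp: subgraph_def)
      qed
      have "gends T' e = {u, w}" "u \<in> gverts T'"
        using uw T' by (auto simp: subgraph_def)
      then have "circuit T' u ((e, w) # q)"
        using q mono[OF q(1)] ne e uw(2) unfolding circuit_def by auto
      then show False using T' by (auto simp: is_tree_def)
    qed
  qed
  moreover have "gverts T' \<subseteq> gverts T" using T' span by (auto simp: subgraph_def)
  ultimately show "T' = T" using T' by (intro mgraph.equality) (auto simp: subgraph_def)
qed

section \<open>Fundamental domains of group actions on trees\<close>

text \<open>The group laws are demanded only for the effect on \<open>X\<close>: the matrices form a
  bare set, and \<open>ball_act\<close> is known to be an action only on
  \<open>vballs\<close>.\<close>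

locale set_action =
  fixes \<Gamma> :: "'g set" and act :: "'g \<Rightarrow> 'x \<Rightarrow> 'x" and X :: "'x set"
  assumes closed: "g \<in> \<Gamma> \<Longrightarrow> x \<in> X \<Longrightarrow> act g x \<in> X"
    and unit: "\<exists>e\<in>\<Gamma>. \<forall>x\<in>X. act e x = x"
    and comp: "g \<in> \<Gamma> \<Longrightarrow> h \<in> \<Gamma> \<Longrightarrow> \<exists>k\<in>\<Gamma>. \<forall>x\<in>X. act k x = act g (act h x)"
    and inverse: "g \<in> \<Gamma> \<Longrightarrow> \<exists>h\<in>\<Gamma>. \<forall>x\<in>X. act h (act g x) = x"
begin

lemma orbit_self: "x \<in> X \<Longrightarrow> x \<in> orbit_of \<Gamma> act x"
  using unit unfolding orbit_of_def by (metis image_iff)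

lemma orbit_subset: "x \<in> X \<Longrightarrow> orbit_of \<Gamma> act x \<subseteq> X"
  using closed by (auto simp: orbit_of_def)

lemma orbit_act_subset:
  assumes "x \<in> X" "g \<in> \<Gamma>"
  shows "orbit_of \<Gamma> act (act g x) \<subseteq> orbit_of \<Gamma> act x"
proof
  fix z assume "z \<in> orbit_of \<Gamma> act (act g x)"
  then obtain h where "h \<in> \<Gamma>" "z = act h (act g x)" by (auto simp: orbit_of_def)
  moreover obtain k where "k \<in> \<Gamma>" "act k x = act h (act g x)"
    using comp[of h g] \<open>h \<in> \<Gamma>\<close> assms by blast
  ultimately show "z \<in> orbit_of \<Gamma> act x" unfolding orbit_of_def by (metis imageI)
qed

lemma orbit_act:
  assumes "x \<in> X" "g \<in> \<Gamma>"
  shows "orbit_of \<Gamma> act (act g x) = orbit_of \<Gamma> act x"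
proof -
  obtain h where "h \<in> \<Gamma>" "act h (act g x) = x" using inverse assms by metis
  then show ?thesis
    using orbit_act_subset[OF assms] orbit_act_subset[of "act g x" h] closed assms by auto
qed

lemma orbit_eq: "x \<in> X \<Longrightarrow> y \<in> orbit_of \<Gamma> act x \<Longrightarrow> orbit_of \<Gamma> act y = orbit_of \<Gamma> act x"
  using orbit_act by (auto simp: orbit_of_def[of _ _ x])

end

text \<open>As in \<open>bt_tree\<close>, an edge is its own set of ends, so a vertex set is enough
  to name each full subgraph used below.\<close>

definition induced :: "'v set set \<Rightarrow> 'v set \<Rightarrow> ('v, 'v set) mgraph" where
  "induced E S = \<lparr>gverts = S, gedges = {e \<in> E. e \<subseteq> S}, gends = (\<lambda>e. e)\<rparr>"

lemma induced_simps [simp]: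
  "gverts (induced E S) = S" "gedges (induced E S) = {e \<in> E. e \<subseteq> S}" "gends (induced E S) = (\<lambda>e. e)"
  by (auto simp: induced_def)

lemma subdivide_simps [simp]:
  "gverts (subdivide G) = Inl ` gverts G \<union> Inr ` gedges G"
  "gedges (subdivide G) = {(v, e). e \<in> gedges G \<and> v \<in> gends G e}"
  "gends (subdivide G) = (\<lambda>(v, e). {Inl v, Inr e})"
  by (auto simp: subdivide_def)

lemma is_treeI: "bridged G \<Longrightarrow> graph_connected G \<Longrightarrow> is_tree G"
  unfolding is_tree_def by (metis bridged_no_circuit)

section \<open>The quotient of a subdivided tree\<close>

locale tree_action =
  set_action \<Gamma> av V
  for \<Gamma> :: "'g set" and av :: "'g \<Rightarrow> 'v \<Rightarrow> 'v" and V :: "'v set" +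
  fixes E :: "'v set set" and ae :: "'g \<Rightarrow> 'v set \<Rightarrow> 'v set"
  assumes edge2: "e \<in> E \<Longrightarrow> \<exists>u v. u \<noteq> v \<and> u \<in> V \<and> v \<in> V \<and> e = {u, v}"
    and edge_closed: "g \<in> \<Gamma> \<Longrightarrow> e \<in> E \<Longrightarrow> av g ` e \<in> E"
    and ae_image: "ae g e = av g ` e"
    and no_inversion: "g \<in> \<Gamma> \<Longrightarrow> e \<in> E \<Longrightarrow> v \<in> e \<Longrightarrow> av g ` e = e \<Longrightarrow> av g v = v"
    and connected: "graph_connected (induced E V)"
    and bridged: "bridged (induced E V)"
    and no_isolated: "v \<in> V \<Longrightarrow> \<exists>e\<in>E. v \<in> e"
begin

abbreviation "G \<equiv> induced E V"
abbreviation "Q \<equiv> subdivision_quotient \<Gamma> av ae G"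
abbreviation "ov \<equiv> orbit_of \<Gamma> (sub_vact av ae)"
abbreviation "oe \<equiv> orbit_of \<Gamma> (sub_eact av ae)"

lemma edge_subset: "e \<in> E \<Longrightarrow> e \<subseteq> V"
  using edge2 by blast

sublocale vS: set_action \<Gamma> "sub_vact av ae" "gverts (subdivide G)"
proof
  fix g x assume "g \<in> \<Gamma>" "x \<in> gverts (subdivide G)"
  then show "sub_vact av ae g x \<in> gverts (subdivide G)"
    using closed edge_closed edge_subset by (auto simp: sub_vact_def ae_image)
next
  obtain e where e: "e \<in> \<Gamma>" "\<And>x. x \<in> V \<Longrightarrow> av e x = x" using unit by blast
  then have "\<And>d. d \<subseteq> V \<Longrightarrow> av e ` d = d" by force
  with e show "\<exists>e\<in>\<Gamma>. \<forall>x\<in>gverts (subdivide G). sub_vact av ae e x = x"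
    using edge_subset by (intro bexI[of _ e]) (auto simp: sub_vact_def ae_image)
next
  fix g h assume "g \<in> \<Gamma>" "h \<in> \<Gamma>"
  then obtain k where k: "k \<in> \<Gamma>" "\<And>x. x \<in> V \<Longrightarrow> av k x = av g (av h x)" using comp by blast
  then have "\<And>d. d \<subseteq> V \<Longrightarrow> av k ` d = av g ` av h ` d" by force
  with k show "\<exists>k\<in>\<Gamma>. \<forall>x\<in>gverts (subdivide G). sub_vact av ae k x = sub_vact av ae g (sub_vact av ae h x)"
    using edge_subset by (intro bexI[of _ k]) (auto simp: sub_vact_def ae_image)
next
  fix g assume "g \<in> \<Gamma>"
  then obtain h where h: "h \<in> \<Gamma>" "\<And>x. x \<in> V \<Longrightarrow> av h (av g x) = x" using inverse by blast
  then have "\<And>d. d \<subseteq> V \<Longrightarrow> av h ` av g ` d = d" by force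
  with h show "\<exists>h\<in>\<Gamma>. \<forall>x\<in>gverts (subdivide G). sub_vact av ae h (sub_vact av ae g x) = x"
    using edge_subset by (intro bexI[of _ h]) (auto simp: sub_vact_def ae_image)
qed

lemma half_edge_verts:
  "(v, e) \<in> gedges (subdivide G) \<Longrightarrow> Inl v \<in> gverts (subdivide G) \<and> Inr e \<in> gverts (subdivide G)"
  using edge_subset by auto

sublocale eS: set_action \<Gamma> "sub_eact av ae" "gedges (subdivide G)"
proof
  fix g x assume g: "g \<in> \<Gamma>" and x: "x \<in> gedges (subdivide G)"
  obtain v e where ve: "x = (v, e)" "e \<in> E" "v \<in> e" using x by auto
  then have "av g ` e \<in> E" using edge_closed g by blast
  then show "sub_eact av ae g x \<in> gedges (subdivide G)"
    using edge_subset ve by (auto simp: sub_eact_def ae_image)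
next
  obtain e where e: "e \<in> \<Gamma>" "\<And>x. x \<in> gverts (subdivide G) \<Longrightarrow> sub_vact av ae e x = x"
    using vS.unit by blast
  have "sub_eact av ae e (v, d) = (v, d)" if "(v, d) \<in> gedges (subdivide G)" for v d
    using half_edge_verts[OF that] e(2)[of "Inl v"] e(2)[of "Inr d"] by (auto simp: sub_vact_def sub_eact_def)
  with e(1) show "\<exists>e\<in>\<Gamma>. \<forall>x\<in>gedges (subdivide G). sub_eact av ae e x = x" by fast
next
  fix g h assume "g \<in> \<Gamma>" "h \<in> \<Gamma>"
  then obtain k where k: "k \<in> \<Gamma>" "\<And>x. x \<in> gverts (subdivide G) \<Longrightarrow>
      sub_vact av ae k x = sub_vact av ae g (sub_vact av ae h x)" using vS.comp by blast
  have "sub_eact av ae k (v, d) = sub_eact av ae g (sub_eact av ae h (v, d))"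
    if "(v, d) \<in> gedges (subdivide G)" for v d
    using half_edge_verts[OF that] k(2)[of "Inl v"] k(2)[of "Inr d"] by (auto simp: sub_vact_def sub_eact_def)
  with k(1) show "\<exists>k\<in>\<Gamma>. \<forall>x\<in>gedges (subdivide G). sub_eact av ae k x = sub_eact av ae g (sub_eact av ae h x)"
    by fast
next
  fix g assume "g \<in> \<Gamma>"
  then obtain h where h: "h \<in> \<Gamma>" "\<And>x. x \<in> gverts (subdivide G) \<Longrightarrow>
      sub_vact av ae h (sub_vact av ae g x) = x" using vS.inverse by blast
  have "sub_eact av ae h (sub_eact av ae g (v, d)) = (v, d)"
    if "(v, d) \<in> gedges (subdivide G)" for v d
    using half_edge_verts[OF that] h(2)[of "Inl v"] h(2)[of "Inr d"] by (auto simp: sub_vact_def sub_eact_def)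
  with h(1) show "\<exists>h\<in>\<Gamma>. \<forall>x\<in>gedges (subdivide G). sub_eact av ae h (sub_eact av ae g x) = x"
    by fast
qed

lemma ov_Inl: "ov (Inl v) = Inl ` orbit_of \<Gamma> av v"
  by (auto simp: orbit_of_def sub_vact_def)

lemma ov_Inr: "ov (Inr e) = Inr ` orbit_of \<Gamma> ae e"
  by (auto simp: orbit_of_def sub_vact_def)

lemma oe_fst: "fst ` oe (v, e) = orbit_of \<Gamma> av v"
  by (auto simp: orbit_of_def sub_eact_def image_image)

lemma oe_ov: "(w, d) \<in> oe (v, e) \<Longrightarrow> Inl w \<in> ov (Inl v) \<and> Inr d \<in> ov (Inr e)"
  by (auto simp: orbit_of_def sub_eact_def sub_vact_def)

lemma Q_simps:
  "gverts Q = ov ` gverts (subdivide G)" "gedges Q = oe ` gedges (subdivide G)"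
  by (simp_all add: subdivision_quotient_def quotient_graph_def del: subdivide_simps)

text \<open>All members of an edge orbit have equivalent ends, so the union in
  \<open>quotient_graph\<close> repeats one and the same set.\<close>

lemma Q_ends:
  assumes k: "k \<in> gedges (subdivide G)"
  shows "gends Q (oe k) = ov ` gends (subdivide G) k"
proof -
  obtain v e where ve: "k = (v, e)" by (cases k)
  have "ov ` gends (subdivide G) x = ov ` gends (subdivide G) k" if "x \<in> oe k" for x
  proof -
    obtain w d where wd: "x = (w, d)" by (cases x)
    have "ov (Inl w) = ov (Inl v)" "ov (Inr d) = ov (Inr e)"
      using oe_ov[of w d v e] that wd ve half_edge_verts[of v e] k vS.orbit_eq by auto
    then show ?thesis using ve wd by simp
  qed
  then have "gends Q (oe k) = (\<Union>x\<in>oe k. ov ` gends (subdivide G) k)"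
    by (simp add: subdivision_quotient_def quotient_graph_def del: subdivide_simps)
  then show ?thesis using eS.orbit_self[OF k] by auto
qed

section \<open>Connected partial transversals of the vertex orbits\<close>

definition inequivalent :: "'v set \<Rightarrow> bool" where
  "inequivalent S \<longleftrightarrow> (\<forall>u\<in>S. \<forall>g\<in>\<Gamma>. av g u \<in> S \<longrightarrow> av g u = u)"

text \<open>A walk from \<open>S\<close> to a missing orbit leaves the union \<open>W\<close> of the
  orbits meeting \<open>S\<close> along some edge. A translate of this edge has its end in
  \<open>W\<close> moved into \<open>S\<close>; the other end is the vertex to add. It keeps the set
  connected and uses up one missing orbit.\<close>

lemma extend_to_transversal:
  assumes "finite (orbit_of \<Gamma> av ` V - orbit_of \<Gamma> av ` S)"
    and "S \<subseteq> V" "graph_connected (induced E S)" "inequivalent S"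
  shows "\<exists>Y. S \<subseteq> Y \<and> Y \<subseteq> V \<and> finite (Y - S) \<and> graph_connected (induced E Y) \<and> inequivalent Y \<and>
     orbit_of \<Gamma> av ` V = orbit_of \<Gamma> av ` Y"
  using assms
proof (induction "card (orbit_of \<Gamma> av ` V - orbit_of \<Gamma> av ` S)" arbitrary: S rule: less_induct)
  case less
  show ?case
  proof (cases "orbit_of \<Gamma> av ` V \<subseteq> orbit_of \<Gamma> av ` S")
    case True
    then show ?thesis using less.prems by (intro exI[of _ S]) auto
  next
    case False
    then obtain v where v: "v \<in> V" "orbit_of \<Gamma> av v \<notin> orbit_of \<Gamma> av ` S" by auto
    obtain s where s: "s \<in> S" using less.prems(3) by (auto simp: graph_connected_def)
    then obtain p where p: "walk G s p v"
      using connected v less.prems(2) unfolding graph_connected_def induced_simps by blast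
    define W where "W = {x. orbit_of \<Gamma> av x \<in> orbit_of \<Gamma> av ` S}"
    have "s \<in> W \<longleftrightarrow> v \<notin> W" using s v by (auto simp: W_def)
    from walk_crosses[OF p this] obtain e where e: "e \<in> E" "e \<inter> W \<noteq> {}" "\<not> e \<subseteq> W"
      by (auto simp: crosses_def)
    obtain a b where ab: "e = {a, b}" "a \<in> W" "b \<notin> W" "a \<in> V" "b \<in> V"
      using edge2[OF e(1)] e(2,3) by auto
    then obtain y where y: "y \<in> S" "orbit_of \<Gamma> av a = orbit_of \<Gamma> av y" by (auto simp: W_def)
    then have "y \<in> orbit_of \<Gamma> av a" using less.prems(2) ab orbit_self by auto
    then obtain g where g: "g \<in> \<Gamma>" "y = av g a" by (auto simp: orbit_of_def)
    define c where "c = av g b"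
    have c: "c \<in> V" "c \<notin> W" "{y, c} \<in> E"
      using closed g ab orbit_act[of b g] edge_closed[OF g(1) e(1)]
      by (auto simp: c_def W_def)
    have yW: "S \<subseteq> W" by (auto simp: W_def)
    define Y where "Y = insert c S"
    have YV: "Y \<subseteq> V" using less.prems(2) c by (auto simp: Y_def)
    have con: "graph_connected (induced E Y)"
    proof (rule graph_connectedI[of y])
      show "y \<in> gverts (induced E Y)" using y by (auto simp: Y_def)
      fix x assume "x \<in> gverts (induced E Y)"
      then consider "x = c" | "x \<in> S" by (auto simp: Y_def)
      then show "reachable (induced E Y) x y"
      proof cases
        case 1
        then show ?thesis using c y by (intro reachable_edge[of _ _ _ "{y, c}"]) (auto simp: Y_def)
      next
        case 2
        then have "reachable (induced E S) x y"
          using less.prems(3) y by (auto intro: graph_connected_reachable)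
        then show ?thesis by (rule reachable_subgraph) (auto simp: subgraph_def Y_def)
      qed
    qed
    have ineq: "inequivalent Y"
    proof -
      have key: "x \<in> W" if "x \<in> V" "g \<in> \<Gamma>" "av g x \<in> S" for x g
        using that orbit_act[of x g] by (auto simp: W_def)
      have key2: "av g x \<in> W" if "x \<in> S" "g \<in> \<Gamma>" for x g
        using that orbit_act[of x g] less.prems(2) by (auto simp: W_def)
      have c1: "av g c \<notin> S" if "g \<in> \<Gamma>" for g using key[OF c(1) that] c(2) by blast
      have c2: "av g x \<noteq> c" if "x \<in> S" "g \<in> \<Gamma>" for x g using key2[OF that] c(2) by auto
      show ?thesis
        using less.prems(4) c1 c2 unfolding inequivalent_def Y_def by (metis insert_iff)
    qed
    have "orbit_of \<Gamma> av c \<notin> orbit_of \<Gamma> av ` S" using c(2) by (auto simp: W_def)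
    then have sub: "orbit_of \<Gamma> av ` V - orbit_of \<Gamma> av ` Y \<subset> orbit_of \<Gamma> av ` V - orbit_of \<Gamma> av ` S"
      using c(1) by (auto simp: Y_def)
    have less_card: "card (orbit_of \<Gamma> av ` V - orbit_of \<Gamma> av ` Y) < card (orbit_of \<Gamma> av ` V - orbit_of \<Gamma> av ` S)"
      using less.prems(1) sub by (rule psubset_card_mono)
    have fin: "finite (orbit_of \<Gamma> av ` V - orbit_of \<Gamma> av ` Y)"
      using less.prems(1) sub by (rule finite_subset[OF psubset_imp_subset, rotated])
    obtain Z where Z: "Y \<subseteq> Z" "Z \<subseteq> V" "finite (Z - Y)" "graph_connected (induced E Z)"
      "inequivalent Z" "orbit_of \<Gamma> av ` V = orbit_of \<Gamma> av ` Z"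
      using less.hyps[OF less_card fin YV con ineq] by (elim exE conjE)
    have "Z - S \<subseteq> insert c (Z - Y)" by (auto simp: Y_def)
    then have "finite (Z - S)" using Z(3) by (meson finite_insert finite_subset)
    then show ?thesis using Z by (intro exI[of _ Z]) (auto simp: Y_def)
  qed
qed

section \<open>Lifting the cut quotient over a connected transversal\<close>

context
  fixes Y :: "'v set"
  assumes YV: "Y \<subseteq> V" and conY: "graph_connected (induced E Y)" and ineqY: "inequivalent Y"
    and transY: "orbit_of \<Gamma> av ` V = orbit_of \<Gamma> av ` Y"
begin

definition "EY = {e \<in> E. e \<subseteq> Y}"
definition "HY = gedges (subdivide (induced E Y))"
definition "ZY = gverts (subdivide (induced E Y))"
text \<open>Edges with no translate in the tree on \<open>Y\<close>. Their orbits turn out to be the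
  removed edges of the quotient.\<close>

definition "bad = {e \<in> E. orbit_of \<Gamma> ae e \<inter> EY = {}}"

lemma HY_iff: "(v, e) \<in> HY \<longleftrightarrow> e \<in> EY \<and> v \<in> e"
  by (auto simp: HY_def EY_def)

lemma ZY_eq: "ZY = Inl ` Y \<union> Inr ` EY"
  by (auto simp: ZY_def EY_def)

lemma HY_sub: "HY \<subseteq> gedges (subdivide G)"
  using YV by (auto simp: HY_def)

lemma ZY_sub: "ZY \<subseteq> gverts (subdivide G)"
  using YV by (auto simp: ZY_def)

lemma EY_inj:
  assumes "e \<in> EY" "d \<in> EY" "d \<in> orbit_of \<Gamma> ae e"
  shows "d = e"
proof -
  obtain g where g: "g \<in> \<Gamma>" "d = av g ` e" using assms(3) by (auto simp: orbit_of_def ae_image)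
  have "av g x = x" if "x \<in> e" for x
    using ineqY g assms that unfolding inequivalent_def EY_def by blast
  then show ?thesis using g by force
qed

lemma ZY_inj:
  assumes "x \<in> ZY" "z \<in> ZY" "z \<in> ov x"
  shows "z = x"
proof (cases x)
  case (Inl u)
  then show ?thesis
    using assms ineqY unfolding Inl ov_Inl ZY_eq inequivalent_def by (auto simp: orbit_of_def)
next
  case (Inr e)
  then obtain d where "z = Inr d" "d \<in> orbit_of \<Gamma> ae e" using assms(3) by (auto simp: ov_Inr)
  then show ?thesis using EY_inj[of e d] assms Inr by (auto simp: ZY_eq)
qed

lemma HY_inj:
  assumes "h \<in> HY" "k \<in> HY" "k \<in> oe h"
  shows "k = h"
proof -
  obtain v e w d where h: "h = (v, e)" "k = (w, d)" by (cases h, cases k)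
  have "Inl w \<in> ov (Inl v)" "Inr d \<in> ov (Inr e)" using oe_ov assms h by blast+
  moreover have "Inl v \<in> ZY" "Inl w \<in> ZY" "Inr d \<in> ZY" "Inr e \<in> ZY"
    using assms h by (auto simp: HY_iff ZY_eq EY_def)
  ultimately show ?thesis using ZY_inj h by blast
qed

text \<open>The lift of a half-edge orbit. Half-edges inside \<open>Y\<close> have priority; failing
  that, only the vertex end is placed in \<open>Y\<close>, and the half-edge hangs off the
  tree.\<close>

definition "rep h = (if \<exists>k. k \<in> HY \<and> k \<in> h then SOME k. k \<in> HY \<and> k \<in> h else SOME k. k \<in> h \<and> fst k \<in> Y)"

lemma rep:
  assumes "h \<in> gedges Q"
  shows "rep h \<in> h" "fst (rep h) \<in> Y" "rep h \<in> gedges (subdivide G)" "oe (rep h) = h"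
    "rep h \<in> HY \<longleftrightarrow> h \<inter> HY \<noteq> {}"
proof -
  obtain k where k: "k \<in> gedges (subdivide G)" "h = oe k" using assms Q_simps by auto
  obtain v e where ve: "k = (v, e)" by (cases k)
  have "v \<in> V" using k ve edge_subset by auto
  then have "orbit_of \<Gamma> av v \<in> orbit_of \<Gamma> av ` Y" using transY by blast
  then obtain y where y: "y \<in> Y" "orbit_of \<Gamma> av v = orbit_of \<Gamma> av y" by blast
  then have "y \<in> fst ` h" using orbit_self YV k ve oe_fst by auto
  then have ex: "\<exists>k. k \<in> h \<and> fst k \<in> Y" using y by auto
  have HYfst: "fst k \<in> Y" if "k \<in> HY" for k using that by (cases k) (auto simp: HY_iff EY_def)
  have *: "rep h \<in> h \<and> fst (rep h) \<in> Y \<and> (rep h \<in> HY \<longleftrightarrow> h \<inter> HY \<noteq> {})"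
  proof (cases "\<exists>k. k \<in> HY \<and> k \<in> h")
    case True
    from someI_ex[OF True] True HYfst show ?thesis unfolding rep_def by auto
  next
    case False
    from someI_ex[OF ex] False show ?thesis unfolding rep_def by auto
  qed
  then show r: "rep h \<in> h" "fst (rep h) \<in> Y" "rep h \<in> HY \<longleftrightarrow> h \<inter> HY \<noteq> {}" by auto
  show "rep h \<in> gedges (subdivide G)" using r(1) k eS.orbit_subset by blast
  show "oe (rep h) = h" using r(1) k eS.orbit_eq by blast
qed

lemma rep_inj: "inj_on rep (gedges Q)"
  by (rule inj_on_inverseI[of _ oe]) (rule rep(4))

lemma rep_HY: "k \<in> HY \<Longrightarrow> rep (oe k) = k"
proof -
  assume k: "k \<in> HY"
  then have kg: "k \<in> gedges (subdivide G)" using HY_sub by blast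
  then have Q: "oe k \<in> gedges Q" using Q_simps by auto
  have "k \<in> oe k" using kg eS.orbit_self by blast
  then have "rep (oe k) \<in> HY" using rep(5)[OF Q] k by blast
  then show ?thesis using HY_inj[OF k] rep(1)[OF Q] by blast
qed

text \<open>If \<open>e\<close> had a translate inside \<open>Y\<close>, the same translation would
  carry the half-edge into \<open>HY\<close>, and \<open>rep\<close> would have preferred that
  one.\<close>

lemma rep_edge_cases:
  assumes "h \<in> gedges Q" "rep h = (v, e)"
  shows "e \<in> EY \<or> e \<in> bad"
proof (rule ccontr)
  assume a: "\<not> (e \<in> EY \<or> e \<in> bad)"
  have e: "e \<in> E" "v \<in> e" using rep(3)[OF assms(1)] assms(2) by auto
  with a obtain g where g: "g \<in> \<Gamma>" "ae g e \<in> EY" by (auto simp: bad_def orbit_of_def)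
  have "sub_eact av ae g (v, e) \<in> oe (v, e)" using g by (auto simp: orbit_of_def)
  then have "(av g v, ae g e) \<in> h" using rep(4)[OF assms(1)] assms(2) by (simp add: sub_eact_def)
  moreover have "(av g v, ae g e) \<in> HY" using g e by (auto simp: HY_iff ae_image)
  ultimately show False using rep(5)[OF assms(1)] a assms(2) by (auto simp: HY_iff)
qed

lemma bad_not_EY: "e \<in> bad \<Longrightarrow> e \<notin> EY"
proof
  assume e: "e \<in> bad" "e \<in> EY"
  then have "Inr e \<in> gverts (subdivide G)" using YV by (auto simp: EY_def)
  then have "Inr e \<in> ov (Inr e)" by (rule vS.orbit_self)
  then show False using e by (auto simp: bad_def ov_Inr)
qed

text \<open>Two different lifted halves of one edge would put both of its ends into
  \<open>Y\<close>, and the edge would not be bad. Hence every hanging barycenter is a leaf of the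
  lift.\<close>

lemma rep_bad_unique:
  assumes "h \<in> gedges Q" "k \<in> gedges Q" "rep h = (v, e)" "rep k = (w, e)" "e \<in> bad"
  shows "h = k"
proof -
  have e: "e \<in> E" "v \<in> e" "w \<in> e" "v \<in> Y" "w \<in> Y"
    using rep(2,3)[OF assms(1)] rep(2,3)[OF assms(2)] assms by auto
  have "v = w"
  proof (rule ccontr)
    assume "v \<noteq> w"
    then have "e \<subseteq> Y" using e edge2[OF e(1)] by auto
    then show False using assms(5) e bad_not_EY by (auto simp: EY_def)
  qed
  then show ?thesis using rep(4) assms by metis
qed

text \<open>The two half-edge orbits of a removed edge are lifted to halves of two different,
  equivalent edges; their barycenters realise the two new nonvertices.\<close>

definition "D = \<lparr>gverts = Inl ` Y \<union> Inr ` snd ` rep ` gedges Q, gedges = rep ` gedges Q,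
  gends = gends (subdivide G)\<rparr>"

lemma HY_rep: "HY \<subseteq> rep ` gedges Q"
proof
  fix k assume k: "k \<in> HY"
  then have "oe k \<in> gedges Q" using HY_sub Q_simps(2) by blast
  then show "k \<in> rep ` gedges Q" using rep_HY[OF k] by (metis imageI)
qed

lemma EY_rep: "EY \<subseteq> snd ` rep ` gedges Q"
proof
  fix e assume e: "e \<in> EY"
  then obtain v where "v \<in> e" using edge2 by (force simp: EY_def)
  then have "(v, e) \<in> HY" using e by (auto simp: HY_iff)
  then have "(v, e) \<in> rep ` gedges Q" using HY_rep by (rule rev_subsetD)
  then show "e \<in> snd ` rep ` gedges Q" by (metis imageI snd_conv)
qed

text \<open>The set \<open>A\<close> of half-edges is left open, here and in
  \<open>connected_attach\<close>, to serve both \<open>D\<close> and the lift \<open>D0\<close> of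
  the maximal tree.\<close>

lemma attach_subgraph:
  assumes "\<And>k. k \<in> A \<Longrightarrow> k \<in> gedges (subdivide G)" "\<And>k. k \<in> A \<Longrightarrow> fst k \<in> Y"
  shows "subgraph \<lparr>gverts = Inl ` Y \<union> Inr ` snd ` A, gedges = A, gends = gends (subdivide G)\<rparr> (subdivide G)"
    (is "subgraph ?D _")
  unfolding subgraph_def
proof (intro conjI ballI subsetI)
  fix x assume "x \<in> gverts ?D"
  then consider y where "x = Inl y" "y \<in> Y" | k where "x = Inr (snd k)" "k \<in> A" by auto
  then show "x \<in> gverts (subdivide G)"
  proof cases
    case 2
    then show ?thesis using assms(1)[of k] by (cases k) auto
  qed (use YV in auto)
next
  fix k x assume "k \<in> gedges ?D" "x \<in> gends (subdivide G) k"
  then show "x \<in> gverts ?D"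
    using assms(2)[of k] by (cases k) (auto intro: rev_image_eqI)
qed (use assms(1) in auto)

lemma D_subgraph: "subgraph D (subdivide G)"
proof -
  have A: "k \<in> gedges (subdivide G)" "fst k \<in> Y" if "k \<in> rep ` gedges Q" for k
    using rep(2,3) that by blast+
  show ?thesis unfolding D_def by (rule attach_subgraph[OF A])
qed

lemma bridged_sub: "bridged (subdivide G)"
proof (rule bridged_subdivide[OF bridged])
  fix e assume "e \<in> gedges G"
  then have "e \<in> E" by simp
  from edge2[OF this] show "\<exists>u v. u \<noteq> v \<and> gends G e = {u, v}" by auto
qed

lemma connected_attach:
  assumes "HY \<subseteq> A" "\<And>k. k \<in> A \<Longrightarrow> fst k \<in> Y"
  shows "graph_connected \<lparr>gverts = Inl ` Y \<union> Inr ` snd ` A, gedges = A, gends = gends (subdivide G)\<rparr>"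
    (is "graph_connected ?D")
proof -
  obtain y where y: "y \<in> Y" using conY by (auto simp: graph_connected_def)
  have edge: "reachable ?D (Inl v) (Inr e)" "reachable ?D (Inr e) (Inl v)" if "(v, e) \<in> A" for v e
  proof -
    have "e \<in> snd ` A" using that by (rule rev_image_eqI) simp
    then have "Inr e \<in> gverts ?D" "Inl v \<in> gverts ?D" "gends ?D (v, e) = {Inl v, Inr e}" "(v, e) \<in> gedges ?D"
      using assms(2)[OF that] that by simp_all
    then show r: "reachable ?D (Inl v) (Inr e)" by (intro reachable_edge[of _ _ _ "(v, e)"])
    then show "reachable ?D (Inr e) (Inl v)" by (rule reachable_sym)
  qed
  have Y: "reachable ?D (Inl x) (Inl y)" if x: "x \<in> Y" for x
  proof (rule reachable_image[where G = "induced E Y" and u = x and v = y and \<pi> = Inl])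
    show "reachable (induced E Y) x y" using conY x y by (auto intro: graph_connected_reachable)
    fix u v e assume "e \<in> gedges (induced E Y)" "gends (induced E Y) e = {u, v}"
    then have "(u, e) \<in> A" "(v, e) \<in> A" using assms(1) HY_iff by (auto simp: EY_def)
    then show "reachable ?D (Inl u) (Inl v)" using reachable_trans[OF edge(1) edge(2)] by blast
  qed auto
  show ?thesis
  proof (rule graph_connectedI[of "Inl y"])
    fix z assume "z \<in> gverts ?D"
    then consider x where "z = Inl x" "x \<in> Y" | v e where "z = Inr e" "(v, e) \<in> A" by auto
    then show "reachable ?D z (Inl y)"
    proof cases
      case 2
      then show ?thesis using edge Y assms(2) reachable_trans by fastforce
    qed (use Y in blast)
  qed (use y in auto)
qed

lemma D_tree: "is_tree D"
proof -
  have "bridged D" using bridged_sub D_subgraph by (rule bridged_subgraph)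
  moreover have "graph_connected D"
    unfolding D_def using HY_rep rep(2) by (intro connected_attach) auto
  ultimately show ?thesis by (rule is_treeI)
qed

text \<open>One half-edge is kept in the maximal tree for each edge of the quotient that does not come from \<open>Y\<close>.\<close>

definition "kept c = (SOME k. k \<in> rep ` gedges Q \<and> Inr (snd k) \<in> c)"

definition "badQ = ov ` Inr ` bad"

lemma kept:
  assumes "c \<in> badQ"
  shows "kept c \<in> rep ` gedges Q" "Inr (snd (kept c)) \<in> c" "snd (kept c) \<in> bad" "ov (Inr (snd (kept c))) = c"
proof -
  obtain e where e: "e \<in> bad" "c = ov (Inr e)" using assms by (auto simp: badQ_def)
  then obtain u where "u \<in> e" using edge2 by (force simp: bad_def)
  then have k: "(u, e) \<in> gedges (subdivide G)" using e edge_subset by (simp add: bad_def)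
  then have Q: "oe (u, e) \<in> gedges Q" using Q_simps by auto
  obtain v d where vd: "rep (oe (u, e)) = (v, d)" by (cases "rep (oe (u, e))")
  then have "Inr d \<in> c" using rep(1)[OF Q] oe_ov[of v d u e] e by auto
  moreover have "(v, d) \<in> rep ` gedges Q" using vd Q by (metis imageI)
  ultimately have "\<exists>k. k \<in> rep ` gedges Q \<and> Inr (snd k) \<in> c" by (intro exI[of _ "(v, d)"]) simp
  from someI_ex[OF this] show *: "kept c \<in> rep ` gedges Q" "Inr (snd (kept c)) \<in> c"
    unfolding kept_def by auto
  obtain h where h: "h \<in> gedges Q" "kept c = rep h" using *(1) by blast
  have "e \<in> E" using e by (simp add: bad_def)
  then have eo: "Inr e \<in> gverts (subdivide G)" using edge_subset by simp
  show **: "ov (Inr (snd (kept c))) = c" using vS.orbit_eq[OF eo] *(2) e by simp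
  have "snd (kept c) \<notin> EY"
    using *(2) e by (auto simp: bad_def ov_Inr)
  then show "snd (kept c) \<in> bad" using rep_edge_cases[OF h(1)] h(2) by (metis prod.collapse)
qed

definition "A0 = HY \<union> kept ` badQ"

text \<open>A lift of the maximal tree: unlike \<open>D\<close>, it has only one half-edge for each
  orbit of bad edges. The orbit maps are therefore injective on it, and \<open>T\<close> inherits
  acyclicity from the subdivided tree.\<close>

definition "D0 = \<lparr>gverts = Inl ` Y \<union> Inr ` snd ` A0, gedges = A0, gends = gends (subdivide G)\<rparr>"

definition "T = \<lparr>gverts = ov ` gverts D0, gedges = oe ` gedges D0, gends = gends Q\<rparr>"

lemma A0_rep: "A0 \<subseteq> rep ` gedges Q"
  using HY_rep kept(1) unfolding A0_def by blast

lemma A0_sub: "A0 \<subseteq> gedges (subdivide G)"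
  using A0_rep rep(3) by blast

lemma snd_A0: "snd ` A0 = EY \<union> snd ` kept ` badQ"
proof -
  have "snd ` HY = EY"
  proof
    show "EY \<subseteq> snd ` HY"
    proof
      fix e assume e: "e \<in> EY"
      then obtain v where "v \<in> e" using edge2 by (force simp: EY_def)
      then have "(v, e) \<in> HY" using e by (auto simp: HY_iff)
      then show "e \<in> snd ` HY" by force
    qed
  qed (auto simp: HY_def EY_def)
  then show ?thesis by (auto simp: A0_def image_Un)
qed

lemma D0_subgraph: "subgraph D0 (subdivide G)"
proof -
  have A: "k \<in> gedges (subdivide G)" "fst k \<in> Y" if "k \<in> A0" for k
    using A0_sub A0_rep rep(2) that by blast+
  show ?thesis unfolding D0_def by (rule attach_subgraph[OF A])
qed

lemma ov_inj_D0: "inj_on ov (gverts D0)"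
proof
  fix x z assume x: "x \<in> gverts D0" and z: "z \<in> gverts D0" and eq: "ov x = ov z"
  have sub: "gverts D0 \<subseteq> gverts (subdivide G)" using D0_subgraph by (auto simp: subgraph_def)
  have zx: "z \<in> ov x" using vS.orbit_self[of z] eq z sub by auto
  have D0: "gverts D0 = ZY \<union> Inr ` snd ` kept ` badQ"
    unfolding D0_def mgraph.simps snd_A0 ZY_eq by blast
  consider "x \<in> ZY" "z \<in> ZY" | "x \<in> ZY" "z \<in> Inr ` snd ` kept ` badQ"
    | "z \<in> ZY" "x \<in> Inr ` snd ` kept ` badQ"
    | "x \<in> Inr ` snd ` kept ` badQ" "z \<in> Inr ` snd ` kept ` badQ"
    using x z unfolding D0 by blast
  then show "x = z"
  proof cases
    case 1
    then show ?thesis using ZY_inj zx by blast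
  next
    case 2
    then obtain e where e: "z = Inr e" "e \<in> bad" using kept(3) by blast
    have "x \<in> ov z" using vS.orbit_self[of x] eq x sub by auto
    then show ?thesis using e 2 by (auto simp: ZY_eq ov_Inr bad_def)
  next
    case 3
    then obtain e where e: "x = Inr e" "e \<in> bad" using kept(3) by blast
    then show ?thesis using zx 3 by (auto simp: ZY_eq ov_Inr bad_def)
  next
    case 4
    then show ?thesis using kept(4) eq by auto
  qed
qed

lemma oe_inj_A0: "inj_on oe A0"
  using rep(4) A0_rep by (auto intro!: inj_on_inverseI[of _ rep])

text \<open>Vertex orbits meet \<open>Y\<close>. A barycenter orbit meets \<open>EY\<close> or is
  reached by its \<open>kept\<close> half-edge, which is the reason for keeping one half of each bad
  edge.\<close>

lemma gverts_T: "gverts T = gverts Q"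
proof
  show "gverts T \<subseteq> gverts Q"
    using D0_subgraph by (auto simp: T_def Q_simps subgraph_def simp del: subdivide_simps)
  show "gverts Q \<subseteq> gverts T"
  proof
    fix c assume "c \<in> gverts Q"
    then consider v where "c = ov (Inl v)" "v \<in> V" | e where "c = ov (Inr e)" "e \<in> E"
      by (auto simp: Q_simps)
    then show "c \<in> gverts T"
    proof cases
      case 1
      then have "orbit_of \<Gamma> av v \<in> orbit_of \<Gamma> av ` Y" using transY by blast
      then obtain y where y: "y \<in> Y" "orbit_of \<Gamma> av v = orbit_of \<Gamma> av y" by blast
      then have "c = ov (Inl y)" using 1 by (simp add: ov_Inl)
      moreover have "Inl y \<in> gverts D0" using y by (simp add: D0_def)
      ultimately show ?thesis unfolding T_def by (metis imageI mgraph.select_convs(1))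
    next
      case 2
      show ?thesis
      proof (cases "e \<in> bad")
        case True
        then have c: "c \<in> badQ" using 2 by (auto simp: badQ_def)
        then have "Inr (snd (kept c)) \<in> gverts D0" by (auto simp: D0_def A0_def)
        then show ?thesis using kept(4)[OF c] unfolding T_def by force
      next
        case False
        then obtain d where d: "d \<in> EY" "d \<in> orbit_of \<Gamma> ae e" using 2 by (auto simp: bad_def)
        have "Inr e \<in> gverts (subdivide G)" using 2 edge_subset by simp
        moreover have "Inr d \<in> ov (Inr e)" using d by (simp add: ov_Inr)
        ultimately have "ov (Inr d) = c" using 2 vS.orbit_eq by simp
        moreover have "Inr d \<in> gverts D0" using d(1) unfolding D0_def mgraph.simps snd_A0 by blast
        ultimately show ?thesis by (auto simp: T_def)
      qed
    qed
  qed
qed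

lemma Q_ends_form:
  assumes "h \<in> gedges Q"
  shows "\<exists>u v. gends Q h = {u, v} \<and> u \<in> gverts Q \<and> v \<in> gverts Q"
proof -
  obtain k where k: "k \<in> gedges (subdivide G)" "h = oe k" using assms Q_simps by auto
  obtain v e where ve: "k = (v, e)" by (cases k)
  have "gends Q h = {ov (Inl v), ov (Inr e)}" using Q_ends[OF k(1)] k ve by simp
  moreover have "ov (Inl v) \<in> gverts Q" "ov (Inr e) \<in> gverts Q"
    using half_edge_verts k(1) ve Q_simps(1) by blast+
  ultimately show ?thesis by blast
qed

lemma T_subgraph: "subgraph T Q"
  unfolding subgraph_def gverts_T
proof (intro conjI ballI)
  have "gedges T = oe ` A0" by (simp add: T_def D0_def)
  then show sub: "gedges T \<subseteq> gedges Q" using A0_sub Q_simps(2) by (metis image_mono)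
  fix h assume "h \<in> gedges T"
  then have "h \<in> gedges Q" using sub by blast
  from Q_ends_form[OF this] obtain u v where "gends Q h = {u, v}" "u \<in> gverts Q" "v \<in> gverts Q" by blast
  then show "gends Q h \<subseteq> gverts Q" by simp
qed (simp_all add: T_def)

lemma T_ends:
  assumes "k \<in> A0"
  shows "gends T (oe k) = ov ` gends D0 k"
proof -
  have "k \<in> gedges (subdivide G)" using assms A0_sub by blast
  then show ?thesis by (simp add: T_def D0_def Q_ends del: subdivide_simps)
qed

lemma T_tree: "is_tree T"
proof -
  have br: "bridged T"
  proof (rule bridged_image)
    show "bridged D0" using bridged_sub D0_subgraph by (rule bridged_subgraph)
    show "inj_on ov (gverts D0)" by (rule ov_inj_D0)
    show "gedges T = oe ` gedges D0" by (simp add: T_def)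
    show "inj_on oe (gedges D0)" using oe_inj_A0 by (simp add: D0_def)
    show "\<And>e. e \<in> gedges D0 \<Longrightarrow> gends D0 e \<subseteq> gverts D0" using D0_subgraph by (auto simp: subgraph_def)
    show "\<And>e. e \<in> gedges D0 \<Longrightarrow> gends T (oe e) = ov ` gends D0 e" using T_ends by (simp add: D0_def)
  qed
  have con: "graph_connected D0"
    unfolding D0_def using A0_rep rep(2) by (intro connected_attach) (auto simp: A0_def)
  obtain r where r: "r \<in> gverts D0" using con by (auto simp: graph_connected_def)
  have conT: "graph_connected T"
  proof (rule graph_connectedI[of "ov r"])
    fix z assume "z \<in> gverts T"
    then obtain x where x: "x \<in> gverts D0" "z = ov x" by (auto simp: T_def)
    have "reachable T (ov x) (ov r)"
    proof (rule reachable_image[where G = D0 and u = x and v = r and \<pi> = ov])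
      show "reachable D0 x r" using con x r by (intro graph_connected_reachable)
      show "\<And>v. v \<in> gverts D0 \<Longrightarrow> ov v \<in> gverts T" by (auto simp: T_def)
      fix u v e assume "e \<in> gedges D0" "gends D0 e = {u, v}" "u \<in> gverts D0" "v \<in> gverts D0"
      then show "reachable T (ov u) (ov v)"
        using T_ends[of e] by (intro reachable_edge[of _ _ _ "oe e"]) (auto simp: T_def D0_def)
    qed
    then show "reachable T z (ov r)" using x by simp
  qed (use r in \<open>auto simp: T_def\<close>)
  show ?thesis using br conT by (rule is_treeI)
qed

lemma T_maximal: "maximal_tree T Q"
  using T_tree T_subgraph gverts_T Q_ends_form by (rule spanning_tree_maximal)

lemma Q_ends_rep:
  assumes "h \<in> gedges Q" "rep h = (v, e)"
  shows "gends Q h = {ov (Inl v), ov (Inr e)}"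
  using Q_ends[OF rep(3)[OF assms(1)]] rep(4)[OF assms(1)] assms(2) by simp

lemma Inl_orbit_not_badQ: "Inl v \<in> c \<Longrightarrow> c \<notin> badQ"
  by (auto simp: badQ_def ov_Inr)

lemma Inl_self: "v \<in> V \<Longrightarrow> Inl v \<in> ov (Inl v)"
  by (rule vS.orbit_self) simp

lemma Inr_self: "e \<in> E \<Longrightarrow> Inr e \<in> ov (Inr e)"
  using edge_subset by (intro vS.orbit_self) simp

lemma EY_not_badQ: "e \<in> EY \<Longrightarrow> Inr e \<in> c \<Longrightarrow> c \<notin> badQ"
  by (auto simp: badQ_def ov_Inr bad_def)

lemma T_edge_at_bad:
  assumes "h \<in> gedges T" "b \<in> badQ" "b \<in> gends Q h"
  shows "h = oe (kept b)"
proof -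
  obtain k where k: "k \<in> A0" "h = oe k" using assms(1) by (auto simp: T_def D0_def)
  obtain v e where ve: "k = (v, e)" by (cases k)
  have kG: "(v, e) \<in> gedges (subdivide G)" using k(1) ve A0_sub by blast
  then have "gends Q h = {ov (Inl v), ov (Inr e)}" using Q_ends[OF kG] k ve by simp
  moreover have "v \<in> V" "e \<in> E" using kG edge_subset by auto
  moreover from this have "b \<noteq> ov (Inl v)" using assms(2) Inl_orbit_not_badQ[OF Inl_self] by metis
  ultimately have b: "b = ov (Inr e)" using assms(3) by simp
  have "e \<notin> EY" using EY_not_badQ[OF _ Inr_self[OF \<open>e \<in> E\<close>]] b assms(2) by metis
  then have "k \<notin> HY" using ve HY_iff by simp
  then obtain c where c: "c \<in> badQ" "k = kept c" using k(1) by (auto simp: A0_def)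
  then have "c = b" using kept(4)[OF c(1)] ve b by (metis snd_conv)
  then show ?thesis using c k by simp
qed

text \<open>Half-edges on edges of \<open>EY\<close> all survive in \<open>T\<close>, so a removed
  half-edge is at a bad barycenter. Conversely, a bad barycenter has two half-edge orbits, and
  \<open>T\<close> contains only the kept one.\<close>

lemma removed_barycenters_T: "removed_barycenters Q T = badQ"
proof
  show "removed_barycenters Q T \<subseteq> badQ"
  proof
    fix b assume "b \<in> removed_barycenters Q T"
    then obtain h where h: "b \<subseteq> range Inr" "h \<in> gedges Q" "h \<notin> gedges T" "b \<in> gends Q h"
      unfolding removed_barycenters_def by blast
    obtain v e where ve: "rep h = (v, e)" by (cases "rep h")
    have "v \<in> V" "v \<in> e" using rep(3)[OF h(2)] ve edge_subset by auto
    then have "b = ov (Inr e)" using Inl_self[of v] h(1,4) Q_ends_rep[OF h(2) ve] by auto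
    moreover have "e \<notin> EY"
    proof
      assume "e \<in> EY"
      then have "(v, e) \<in> A0" using \<open>v \<in> e\<close> by (auto simp: A0_def HY_iff)
      then have "h \<in> gedges T" using rep(4)[OF h(2)] ve by (force simp: T_def D0_def)
      then show False using h(3) by blast
    qed
    then have "e \<in> bad" using rep_edge_cases[OF h(2) ve] by blast
    ultimately show "b \<in> badQ" by (auto simp: badQ_def)
  qed
  show "badQ \<subseteq> removed_barycenters Q T"
  proof
    fix b assume b: "b \<in> badQ"
    then obtain e where e: "e \<in> bad" "b = ov (Inr e)" by (auto simp: badQ_def)
    then have eE: "e \<in> E" by (auto simp: bad_def)
    then obtain u w where uw: "u \<noteq> w" "e = {u, w}" using edge2 by blast
    have kG: "(u, e) \<in> gedges (subdivide G)" "(w, e) \<in> gedges (subdivide G)"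
      using eE edge_subset uw by auto
    have bends: "b \<in> gends Q (oe (u, e))" "b \<in> gends Q (oe (w, e))"
      using Q_ends[OF kG(1)] Q_ends[OF kG(2)] e by auto
    \<comment> \<open>An inversion of \<open>e\<close> would identify its two halves in the
      quotient, leaving no half to be removed.\<close>
    have "oe (u, e) \<noteq> oe (w, e)"
    proof
      assume "oe (u, e) = oe (w, e)"
      then have "(w, e) \<in> oe (u, e)" using eS.orbit_self[OF kG(2)] by simp
      then obtain g where "g \<in> \<Gamma>" "w = av g u" "e = av g ` e"
        by (auto simp: orbit_of_def sub_eact_def ae_image)
      then show False using no_inversion[of g e u] eE uw by auto
    qed
    then have "oe (u, e) \<notin> gedges T \<or> oe (w, e) \<notin> gedges T"
      using T_edge_at_bad b bends by metis
    moreover have "oe (u, e) \<in> gedges Q" "oe (w, e) \<in> gedges Q"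
      using kG Q_simps(2) by blast+
    moreover have "b \<subseteq> range Inr" using e by (auto simp: ov_Inr)
    moreover have "Inr e \<in> gverts (subdivide G)" using eE edge_subset by simp
    then have "b \<in> gverts Q" using e Q_simps(1) by blast
    ultimately show "b \<in> removed_barycenters Q T"
      using bends unfolding removed_barycenters_def by blast
  qed
qed

definition "vrep c = (SOME x. x \<in> c \<and> x \<in> ZY)"

lemma vrep:
  assumes "c \<in> gverts Q" "c \<notin> badQ"
  shows "vrep c \<in> c" "vrep c \<in> ZY"
proof -
  consider v where "c = ov (Inl v)" "v \<in> V" | e where "c = ov (Inr e)" "e \<in> E"
    using assms(1) by (auto simp: Q_simps)
  then have "\<exists>x. x \<in> c \<and> x \<in> ZY"
  proof cases
    case 1
    then have "orbit_of \<Gamma> av v \<in> orbit_of \<Gamma> av ` Y" using transY by blast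
    then obtain y where y: "y \<in> Y" "orbit_of \<Gamma> av v = orbit_of \<Gamma> av y" by blast
    then have "y \<in> orbit_of \<Gamma> av v" using orbit_self YV by auto
    then show ?thesis using 1 y by (auto simp: ov_Inl ZY_eq)
  next
    case 2
    then have "e \<notin> bad" using assms(2) by (auto simp: badQ_def)
    then obtain d where "d \<in> EY" "d \<in> orbit_of \<Gamma> ae e" using 2 by (auto simp: bad_def)
    then show ?thesis using 2 by (auto simp: ov_Inr ZY_eq)
  qed
  from someI_ex[OF this] show "vrep c \<in> c" "vrep c \<in> ZY" by (auto simp: vrep_def)
qed

lemma vrep_ZY:
  assumes "x \<in> ZY"
  shows "ov x \<in> gverts Q" "ov x \<notin> badQ" "vrep (ov x) = x"
proof -
  have xG: "x \<in> gverts (subdivide G)" using assms ZY_sub by blast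
  then show 1: "ov x \<in> gverts Q" using Q_simps(1) by blast
  have "x \<in> ov x" using xG by (rule vS.orbit_self)
  then show 2: "ov x \<notin> badQ"
    using assms Inl_orbit_not_badQ EY_not_badQ by (auto simp: ZY_eq)
  show "vrep (ov x) = x" using ZY_inj[OF assms] vrep[OF 1 2] by blast
qed

lemma gverts_cut:
  "gverts (cut_graph Q badQ) = Inl ` (gverts Q - badQ) \<union> Inr ` {h \<in> gedges Q. snd (rep h) \<in> bad}"
proof -
  have "gends Q h \<inter> badQ \<noteq> {} \<longleftrightarrow> snd (rep h) \<in> bad" if h: "h \<in> gedges Q" for h
  proof -
    obtain v e where ve: "rep h = (v, e)" by (cases "rep h")
    have vV: "v \<in> V" "e \<in> E" using rep(3)[OF h] ve edge_subset by auto
    have "gends Q h \<inter> badQ \<noteq> {} \<longleftrightarrow> ov (Inr e) \<in> badQ"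
      using Q_ends_rep[OF h ve] Inl_orbit_not_badQ[OF Inl_self[OF vV(1)]] by auto
    also have "\<dots> \<longleftrightarrow> e \<in> bad"
      using rep_edge_cases[OF h ve] EY_not_badQ[OF _ Inr_self[OF vV(2)]] by (auto simp: badQ_def)
    finally show ?thesis using ve by simp
  qed
  then have "{h \<in> gedges Q. gends Q h \<inter> badQ \<noteq> {}} = {h \<in> gedges Q. snd (rep h) \<in> bad}" by blast
  then show ?thesis by (simp add: cut_graph_def)
qed

lemma gedges_cut: "gedges (cut_graph Q badQ) = gedges Q"
  by (simp add: cut_graph_def)

lemma gends_cut:
  assumes "h \<in> gedges Q" "rep h = (v, e)"
  shows "gends (cut_graph Q badQ) h =
    {Inl (ov (Inl v)), if e \<in> bad then Inr h else Inl (ov (Inr e))}"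
proof -
  have vV: "v \<in> V" "e \<in> E" using rep(3)[OF assms(1)] assms(2) edge_subset by auto
  have 1: "ov (Inl v) \<notin> badQ" using Inl_orbit_not_badQ[OF Inl_self[OF vV(1)]] .
  have 2: "ov (Inr e) \<in> badQ \<longleftrightarrow> e \<in> bad"
    using rep_edge_cases[OF assms] EY_not_badQ[OF _ Inr_self[OF vV(2)]] by (auto simp: badQ_def)
  show ?thesis
    using 1 2 by (auto simp: cut_graph_def Q_ends_rep[OF assms])
qed

text \<open>An uncut vertex is lifted into \<open>ZY\<close>, a new vertex \<open>Inr h\<close> to
  the barycenter of \<open>rep h\<close>. Injectivity on new vertices is
  \<open>rep_bad_unique\<close>, and the two kinds stay apart because bad edges are not in
  \<open>EY\<close>.\<close>

lemma lifted_D: "lifted_subtree (subdivide G) Q badQ D"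
proof -
  define \<phi> where "\<phi> = case_sum vrep (\<lambda>h. Inr (snd (rep h)) :: 'v + 'v set)"
  have \<phi>_simps: "\<phi> (Inl c) = vrep c" "\<phi> (Inr h) = Inr (snd (rep h))" for c h
    by (simp_all add: \<phi>_def)
  let ?C = "cut_graph Q badQ"
  have inj: "inj_on \<phi> (gverts ?C)"
  proof
    fix x z assume x: "x \<in> gverts ?C" and z: "z \<in> gverts ?C" and eq: "\<phi> x = \<phi> z"
    have mixed: "vrep c \<noteq> Inr (snd (rep h))" if "c \<in> gverts Q" "c \<notin> badQ" "snd (rep h) \<in> bad" for c h
      using vrep(2)[OF that(1,2)] that(3) bad_not_EY by (auto simp: ZY_eq)
    have LL: "c = d" if cd: "c \<in> gverts Q - badQ" "d \<in> gverts Q - badQ" "vrep c = vrep d" for c d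
    proof -
      have "vrep c \<in> c" using vrep(1) cd(1) by blast
      moreover have "vrep c \<in> d" unfolding cd(3) using vrep(1) cd(2) by blast
      moreover obtain x y where "c = ov x" "d = ov y" "x \<in> gverts (subdivide G)" "y \<in> gverts (subdivide G)"
        using cd(1,2) unfolding Q_simps by blast
      ultimately show ?thesis using vS.orbit_eq by metis
    qed
    have RR: "h = k" if "h \<in> gedges Q" "k \<in> gedges Q" "snd (rep h) \<in> bad" "snd (rep h) = snd (rep k)" for h k
      using rep_bad_unique[OF that(1,2)] that(3,4) by (metis prod.collapse)
    consider c d where "x = Inl c" "z = Inl d" "c \<in> gverts Q - badQ" "d \<in> gverts Q - badQ"
      | c h where "x = Inl c" "z = Inr h" "c \<in> gverts Q - badQ" "snd (rep h) \<in> bad"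
      | c h where "x = Inr h" "z = Inl c" "c \<in> gverts Q - badQ" "snd (rep h) \<in> bad"
      | h k where "x = Inr h" "z = Inr k" "h \<in> gedges Q" "k \<in> gedges Q" "snd (rep h) \<in> bad"
      using x z unfolding gverts_cut by blast
    then show "x = z"
    proof cases
      case 1
      then show ?thesis using LL eq \<phi>_simps by simp
    next
      case 2
      then show ?thesis using mixed[of c h] eq \<phi>_simps by simp
    next
      case 3
      then show ?thesis using mixed[of c h] eq \<phi>_simps by simp
    next
      case 4
      then show ?thesis using RR[of h k] eq \<phi>_simps by simp
    qed
  qed
  have "\<phi> ` gverts ?C \<subseteq> gverts D"
  proof
    fix x assume "x \<in> \<phi> ` gverts ?C"
    then consider c where "x = vrep c" "c \<in> gverts Q" "c \<notin> badQ" | h where "x = Inr (snd (rep h))" "h \<in> gedges Q"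
      unfolding gverts_cut using \<phi>_simps by auto
    then show "x \<in> gverts D"
    proof cases
      case 1
      then have "x \<in> ZY" using vrep(2) by simp
      then show ?thesis using EY_rep unfolding ZY_eq D_def by auto
    next
      case 2
      then show ?thesis unfolding D_def by simp
    qed
  qed
  moreover have "gverts D \<subseteq> \<phi> ` gverts ?C"
  proof
    fix x assume "x \<in> gverts D"
    then consider y where "x = Inl y" "y \<in> Y" | h where "x = Inr (snd (rep h))" "h \<in> gedges Q"
      unfolding D_def by auto
    then have "x \<in> ZY \<or> (\<exists>h\<in>gedges Q. x = Inr (snd (rep h)) \<and> snd (rep h) \<in> bad)"
    proof cases
      case 2
      have "snd (rep h) \<in> EY \<or> snd (rep h) \<in> bad" using rep_edge_cases[OF 2(2)] by (metis prod.collapse)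
      then show ?thesis
      proof
        assume "snd (rep h) \<in> EY"
        then show ?thesis using 2 by (simp add: ZY_eq)
      qed (use 2 in blast)
    qed (auto simp: ZY_eq)
    then show "x \<in> \<phi> ` gverts ?C"
    proof
      assume "x \<in> ZY"
      then have "Inl (ov x) \<in> gverts ?C" "\<phi> (Inl (ov x)) = x"
        unfolding gverts_cut \<phi>_simps using vrep_ZY by blast+
      then show ?thesis by (metis imageI)
    next
      assume "\<exists>h\<in>gedges Q. x = Inr (snd (rep h)) \<and> snd (rep h) \<in> bad"
      then obtain h where "Inr h \<in> gverts ?C" "\<phi> (Inr h) = x"
        unfolding gverts_cut \<phi>_simps by blast
      then show ?thesis by (metis imageI)
    qed
  qed
  ultimately have bij: "bij_betw \<phi> (gverts ?C) (gverts D)" using inj by (simp add: bij_betw_def)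
  have bije: "bij_betw rep (gedges ?C) (gedges D)"
    using rep_inj by (simp add: bij_betw_def gedges_cut D_def)
  have ends: "gends (subdivide G) (rep h) = \<phi> ` gends ?C h" if h: "h \<in> gedges Q" for h
  proof -
    obtain v e where ve: "rep h = (v, e)" by (cases "rep h")
    have v: "Inl v \<in> ZY" using rep(2)[OF h] ve by (simp add: ZY_eq)
    have e: "Inr e \<in> ZY" if "e \<notin> bad" using rep_edge_cases[OF h ve] that by (simp add: ZY_eq)
    show ?thesis using vrep_ZY(3)[OF v] vrep_ZY(3)[OF e]
      by (auto simp: gends_cut[OF h ve] \<phi>_simps ve)
  qed
  have new: "\<phi> (Inr h) \<in> \<Union> (gends Q h \<inter> badQ)" if "Inr h \<in> gverts ?C" for h
  proof -
    have h: "h \<in> gedges Q" "snd (rep h) \<in> bad" using that unfolding gverts_cut by auto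
    obtain v e where ve: "rep h = (v, e)" by (cases "rep h")
    have "Inr e \<in> ov (Inr e)" using h ve by (intro Inr_self) (simp add: bad_def)
    then show ?thesis using h(2) ve unfolding \<phi>_simps Q_ends_rep[OF h(1) ve] badQ_def by auto
  qed
  show ?thesis
    unfolding lifted_subtree_def
    using D_subgraph D_tree bij bije ends new vrep(1) rep(1)
    by (intro conjI exI[of _ \<phi>] exI[of _ rep]) (simp_all add: gedges_cut \<phi>_simps)
qed

lemma fundamental_domain_D: "fundamental_domain \<Gamma> av ae G D"
  unfolding fundamental_domain_def
  using T_maximal lifted_D removed_barycenters_T by metis

end

theorem fundamental_domain_containing:
  assumes S: "S \<subseteq> V" "graph_connected (induced E S)" "inequivalent S"
    and fin: "finite (oe ` gedges (subdivide G) - oe ` gedges (subdivide (induced E S)))"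
  shows "\<exists>F. subgraph F (subdivide G) \<and> finite_graph F \<and>
     fundamental_domain \<Gamma> av ae G (graph_union (subdivide (induced E S)) F)"
proof -
  let ?M = "oe ` gedges (subdivide G) - oe ` gedges (subdivide (induced E S))"
  \<comment> \<open>Every vertex lies on an edge, so a missing vertex orbit lies under a missing
    half-edge orbit. Finiteness for half-edges thus covers vertices.\<close>
  have "orbit_of \<Gamma> av ` V - orbit_of \<Gamma> av ` S \<subseteq> (\<lambda>h. fst ` h) ` ?M"
  proof
    fix c assume c: "c \<in> orbit_of \<Gamma> av ` V - orbit_of \<Gamma> av ` S"
    then obtain v where v: "v \<in> V" "c = orbit_of \<Gamma> av v" by blast
    then obtain e where e: "e \<in> E" "v \<in> e" using no_isolated by blast
    have "oe (v, e) \<notin> oe ` gedges (subdivide (induced E S))"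
    proof
      assume "oe (v, e) \<in> oe ` gedges (subdivide (induced E S))"
      then obtain w d where wd: "oe (v, e) = oe (w, d)" "w \<in> S" by auto
      then have "c = orbit_of \<Gamma> av w" using oe_fst[of v e] oe_fst[of w d] v by simp
      then show False using c wd by blast
    qed
    moreover have "(v, e) \<in> gedges (subdivide G)" using e edge_subset by simp
    ultimately have "oe (v, e) \<in> ?M" by blast
    then show "c \<in> (\<lambda>h. fst ` h) ` ?M" using v oe_fst by (metis image_eqI)
  qed
  then have "finite (orbit_of \<Gamma> av ` V - orbit_of \<Gamma> av ` S)"
    using fin by (meson finite_imageI finite_subset)
  from extend_to_transversal[OF this S]
  obtain Y where Y: "S \<subseteq> Y" "Y \<subseteq> V" "finite (Y - S)" "graph_connected (induced E Y)" "inequivalent Y"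
     "orbit_of \<Gamma> av ` V = orbit_of \<Gamma> av ` Y" by (elim exE conjE)
  let ?S = "subdivide (induced E S)" and ?D = "D Y"
  note defs = D_def[OF Y(2,4-6)] HY_def[OF Y(2,4-6)] EY_def[OF Y(2,4-6)]
  have SHY: "gedges ?S \<subseteq> HY Y" using Y(1) by (auto simp: defs)
  have SD: "gedges ?S \<subseteq> gedges ?D" using SHY HY_rep[OF Y(2,4-6)] by (simp add: defs)
  have SDv: "gverts ?S \<subseteq> gverts ?D"
  proof -
    have "gedges (induced E S) \<subseteq> EY Y" using Y(1) by (auto simp: defs)
    also have "EY Y \<subseteq> snd ` rep Y ` gedges Q" by (rule EY_rep[OF Y(2,4-6)])
    finally have "Inl ` S \<union> Inr ` gedges (induced E S) \<subseteq> Inl ` Y \<union> Inr ` snd ` rep Y ` gedges Q"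
      by (intro Un_mono image_mono Y(1))
    then show ?thesis by (simp add: D_def[OF Y(2,4-6)])
  qed
  have Dsub: "subgraph ?D (subdivide G)" by (rule D_subgraph[OF Y(2,4-6)])
  define K where "K = gedges ?D - gedges ?S"
  have "K \<subseteq> rep Y ` ?M"
  proof
    fix k assume k: "k \<in> K"
    then obtain h where h: "h \<in> gedges Q" "k = rep Y h" by (auto simp: K_def defs)
    have "h \<notin> oe ` gedges ?S"
    proof
      assume "h \<in> oe ` gedges ?S"
      then obtain k' where k': "k' \<in> gedges ?S" "h = oe k'" by blast
      then have "rep Y h = k'" using rep_HY[OF Y(2,4-6)] SHY by blast
      then show False using k k' h by (simp add: K_def)
    qed
    then show "k \<in> rep Y ` ?M" using h Q_simps(2) by blast
  qed
  then have finK: "finite K" using fin by (meson finite_imageI finite_subset)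
  \<comment> \<open>The ends of the half-edges in \<open>K\<close> are included even if they already
    lie in the subdivision of \<open>S\<close>, since \<open>F\<close> must be a subgraph by
    itself.\<close>
  define F where "F = \<lparr>gverts = (gverts ?D - gverts ?S) \<union> (\<Union>k\<in>K. gends (subdivide G) k),
    gedges = K, gends = gends (subdivide G)\<rparr>"
  have Kends: "(\<Union>k\<in>K. gends (subdivide G) k) \<subseteq> gverts ?D"
    using Dsub unfolding subgraph_def K_def by blast
  have Fsub: "subgraph F (subdivide G)"
    unfolding subgraph_def
  proof (intro conjI ballI)
    show "gverts F \<subseteq> gverts (subdivide G)" using Kends Dsub unfolding subgraph_def F_def by auto
    show "gedges F \<subseteq> gedges (subdivide G)" using Dsub unfolding subgraph_def F_def K_def by auto
    show "\<And>e. e \<in> gedges F \<Longrightarrow> gends (subdivide G) e \<subseteq> gverts F" unfolding F_def by auto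
  qed (simp add: F_def)
  have "gverts ?D - gverts ?S \<subseteq> Inl ` (Y - S) \<union> Inr ` snd ` K"
  proof
    fix x assume x: "x \<in> gverts ?D - gverts ?S"
    then consider y where "x = Inl y" "y \<in> Y" | k where "x = Inr (snd k)" "k \<in> gedges ?D"
      unfolding defs by auto
    then show "x \<in> Inl ` (Y - S) \<union> Inr ` snd ` K"
    proof cases
      case 1
      then show ?thesis using x by auto
    next
      case 2
      then have "k \<notin> gedges ?S" using x by auto
      then have "k \<in> K" using 2 by (simp add: K_def)
      then show ?thesis using 2 by blast
    qed
  qed
  then have "finite (gverts ?D - gverts ?S)"
    using Y(3) finK by (meson finite_UnI finite_imageI finite_subset)
  moreover have "finite (\<Union>k\<in>K. gends (subdivide G) k)"
    using finK by (auto simp: split_def)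
  ultimately have "finite_graph F" using finK by (simp add: finite_graph_def F_def)
  moreover have "graph_union ?S F = ?D"
  proof (intro mgraph.equality)
    show "gverts (graph_union ?S F) = gverts ?D"
      using SDv Kends by (auto simp: graph_union_def F_def simp del: subdivide_simps)
    show "gedges (graph_union ?S F) = gedges ?D"
      using SD by (auto simp: graph_union_def F_def K_def simp del: subdivide_simps)
    show "gends (graph_union ?S F) = gends ?D"
      by (simp add: graph_union_def defs)
  qed simp
  ultimately show ?thesis using Fsub fundamental_domain_D[OF Y(2,4-6)] by metis
qed

end

section \<open>Balls and the ball tree\<close>

text \<open>The valuation is at least \<open>k\<close>, with the valuation of \<open>0\<close> read
  as infinity instead of the default value \<open>0\<close> of \<open>fls_subdegree\<close>.\<close>

definition vge :: "int \<Rightarrow> 'a::field fls \<Rightarrow> bool" where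
  "vge k y \<longleftrightarrow> y = 0 \<or> k \<le> fls_subdegree y"

lemma vge_nth: "vge k y \<longleftrightarrow> (\<forall>i<k. fls_nth y i = 0)"
proof
  show "vge k y \<Longrightarrow> \<forall>i<k. fls_nth y i = 0" by (auto simp: vge_def)
  show "\<forall>i<k. fls_nth y i = 0 \<Longrightarrow> vge k y"
    unfolding vge_def using fls_subdegree_geI by blast
qed

lemma vge_zero [simp]: "vge k 0"
  by (simp add: vge_def)

lemma vge_mono: "vge k y \<Longrightarrow> j \<le> k \<Longrightarrow> vge j y"
  by (auto simp: vge_def)

lemma vge_add: "vge k x \<Longrightarrow> vge k y \<Longrightarrow> vge k (x + y)"
  by (auto simp: vge_nth)

lemma vge_uminus [simp]: "vge k (- x) \<longleftrightarrow> vge k x"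
  by (auto simp: vge_nth)

lemma vge_diff: "vge k x \<Longrightarrow> vge k y \<Longrightarrow> vge k (x - y)"
  by (auto simp: vge_nth)

lemma vge_diff_commute: "vge k (x - y) \<longleftrightarrow> vge k (y - x)"
  by (metis minus_diff_eq vge_uminus)

lemma vge_mult: "vge j x \<Longrightarrow> vge k y \<Longrightarrow> vge (j + k) (x * y)"
  by (cases "x = 0 \<or> y = 0") (auto simp: vge_def)

lemma vge_mult_iff: "c \<noteq> 0 \<Longrightarrow> vge k (c * y) \<longleftrightarrow> vge (k - fls_subdegree c) y"
  by (cases "y = 0") (auto simp: vge_def)

lemma vge_divide_iff: "c \<noteq> 0 \<Longrightarrow> vge k (y / c) \<longleftrightarrow> vge (k + fls_subdegree c) y"
  using vge_mult_iff[of c "k + fls_subdegree c" "y / c"] by simp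

lemma mem_vball: "y \<in> vball x r \<longleftrightarrow> vge r (y - x)"
  by (auto simp: vball_def vge_def)

lemma vball_subset_iff: "vball x r \<subseteq> vball y s \<longleftrightarrow> s \<le> r \<and> vge s (x - y)"
proof
  assume sub: "vball x r \<subseteq> vball y s"
  have "x \<in> vball x r" by (simp add: mem_vball)
  with sub have "x \<in> vball y s" by (rule subsetD)
  then have x: "vge s (x - y)" by (simp add: mem_vball)
  \<comment> \<open>A point whose difference from \<open>x\<close> has valuation exactly
    \<open>r\<close> tests the radius: together with \<open>x\<close> it forces
    \<open>s \<le> r\<close>.\<close>
  have "x + fls_X_intpow r \<in> vball x r" by (simp add: mem_vball vge_def)
  with sub have "x + fls_X_intpow r \<in> vball y s" by (rule subsetD)
  then have "vge s (x + fls_X_intpow r - y)" by (simp add: mem_vball)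
  then have "vge s (x + fls_X_intpow r - y - (x - y))" using x by (rule vge_diff)
  then show "s \<le> r \<and> vge s (x - y)" using x by (simp add: vge_def)
next
  assume a: "s \<le> r \<and> vge s (x - y)"
  show "vball x r \<subseteq> vball y s"
  proof
    fix z assume "z \<in> vball x r"
    then have "vge s (z - x)" using a by (auto simp: mem_vball intro: vge_mono)
    then have "vge s (z - x + (x - y))" using a by (blast intro: vge_add)
    then show "z \<in> vball y s" by (simp add: mem_vball)
  qed
qed

lemma vball_eq_iff: "vball x r = vball y s \<longleftrightarrow> r = s \<and> vge r (x - y)"
proof -
  have "vball x r = vball y s \<longleftrightarrow> vball x r \<subseteq> vball y s \<and> vball y s \<subseteq> vball x r" by blast
  then show ?thesis using vge_diff_commute[of r x y] unfolding vball_subset_iff by auto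
qed

lemma vball_in_vballs [simp]: "vball x r \<in> vballs"
  by (auto simp: vballs_def)

lemma vball_cases:
  assumes "B \<in> vballs"
  obtains x r where "B = vball x r"
  using assms by (auto simp: vballs_def)

lemma maximal_subball_iff:
  "maximal_subball B B' \<longleftrightarrow> (\<exists>x r. B = vball x (r + 1) \<and> B' = vball x r)"
proof
  assume m: "maximal_subball B B'"
  then have "B \<in> vballs" "B' \<in> vballs" by (auto simp: maximal_subball_def)
  then obtain x r y s where B: "B = vball x r" "B' = vball y s" by (metis vball_cases)
  have sub: "B \<subseteq> B'" "B \<noteq> B'" using m by (auto simp: maximal_subball_def)
  then have sr: "s \<le> r" "vge s (x - y)" using vball_subset_iff[of x r y s] B by auto
  have "s \<noteq> r" using sub(2) B vball_eq_iff[of x r y s] sr by auto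
  have B': "B' = vball x s" using B sr vball_eq_iff[of x s y s] by auto
  have "r = s + 1"
  proof (rule ccontr)
    assume "r \<noteq> s + 1"
    then have "s + 1 < r" using sr \<open>s \<noteq> r\<close> by linarith
    then have "B \<subset> vball x (s + 1)" "vball x (s + 1) \<subset> B'"
      unfolding B(1) B' psubset_eq vball_subset_iff vball_eq_iff by auto
    moreover have "vball x (s + 1) \<in> vballs" by simp
    ultimately show False using m unfolding maximal_subball_def by blast
  qed
  then show "\<exists>x r. B = vball x (r + 1) \<and> B' = vball x r" using B B' by auto
next
  assume "\<exists>x r. B = vball x (r + 1) \<and> B' = vball x r"
  then obtain x r where B: "B = vball x (r + 1)" "B' = vball x r" by auto
  have "False" if "C \<in> vballs" "B \<subset> C" "C \<subset> B'" for C
  proof -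
    obtain y s where C: "C = vball y s" using \<open>C \<in> vballs\<close> by (rule vball_cases)
    have "s \<le> r + 1" "vge s (x - y)" "r \<le> s"
      using that(2,3) unfolding B C psubset_eq vball_subset_iff by auto
    then have "s = r + 1 \<or> s = r" by linarith
    then show False
      using that(2,3) \<open>vge s (x - y)\<close> vge_diff_commute[of s x y] unfolding B C psubset_eq vball_eq_iff by auto
  qed
  moreover have "B \<subset> B'" unfolding B psubset_eq vball_subset_iff vball_eq_iff by auto
  ultimately show "maximal_subball B B'" using B by (auto simp: maximal_subball_def)
qed

section \<open>Branches, lines and spanned subtrees of the ball tree\<close>

definition ball_edges :: "'a::field fls set set set" where
  "ball_edges = {{vball x (r + 1), vball x r} | x r. True}"

lemma ball_edgesI: "{vball x (r + 1), vball x r} \<in> ball_edges"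
  by (auto simp: ball_edges_def)

lemma bt_tree_eq: "bt_tree = induced ball_edges vballs"
proof -
  have "{{B, B'} | B B'. maximal_subball B B'} = {e \<in> ball_edges. e \<subseteq> vballs}"
    unfolding maximal_subball_iff ball_edges_def by auto
  then show ?thesis by (simp add: bt_tree_def induced_def)
qed

lemma ball_edges_subset: "e \<in> ball_edges \<Longrightarrow> e \<subseteq> vballs"
  by (auto simp: ball_edges_def)

text \<open>The balls inside \<open>vball x (r + 1)\<close> form a branch, whose only exit is the
  edge to its parent ball. This cut serves both acyclicity and the minimality of the spanned
  subtree.\<close>

lemma ball_edge_crosses:
  assumes "f \<in> ball_edges"
  shows "(f \<inter> {B. B \<subseteq> vball x (r + 1)} \<noteq> {} \<and> \<not> f \<subseteq> {B. B \<subseteq> vball x (r + 1)}) \<longleftrightarrow>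
    f = {vball x (r + 1), vball x r}"
proof -
  obtain y s where f: "f = {vball y (s + 1), vball y s}" using assms by (auto simp: ball_edges_def)
  show ?thesis
  proof
    assume "f \<inter> {B. B \<subseteq> vball x (r + 1)} \<noteq> {} \<and> \<not> f \<subseteq> {B. B \<subseteq> vball x (r + 1)}"
    then have a: "r \<le> s" "vge (r + 1) (y - x)" "\<not> r + 1 \<le> s"
      unfolding f by (auto simp: vball_subset_iff)
    then have "s = r" by linarith
    moreover have "vge r (y - x)" using a(2) by (rule vge_mono) simp
    ultimately have "vball y (s + 1) = vball x (r + 1)" "vball y s = vball x r"
      using a(2) by (simp_all add: vball_eq_iff)
    then show "f = {vball x (r + 1), vball x r}" using f by simp
  qed (auto simp: vball_subset_iff)
qed

lemma bridged_bt_tree: "bridged bt_tree"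
  unfolding bridged_def
proof
  fix e :: "'a fls set set" assume "e \<in> gedges bt_tree"
  then obtain x r where e: "e = {vball x (r + 1), vball x r}"
    by (auto simp: bt_tree_eq ball_edges_def)
  have "crosses bt_tree {B. B \<subseteq> vball x (r + 1)} f \<longleftrightarrow> f = e" if "f \<in> gedges bt_tree" for f
    using ball_edge_crosses[of f x r] that by (simp add: crosses_def bt_tree_eq e)
  then show "\<exists>W. \<forall>f\<in>gedges bt_tree. crosses bt_tree W f \<longleftrightarrow> f = e" by blast
qed

text \<open>The vertices of the lines joining the points of \<open>P\<close> to infinity.\<close>

definition balls_around :: "'a::field fls set \<Rightarrow> 'a fls set set" where
  "balls_around P = {vball x r | x r. x \<in> P}"

lemma balls_aroundI: "x \<in> P \<Longrightarrow> vball x r \<in> balls_around P"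
  by (auto simp: balls_around_def)

lemma balls_around_UNIV: "balls_around UNIV = vballs"
  by (auto simp: balls_around_def vballs_def)

lemma reachable_down:
  assumes "x \<in> P"
  shows "reachable (induced ball_edges (balls_around P)) (vball x (r + int k)) (vball x r)"
proof (induction k)
  case 0
  then show ?case using balls_aroundI[OF assms] by (auto intro: reachable_refl)
next
  case (Suc k)
  have "{vball x (r + int (Suc k)), vball x (r + int k)} \<in> ball_edges"
    using ball_edgesI[of x "r + int k"] by (simp add: algebra_simps)
  then have "reachable (induced ball_edges (balls_around P)) (vball x (r + int (Suc k))) (vball x (r + int k))"
    using balls_aroundI[OF assms]
    by (intro reachable_edge[where e = "{vball x (r + int (Suc k)), vball x (r + int k)}"]) simp_all
  then show ?case using Suc by (rule reachable_trans)
qed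

lemma reachable_line:
  assumes "x \<in> P" "s \<le> r"
  shows "reachable (induced ball_edges (balls_around P)) (vball x r) (vball x s)"
  using reachable_down[OF assms(1), of s "nat (r - s)"] assms(2) by simp

lemma connected_balls_around:
  assumes "p \<in> P"
  shows "graph_connected (induced ball_edges (balls_around P))"
proof (rule graph_connectedI[of "vball p 0"])
  show "vball p 0 \<in> gverts (induced ball_edges (balls_around P))"
    using balls_aroundI[OF assms] by simp
  fix B assume "B \<in> gverts (induced ball_edges (balls_around P))"
  then obtain x r where B: "B = vball x r" "x \<in> P" by (auto simp: balls_around_def)
  \<comment> \<open>Two points share every ball whose radius is at most the valuation of their
    difference, so the two lines have merged at radius \<open>m\<close>. For \<open>x = p\<close>
    the default value \<open>0\<close> of \<open>fls_subdegree\<close> does no harm.\<close>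
  define m where "m = min (min r 0) (fls_subdegree (x - p))"
  have "vball x m = vball p m" unfolding vball_eq_iff vge_def m_def by simp
  moreover have "m \<le> r" "m \<le> 0" by (auto simp: m_def)
  ultimately have "reachable (induced ball_edges (balls_around P)) B (vball p m)"
    "reachable (induced ball_edges (balls_around P)) (vball p 0) (vball p m)"
    using reachable_line[OF B(2), of m r] reachable_line[OF assms, of m 0] B(1) by simp_all
  then show "reachable (induced ball_edges (balls_around P)) B (vball p 0)"
    using reachable_sym reachable_trans by metis
qed

lemma connected_bt_tree: "graph_connected bt_tree"
  using connected_balls_around[of 0 UNIV] by (simp add: bt_tree_eq balls_around_UNIV)

lemma subgraph_balls_around: "subgraph (induced ball_edges (balls_around P)) bt_tree"
  using ball_edges_subset by (auto simp: subgraph_def bt_tree_eq balls_around_def vballs_def)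

lemma ray_balls_shrinking: "x \<in> P \<Longrightarrow> ray (induced ball_edges (balls_around P)) (\<lambda>k. vball x (int k))"
proof -
  assume x: "x \<in> P"
  have "{vball x (int k), vball x (int (Suc k))} \<in> ball_edges" for k
    using ball_edgesI[of x "int k"] by (simp add: insert_commute algebra_simps)
  then show ?thesis
    using balls_aroundI[OF x] by (auto simp: ray_def inj_def vball_eq_iff)
qed

lemma ray_balls_growing: "x \<in> P \<Longrightarrow> ray (induced ball_edges (balls_around P)) (\<lambda>k. vball x (- int k))"
proof -
  assume x: "x \<in> P"
  have "{vball x (- int k), vball x (- int (Suc k))} \<in> ball_edges" for k
    using ball_edgesI[of x "- int (Suc k)"] by simp
  then show ?thesis
    using balls_aroundI[OF x] by (auto simp: ray_def inj_def vball_eq_iff)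
qed

lemma balls_around_edge:
  assumes "e \<in> ball_edges" "e \<subseteq> balls_around P"
  obtains x r where "x \<in> P" "e = {vball x (r + 1), vball x r}"
proof -
  obtain y s where e: "e = {vball y (s + 1), vball y s}" using assms(1) by (auto simp: ball_edges_def)
  then have "vball y (s + 1) \<in> balls_around P" using assms(2) by simp
  then obtain x r where x: "vball y (s + 1) = vball x r" "x \<in> P" by (auto simp: balls_around_def)
  then have "vge (s + 1) (y - x)" "r = s + 1" by (auto simp: vball_eq_iff)
  then have "vball y s = vball x s" by (auto simp: vball_eq_iff intro: vge_mono)
  then show ?thesis using that[of x s] e x \<open>r = s + 1\<close> by simp
qed

text \<open>A subtree with the ends \<open>x\<close> and infinity has vertices deep inside and far
  outside \<open>vball x (r + 1)\<close>. A walk between them must use the only edge leaving that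
  branch, so every edge on the line is forced.\<close>

lemma smallest_subtree_balls_around:
  assumes "0 \<in> P"
  shows "smallest_subtree bt_tree ({bt_end Infinity} \<union> {bt_end (Affine x) | x. x \<in> P})
    (induced ball_edges (balls_around P))" (is "smallest_subtree _ ?E ?S")
  unfolding smallest_subtree_def
proof (intro conjI allI impI ballI)
  show sub: "subgraph ?S bt_tree" by (rule subgraph_balls_around)
  show "is_tree ?S"
    using bridged_subgraph[OF bridged_bt_tree sub] connected_balls_around[OF assms] by (rule is_treeI)
  have UN: "induced ball_edges (balls_around UNIV) = bt_tree" by (simp add: bt_tree_eq balls_around_UNIV)
  have self: "\<rho> \<in> end_class bt_tree \<rho>" if "ray bt_tree \<rho>" for \<rho>
    using that unfolding end_class_def by auto
  fix \<epsilon> assume "\<epsilon> \<in> ?E"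
  then consider "\<epsilon> = bt_end Infinity" | x where "\<epsilon> = bt_end (Affine x)" "x \<in> P" by blast
  then show "contains_end ?S \<epsilon>"
  proof cases
    case 1
    then show ?thesis
      using self[OF ray_balls_growing[of 0 UNIV, unfolded UN]] ray_balls_growing[OF assms]
      unfolding contains_end_def by auto
  next
    case 2
    then show ?thesis
      using self[OF ray_balls_shrinking[of x UNIV, unfolded UN]] ray_balls_shrinking[OF 2(2)]
      unfolding contains_end_def by auto
  qed
next
  fix S' assume S': "subgraph S' bt_tree \<and> is_tree S' \<and> (\<forall>\<epsilon>\<in>?E. contains_end S' \<epsilon>)"
  have edge: "{vball x (r + 1), vball x r} \<in> gedges S'" if x: "x \<in> P" for x r
  proof -
    have "contains_end S' (bt_end (Affine x))" "contains_end S' (bt_end Infinity)" using S' x by blast+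
    then obtain \<rho> m n \<rho>' m' n' where
      \<rho>: "ray S' \<rho>" "\<forall>k. \<rho> (k + m) = vball x (int (k + n))" and
      \<rho>': "ray S' \<rho>'" "\<forall>k. \<rho>' (k + m') = vball 0 (- int (k + n'))"
      unfolding contains_end_def end_class_def bt_end.simps by blast
    \<comment> \<open>\<open>k\<close> makes the ball on the first ray lie in
      \<open>vball x (r + 1)\<close>. \<open>k'\<close> makes the ball on the second ray too large
      for that, and large enough to contain \<open>x\<close>, so that it is also centred at
      \<open>x\<close>; the shifts \<open>n\<close> and \<open>n'\<close> only help.\<close>
    define k where "k = nat (\<bar>r\<bar> + 1)"
    define k' where "k' = nat (\<bar>r\<bar> + \<bar>fls_subdegree x\<bar>)"
    have A: "vball x (int (k + n)) \<in> gverts S'"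
      using \<rho>(1) \<rho>(2)[rule_format, of k] unfolding ray_def by (metis range_subsetD)
    have "vball 0 (- int (k' + n')) = vball x (- int (k' + n'))"
      by (auto simp: vball_eq_iff vge_def k'_def)
    then have B: "vball x (- int (k' + n')) \<in> gverts S'"
      using \<rho>'(1) \<rho>'(2)[rule_format, of k'] unfolding ray_def by (metis range_subsetD)
    obtain p where p: "walk S' (vball x (int (k + n))) p (vball x (- int (k' + n')))"
      using A B S' by (metis graph_connected_def is_tree_def)
    let ?W = "{B. B \<subseteq> vball x (r + 1)}"
    have "vball x (int (k + n)) \<in> ?W" "vball x (- int (k' + n')) \<notin> ?W"
      by (auto simp: vball_subset_iff k_def k'_def)
    with walk_crosses[OF p, of ?W] obtain e where e: "e \<in> gedges S'" "crosses S' ?W e" by blast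
    then have "e \<in> ball_edges" "gends S' e = e" using S' by (auto simp: subgraph_def bt_tree_eq)
    then have "e = {vball x (r + 1), vball x r}"
      using e(2) ball_edge_crosses[of e x r] by (simp add: crosses_def)
    then show ?thesis using e by simp
  qed
  have "vball x r \<in> gverts S'" if "x \<in> P" for x r
  proof -
    have "gends bt_tree {vball x (r + 1), vball x r} \<subseteq> gverts S'"
      using edge[OF that] S' by (auto simp: subgraph_def)
    then show ?thesis by (simp add: bt_tree_eq)
  qed
  then have "gverts ?S \<subseteq> gverts S'" by (auto simp: balls_around_def)
  moreover have "gedges ?S \<subseteq> gedges S'" using edge by (auto elim: balls_around_edge)
  moreover have "gends S' = (\<lambda>e. e)" using S' by (simp add: subgraph_def bt_tree_eq)
  ultimately show "subgraph ?S S'" unfolding subgraph_def by simp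
qed

section \<open>The action on balls\<close>

lemma vector2_eq_iff: "v = w \<longleftrightarrow> v $ 1 = w $ 1 \<and> v $ 2 = (w $ 2 :: 'a)" for v w :: "'a ^ 2"
  by (simp add: vec_eq_iff forall_2)

text \<open>The right side describes integral coordinates in the basis \<open>(t, 0)\<close>,
  \<open>(x, 1)\<close> with \<open>t = fls_X_intpow r\<close>. The vector \<open>(t, 0)\<close> is
  the difference of the generators \<open>(x + t, 1)\<close> and \<open>(x, 1)\<close>.\<close>

lemma ball_lattice_vball:
  fixes x :: "'a::field fls"
  shows "ball_lattice (vball x r) = {v. vge 0 (v $ 2) \<and> vge r (v $ 1 - x * v $ 2)}" (is "_ = ?L")
proof
  have "integral_submodule ?L"
    unfolding integral_submodule_def
  proof (intro conjI ballI)
    fix v w assume v: "v \<in> ?L" and w: "w \<in> ?L"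
    have "vge r ((v $ 1 - x * v $ 2) + (w $ 1 - x * w $ 2))" using v w by (auto intro: vge_add)
    then show "v + w \<in> ?L" using v w by (auto simp: algebra_simps intro: vge_add)
  next
    fix a :: "'a fls" and v assume a: "a \<in> vball 0 0" and v: "v \<in> ?L"
    have "vge (0 + r) (a * (v $ 1 - x * v $ 2))" "vge (0 + 0) (a * v $ 2)"
      using a v vge_mult[of 0 a r "v $ 1 - x * v $ 2"] vge_mult[of 0 a 0 "v $ 2"]
      by (simp_all add: mem_vball)
    then show "a *s v \<in> ?L" by (simp add: algebra_simps)
  qed simp
  moreover have "{vector [y, 1] | y. y \<in> vball x r} \<subseteq> ?L"
    by (auto simp: mem_vball vge_def)
  ultimately show "ball_lattice (vball x r) \<subseteq> ?L"
    unfolding ball_lattice_def by (intro hull_minimal)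
  show "?L \<subseteq> ball_lattice (vball x r)"
    unfolding ball_lattice_def hull_def
  proof (intro subsetI InterI)
    fix v S assume v: "v \<in> ?L"
      and S: "S \<in> {t. integral_submodule t \<and> {vector [y, 1] |y. y \<in> vball x r} \<subseteq> t}"
    then have add: "\<And>v w. v \<in> S \<Longrightarrow> w \<in> S \<Longrightarrow> v + w \<in> S"
      and scale: "\<And>a v. vge 0 a \<Longrightarrow> v \<in> S \<Longrightarrow> a *s v \<in> S"
      and gen: "\<And>y. vge r (y - x) \<Longrightarrow> vector [y, 1] \<in> S"
      by (auto simp: integral_submodule_def mem_vball)
    define t :: "'a fls" where "t = fls_X_intpow r"
    have t: "t \<noteq> 0" "fls_subdegree t = r" by (simp_all add: t_def)
    let ?a = "(v $ 1 - x * v $ 2) / t"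
    have "vge r (x + t - x)" using t by (simp add: vge_def)
    from gen[OF this] have g: "vector [x + t, 1] \<in> S" .
    have x: "vector [x, 1] \<in> S" by (intro gen) simp
    have "vge 0 ?a" using v t by (simp add: vge_divide_iff)
    then have "?a *s (vector [x + t, 1] + (- 1) *s vector [x, 1]) + (v $ 2) *s vector [x, 1] \<in> S"
      using g x v by (intro add scale) (auto simp: vge_def)
    also have "?a *s (vector [x + t, 1] + (- 1) *s vector [x, 1]) + (v $ 2) *s vector [x, 1] = v"
      unfolding vector2_eq_iff using t(1) by (simp add: field_simps)
    finally show "v \<in> S" .
  qed
qed

lemma homothetic_refl: "homothetic L L"
  unfolding homothetic_def by (intro exI[of _ 1]) simp

lemma homothetic_sym:
  assumes "homothetic L L'" shows "homothetic L' L"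
proof -
  obtain c where c: "c \<noteq> 0" "L' = (\<lambda>v. c *s v) ` L" using assms by (auto simp: homothetic_def)
  then have "L = (\<lambda>v. inverse c *s v) ` L'" by (simp add: image_image)
  then show ?thesis using c(1) unfolding homothetic_def by (intro exI[of _ "inverse c"]) simp
qed

lemma homothetic_trans:
  assumes "homothetic L L'" "homothetic L' L''" shows "homothetic L L''"
proof -
  obtain c d where "c \<noteq> 0" "L' = (\<lambda>v. c *s v) ` L" "d \<noteq> 0" "L'' = (\<lambda>v. d *s v) ` L'"
    using assms by (auto simp: homothetic_def)
  then have "d * c \<noteq> 0" "L'' = (\<lambda>v. (d * c) *s v) ` L" by (simp_all add: image_image)
  then show ?thesis unfolding homothetic_def by blast
qed

lemma homothetic_mult:
  assumes "homothetic L L'" shows "homothetic ((*v) g ` L) ((*v) g ` L')"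
proof -
  obtain c where "c \<noteq> 0" "L' = (\<lambda>v. c *s v) ` L" using assms by (auto simp: homothetic_def)
  then show ?thesis
    unfolding homothetic_def by (intro exI[of _ c]) (simp add: image_image vector_scalar_commute)
qed

text \<open>A preimage of \<open>(y, 1)\<close> has integral second coordinate, so the factor
  \<open>c\<close> has valuation at most \<open>0\<close>. The images of \<open>(x, 1)\<close> and
  \<open>(fls_X_intpow r, 0)\<close> then bound \<open>x - y\<close> and \<open>r\<close>. By
  symmetry, homothetic ball lattices belong to equal balls.\<close>

lemma homothetic_ball_lattice_imp:
  fixes x y :: "'a::field fls"
  assumes "homothetic (ball_lattice (vball x r)) (ball_lattice (vball y s))"
  shows "s \<le> r \<and> vge s (x - y)"
proof -
  obtain c where c: "c \<noteq> 0" and eq: "ball_lattice (vball y s) = (\<lambda>v. c *s v) ` ball_lattice (vball x r)"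
    using assms by (auto simp: homothetic_def)
  have "vector [y, 1] \<in> ball_lattice (vball y s)" by (simp add: ball_lattice_vball vge_def)
  then obtain v :: "'a fls ^ 2" where "v \<in> ball_lattice (vball x r)" "vector [y, 1] = c *s v"
    unfolding eq by blast
  then have v: "vge 0 (v $ 2)" "vector [y, 1] = c *s v" by (simp_all add: ball_lattice_vball)
  have "1 = c * v $ 2" using arg_cong[OF v(2), of "\<lambda>v. v $ 2"] by simp
  then have "0 = fls_subdegree c + fls_subdegree (v $ 2)" "v $ 2 \<noteq> 0"
    by (metis fls_subdegree_mult fls_one_subdegree mult_zero_right zero_neq_one c) (use \<open>1 = c * v $ 2\<close> in auto)
  then have c0: "fls_subdegree c \<le> 0" using v(1) by (simp add: vge_def)
  have "vector [x, 1] \<in> ball_lattice (vball x r)" by (simp add: ball_lattice_vball vge_def)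
  then have "c *s vector [x, 1] \<in> ball_lattice (vball y s)" unfolding eq by blast
  then have 1: "vge s (c * (x - y))" by (simp add: ball_lattice_vball algebra_simps)
  have "vector [fls_X_intpow r, 0] \<in> ball_lattice (vball x r)" by (simp add: ball_lattice_vball vge_def)
  then have "c *s vector [fls_X_intpow r, 0] \<in> ball_lattice (vball y s)" unfolding eq by blast
  then have 2: "vge s (c * fls_X_intpow r)" by (simp add: ball_lattice_vball)
  show ?thesis
    using 1 2 c c0 by (auto simp: vge_mult_iff intro: vge_mono) (simp add: vge_def)
qed

lemma homothetic_ball_lattice:
  assumes "B \<in> vballs" "B' \<in> vballs" "homothetic (ball_lattice B) (ball_lattice B')"
  shows "B = B'"
proof -
  obtain x r y s where B: "B = vball x r" "B' = vball y s" using assms by (metis vball_cases)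
  have "B \<subseteq> B'" "B' \<subseteq> B"
    using homothetic_ball_lattice_imp assms(3) homothetic_sym[OF assms(3)]
    unfolding B vball_subset_iff by blast+
  then show ?thesis by blast
qed

lemma ball_act_eqI:
  assumes "B' \<in> vballs" "homothetic ((*v) g ` ball_lattice B) (ball_lattice B')"
  shows "ball_act g B = B'"
  unfolding ball_act_def
proof (rule the_equality)
  show "B' \<in> vballs \<and> homothetic ((*v) g ` ball_lattice B) (ball_lattice B')" using assms by simp
  fix C assume C: "C \<in> vballs \<and> homothetic ((*v) g ` ball_lattice B) (ball_lattice C)"
  then have "homothetic (ball_lattice C) (ball_lattice B')"
    using assms(2) homothetic_sym homothetic_trans by blast
  then show "C = B'" using C assms(1) homothetic_ball_lattice by blast
qed

section \<open>Images of balls under Moebius transformations\<close>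

lemma mult2_nth:
  fixes g :: "'a::semiring_1 ^ 2 ^ 2"
  shows "(g *v v) $ 1 = g $ 1 $ 1 * v $ 1 + g $ 1 $ 2 * v $ 2"
    "(g *v v) $ 2 = g $ 2 $ 1 * v $ 1 + g $ 2 $ 2 * v $ 2"
  by (simp_all add: matrix_vector_mult_def sum_2)

context
  fixes g :: "'a::field fls ^ 2 ^ 2" and x :: "'a fls" and r :: int
  assumes det: "det g \<noteq> 0"
begin

text \<open>The denominator of the Moebius transformation \<open>g\<close> does not vanish on the ball.\<close>

lemma homothetic_affine:
  assumes q: "g $ 2 $ 1 * x + g $ 2 $ 2 \<noteq> 0"
    and c: "vge (fls_subdegree (g $ 2 $ 1 * x + g $ 2 $ 2) - r) (g $ 2 $ 1)"
  shows "homothetic ((*v) g ` ball_lattice (vball x r)) (ball_lattice (vball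
    ((g $ 1 $ 1 * x + g $ 1 $ 2) / (g $ 2 $ 1 * x + g $ 2 $ 2))
    (r + fls_subdegree (det g) - 2 * fls_subdegree (g $ 2 $ 1 * x + g $ 2 $ 2))))"
proof -
  define q p where "q = g $ 2 $ 1 * x + g $ 2 $ 2" and "p = g $ 1 $ 1 * x + g $ 1 $ 2"
  define D where "D = det g"
  have D: "D = g $ 1 $ 1 * g $ 2 $ 2 - g $ 1 $ 2 * g $ 2 $ 1" by (simp add: D_def det_2)
  have Dpq: "g $ 1 $ 1 * q - p * g $ 2 $ 1 = D" by (simp add: D p_def q_def algebra_simps)
  have q0: "q \<noteq> 0" and D0: "D \<noteq> 0" using q det by (auto simp: q_def D_def)
  have c: "vge (fls_subdegree q - r) (g $ 2 $ 1)" using c by (simp add: q_def)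
  have act1: "(g *v v) $ 1 = g $ 1 $ 1 * (v $ 1 - x * v $ 2) + p * v $ 2"
    and act2: "(g *v v) $ 2 = g $ 2 $ 1 * (v $ 1 - x * v $ 2) + q * v $ 2" for v
    by (simp_all add: mult2_nth p_def q_def algebra_simps)
  have int: "vge 0 (g $ 2 $ 1 * e / q)" if "vge r e" for e
    using vge_mult[OF c that] q0 by (simp add: vge_divide_iff)
  \<comment> \<open>The vector \<open>(x, 1)\<close> goes to \<open>(p, q)\<close>, and dividing by
    \<open>q\<close> makes its second coordinate \<open>1\<close>. The hypothesis on the pole enters
    through \<open>int\<close>; the new radius comes from the determinant identity
    \<open>Dpq\<close>.\<close>
  have "ball_lattice (vball (p / q) (r + fls_subdegree D - 2 * fls_subdegree q)) =
    (\<lambda>v. inverse q *s v) ` (*v) g ` ball_lattice (vball x r)" (is "?L = ?R")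
  proof
    show "?R \<subseteq> ?L"
    proof
      fix w assume "w \<in> ?R"
      then obtain v where v: "vge 0 (v $ 2)" "vge r (v $ 1 - x * v $ 2)" "w = inverse q *s (g *v v)"
        by (auto simp: ball_lattice_vball)
      have w2: "w $ 2 = g $ 2 $ 1 * (v $ 1 - x * v $ 2) / q + v $ 2"
        using q0 by (simp add: v act2 field_simps)
      have w1: "w $ 1 = inverse q * (g $ 1 $ 1 * (v $ 1 - x * v $ 2) + p * v $ 2)"
        by (simp add: v act1)
      have "w $ 1 - p / q * w $ 2 = (v $ 1 - x * v $ 2) * (g $ 1 $ 1 * q - p * g $ 2 $ 1) / q ^ 2"
        using q0 unfolding w2 w1 by (simp add: field_simps power2_eq_square)
      then have w1: "w $ 1 - p / q * w $ 2 = D * (v $ 1 - x * v $ 2) / q ^ 2"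
        unfolding Dpq by simp
      have "vge 0 (w $ 2)" unfolding w2 using int[OF v(2)] v(1) by (rule vge_add)
      moreover have "vge (r + fls_subdegree D - 2 * fls_subdegree q) (w $ 1 - p / q * w $ 2)"
        using v(2) q0 D0 unfolding w1 by (simp add: vge_divide_iff vge_mult_iff fls_subdegree_pow)
      ultimately show "w \<in> ?L" by (simp add: ball_lattice_vball)
    qed
    show "?L \<subseteq> ?R"
    proof
      fix w assume "w \<in> ?L"
      then have w: "vge 0 (w $ 2)" "vge (r + fls_subdegree D - 2 * fls_subdegree q) (w $ 1 - p / q * w $ 2)"
        by (auto simp: ball_lattice_vball)
      \<comment> \<open>\<open>e\<close> and \<open>f\<close> are the lattice coordinates of the
        preimage, obtained by solving the formulas of the other inclusion for them.\<close>
      define e where "e = q ^ 2 * (w $ 1 - p / q * w $ 2) / D"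
      define f where "f = w $ 2 - g $ 2 $ 1 * e / q"
      define v :: "'a fls ^ 2" where "v = vector [e + x * f, f]"
      have q2: "q ^ 2 \<noteq> 0" using q0 by simp
      have e: "vge r e"
        unfolding e_def vge_divide_iff[OF D0] vge_mult_iff[OF q2] fls_subdegree_pow
        using w(2) by (rule vge_mono) simp
      have "vge 0 f" unfolding f_def using w(1) int[OF e] by (rule vge_diff)
      with e have vL: "v \<in> ball_lattice (vball x r)" by (simp add: ball_lattice_vball v_def)
      have v: "v $ 1 - x * v $ 2 = e" "v $ 2 = f" by (simp_all add: v_def)
      have w2: "w $ 2 = inverse q * (g $ 2 $ 1 * e + q * f)"
        using q0 by (simp add: f_def field_simps)
      have "inverse q * (g $ 1 $ 1 * e + p * f) = e * (g $ 1 $ 1 * q - p * g $ 2 $ 1) / q ^ 2 + p / q * w $ 2"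
        using q0 unfolding w2 by (simp add: field_simps power2_eq_square)
      also have "\<dots> = w $ 1" unfolding Dpq using q0 D0 by (simp add: e_def)
      finally have "w = inverse q *s (g *v v)"
        unfolding vector2_eq_iff vector_smult_component act1 act2 v(1) unfolding v(2) using w2 by simp
      then show "w \<in> ?R" using vL by blast
    qed
  qed
  then show ?thesis
    using q0 unfolding homothetic_def q_def p_def D_def by (intro exI[of _ "inverse q"]) (simp add: q_def)
qed

text \<open>The ball contains the pole of \<open>g\<close>, up to the boundary case.\<close>

lemma homothetic_pole:
  assumes c: "g $ 2 $ 1 \<noteq> 0"
    and q: "vge (fls_subdegree (g $ 2 $ 1) + r) (g $ 2 $ 1 * x + g $ 2 $ 2)"
  shows "homothetic ((*v) g ` ball_lattice (vball x r)) (ball_lattice (vball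
    (g $ 1 $ 1 / g $ 2 $ 1) (fls_subdegree (det g) - 2 * fls_subdegree (g $ 2 $ 1) - r)))"
proof -
  define q p where "q = g $ 2 $ 1 * x + g $ 2 $ 2" and "p = g $ 1 $ 1 * x + g $ 1 $ 2"
  define a c where "a = g $ 1 $ 1" and "c = g $ 2 $ 1"
  define D where "D = det g"
  define t :: "'a fls" where "t = fls_X_intpow r"
  have t0: "t \<noteq> 0" and vt: "fls_subdegree t = r" by (simp_all add: t_def)
  have D: "D = g $ 1 $ 1 * g $ 2 $ 2 - g $ 1 $ 2 * g $ 2 $ 1" by (simp add: D_def det_2)
  have Dpq: "a * q - p * c = D" by (simp add: D p_def q_def a_def c_def algebra_simps)
  have c0: "c \<noteq> 0" and D0: "D \<noteq> 0" using c det by (auto simp: c_def D_def)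
  have q: "vge (fls_subdegree c + r) q" using q by (simp add: q_def c_def)
  have act1: "(g *v v) $ 1 = a * (v $ 1 - x * v $ 2) + p * v $ 2"
    and act2: "(g *v v) $ 2 = c * (v $ 1 - x * v $ 2) + q * v $ 2" for v
    by (simp_all add: mult2_nth p_def q_def a_def c_def algebra_simps)
  have ct: "c * t \<noteq> 0" using c0 t0 by simp
  have vct: "fls_subdegree (c * t) = fls_subdegree c + r" using c0 t0 vt by simp
  have int: "vge r (q * f / c)" if "vge 0 f" for f
    using vge_mult[OF q that] c0 by (simp add: vge_divide_iff algebra_simps)
  \<comment> \<open>Now \<open>(t, 0)\<close> is the vector to normalise: its image is
    \<open>(a * t, c * t)\<close>, which explains both the factor \<open>inverse (c * t)\<close> and
    the centre \<open>a / c\<close>.\<close>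
  have "ball_lattice (vball (a / c) (fls_subdegree D - 2 * fls_subdegree c - r)) =
    (\<lambda>v. inverse (c * t) *s v) ` (*v) g ` ball_lattice (vball x r)" (is "?L = ?R")
  proof
    show "?R \<subseteq> ?L"
    proof
      fix w assume "w \<in> ?R"
      then obtain v where v: "vge 0 (v $ 2)" "vge r (v $ 1 - x * v $ 2)" "w = inverse (c * t) *s (g *v v)"
        by (auto simp: ball_lattice_vball)
      have w2: "w $ 2 = (v $ 1 - x * v $ 2 + q * v $ 2 / c) / t"
        using c0 t0 by (simp add: v act2 field_simps)
      have w1: "w $ 1 = inverse (c * t) * (a * (v $ 1 - x * v $ 2) + p * v $ 2)"
        by (simp add: v act1)
      have "w $ 1 - a / c * w $ 2 = - ((a * q - p * c) * v $ 2 / (c ^ 2 * t))"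
        using c0 t0 unfolding w2 w1 by (simp add: field_simps power2_eq_square)
      then have w1: "w $ 1 - a / c * w $ 2 = - (D * v $ 2 / (c ^ 2 * t))"
        unfolding Dpq by simp
      have vc2t: "fls_subdegree (c ^ 2 * t) = 2 * fls_subdegree c + r"
        using c0 t0 vt by (simp add: fls_subdegree_pow)
      have "vge 0 (w $ 2)"
        using int[OF v(1)] v(2) t0 vt unfolding w2 by (simp add: vge_divide_iff vge_add)
      moreover have "vge (fls_subdegree D - 2 * fls_subdegree c - r) (w $ 1 - a / c * w $ 2)"
        using v(1) D0 c0 t0 vc2t unfolding w1 vge_uminus
        by (subst vge_divide_iff) (auto simp: vge_mult_iff intro: vge_mono)
      ultimately show "w \<in> ?L" by (simp add: ball_lattice_vball)
    qed
    show "?L \<subseteq> ?R"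
    proof
      fix w assume "w \<in> ?L"
      then have w: "vge 0 (w $ 2)" "vge (fls_subdegree D - 2 * fls_subdegree c - r) (w $ 1 - a / c * w $ 2)"
        by (auto simp: ball_lattice_vball)
      define f where "f = - ((c ^ 2 * t) * (w $ 1 - a / c * w $ 2) / D)"
      define e where "e = t * w $ 2 - q * f / c"
      define v :: "'a fls ^ 2" where "v = vector [e + x * f, f]"
      have vc2t: "fls_subdegree (c ^ 2 * t) = 2 * fls_subdegree c + r"
        using c0 t0 vt by (simp add: fls_subdegree_pow)
      have c2t: "c ^ 2 * t \<noteq> 0" using c0 t0 by simp
      have "vge 0 ((c ^ 2 * t) * (w $ 1 - a / c * w $ 2) / D)"
        unfolding vge_divide_iff[OF D0] vge_mult_iff[OF c2t] vc2t using w(2) by (rule vge_mono) simp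
      then have f: "vge 0 f" unfolding f_def by simp
      have "vge r (t * w $ 2)" using w(1) t0 vt by (simp add: vge_mult_iff)
      then have "vge r e" unfolding e_def using int[OF f] by (rule vge_diff)
      with f have vL: "v \<in> ball_lattice (vball x r)" by (simp add: ball_lattice_vball v_def)
      have v: "v $ 1 - x * v $ 2 = e" "v $ 2 = f" by (simp_all add: v_def)
      have w2: "w $ 2 = inverse (c * t) * (c * e + q * f)"
        using c0 t0 by (simp add: e_def field_simps)
      have "inverse (c * t) * (a * e + p * f) = - (f * (a * q - p * c) / (c ^ 2 * t)) + a / c * w $ 2"
        using c0 t0 unfolding w2 by (simp add: field_simps power2_eq_square)
      also have "\<dots> = w $ 1" unfolding Dpq using c2t D0 by (simp add: f_def)
      finally have "w = inverse (c * t) *s (g *v v)"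
        unfolding vector2_eq_iff vector_smult_component act1 act2 v(1) unfolding v(2) using w2 by simp
      then show "w \<in> ?R" using vL by blast
    qed
  qed
  then show ?thesis
    using ct unfolding homothetic_def a_def c_def D_def by (intro exI[of _ "inverse (c * t)"]) (simp add: c_def)
qed

lemmas ball_act_affine = ball_act_eqI[OF vball_in_vballs homothetic_affine]
lemmas ball_act_pole = ball_act_eqI[OF vball_in_vballs homothetic_pole]

text \<open>The two formulas overlap when the denominator at \<open>x\<close> has the valuation of
  \<open>g $ 2 $ 1\<close> plus \<open>r\<close>. Giving this case to \<open>affine\<close> leaves a
  margin of one in \<open>pole\<close>, so radii \<open>r\<close> and \<open>r + 1\<close>, the two
  ends of an edge, are always treated by the same formula.\<close>

lemma affine_or_pole:
  obtains (affine) "g $ 2 $ 1 * x + g $ 2 $ 2 \<noteq> 0"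
      "vge (fls_subdegree (g $ 2 $ 1 * x + g $ 2 $ 2) - r) (g $ 2 $ 1)"
    | (pole) "g $ 2 $ 1 \<noteq> 0" "vge (fls_subdegree (g $ 2 $ 1) + r + 1) (g $ 2 $ 1 * x + g $ 2 $ 2)"
proof (cases "g $ 2 $ 1 = 0")
  case True
  then have "g $ 2 $ 2 \<noteq> 0" using det by (auto simp: det_2)
  then show ?thesis using True affine by simp
next
  case False
  show ?thesis
  proof (cases "vge (fls_subdegree (g $ 2 $ 1) + r + 1) (g $ 2 $ 1 * x + g $ 2 $ 2)")
    case True
    then show ?thesis using False pole by simp
  next
    case f: False
    then show ?thesis using False affine by (simp add: vge_def)
  qed
qed

end

lemma ball_act_vballs:
  assumes "det g \<noteq> 0" "B \<in> vballs"
  shows "ball_act g B \<in> vballs" "homothetic ((*v) g ` ball_lattice B) (ball_lattice (ball_act g B))"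
proof -
  obtain x r where B: "B = vball x r" using assms(2) by (rule vball_cases)
  have "\<exists>B'\<in>vballs. homothetic ((*v) g ` ball_lattice B) (ball_lattice B')"
  proof (rule affine_or_pole[OF assms(1), of x r])
    assume a: "g $ 2 $ 1 * x + g $ 2 $ 2 \<noteq> 0" "vge (fls_subdegree (g $ 2 $ 1 * x + g $ 2 $ 2) - r) (g $ 2 $ 1)"
    show ?thesis using homothetic_affine[OF assms(1) a] vball_in_vballs unfolding B by blast
  next
    assume a: "g $ 2 $ 1 \<noteq> 0" "vge (fls_subdegree (g $ 2 $ 1) + r + 1) (g $ 2 $ 1 * x + g $ 2 $ 2)"
    have "vge (fls_subdegree (g $ 2 $ 1) + r) (g $ 2 $ 1 * x + g $ 2 $ 2)" using a(2) by (rule vge_mono) simp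
    then show ?thesis using homothetic_pole[OF assms(1) a(1)] vball_in_vballs unfolding B by blast
  qed
  then show "ball_act g B \<in> vballs" "homothetic ((*v) g ` ball_lattice B) (ball_lattice (ball_act g B))"
    using ball_act_eqI by metis+
qed

lemma ball_act_mult:
  assumes "det g \<noteq> 0" "det h \<noteq> 0" "B \<in> vballs"
  shows "ball_act (g ** h) B = ball_act g (ball_act h B)"
proof (rule ball_act_eqI)
  have hB: "ball_act h B \<in> vballs" using ball_act_vballs assms by blast
  show "ball_act g (ball_act h B) \<in> vballs" using ball_act_vballs(1)[OF assms(1) hB] .
  have "(*v) (g ** h) ` ball_lattice B = (*v) g ` (*v) h ` ball_lattice B"
    by (simp add: image_image matrix_vector_mul_assoc)
  then show "homothetic ((*v) (g ** h) ` ball_lattice B) (ball_lattice (ball_act g (ball_act h B)))"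
    using homothetic_trans[OF homothetic_mult[OF ball_act_vballs(2)[OF assms(2,3)]] ball_act_vballs(2)[OF assms(1) hB]]
    by simp
qed

lemma ball_act_one: "B \<in> vballs \<Longrightarrow> ball_act (mat 1) B = B"
  by (rule ball_act_eqI) (auto simp: homothetic_refl)

lemma ball_act_edge:
  assumes "det g \<noteq> 0" "e \<in> ball_edges"
  shows "ball_act g ` e \<in> ball_edges"
proof -
  obtain x r where e: "e = {vball x (r + 1), vball x r}" using assms(2) by (auto simp: ball_edges_def)
  show ?thesis
  proof (rule affine_or_pole[OF assms(1), of x r])
    assume a: "g $ 2 $ 1 * x + g $ 2 $ 2 \<noteq> 0" "vge (fls_subdegree (g $ 2 $ 1 * x + g $ 2 $ 2) - r) (g $ 2 $ 1)"
    have a': "vge (fls_subdegree (g $ 2 $ 1 * x + g $ 2 $ 2) - (r + 1)) (g $ 2 $ 1)"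
      using a(2) by (rule vge_mono) simp
    define q s where "q = g $ 2 $ 1 * x + g $ 2 $ 2"
      and "s = r + fls_subdegree (det g) - 2 * fls_subdegree (g $ 2 $ 1 * x + g $ 2 $ 2)"
    have s: "r + 1 + fls_subdegree (det g) - 2 * fls_subdegree (g $ 2 $ 1 * x + g $ 2 $ 2) = s + 1"
      by (simp add: s_def)
    show ?thesis
      unfolding e image_insert image_empty ball_act_affine[OF assms(1) a] ball_act_affine[OF assms(1) a(1) a']
        s s_def[symmetric] by (rule ball_edgesI)
  next
    assume a: "g $ 2 $ 1 \<noteq> 0" "vge (fls_subdegree (g $ 2 $ 1) + r + 1) (g $ 2 $ 1 * x + g $ 2 $ 2)"
    have a': "vge (fls_subdegree (g $ 2 $ 1) + r) (g $ 2 $ 1 * x + g $ 2 $ 2)"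
      "vge (fls_subdegree (g $ 2 $ 1) + (r + 1)) (g $ 2 $ 1 * x + g $ 2 $ 2)"
      using a(2) by (auto simp: algebra_simps intro: vge_mono)
    define s where "s = fls_subdegree (det g) - 2 * fls_subdegree (g $ 2 $ 1) - r - 1"
    have "ball_act g (vball x (r + 1)) = vball (g $ 1 $ 1 / g $ 2 $ 1) s"
      "ball_act g (vball x r) = vball (g $ 1 $ 1 / g $ 2 $ 1) (s + 1)"
      using ball_act_pole[OF assms(1) a(1) a'(2)] ball_act_pole[OF assms(1) a(1) a'(1)]
      by (simp_all add: s_def algebra_simps)
    then show ?thesis
      using ball_edgesI[of "g $ 1 $ 1 / g $ 2 $ 1" s] unfolding e by (simp add: insert_commute)
  qed
qed

text \<open>Both formulas change the radius, up to sign, by the valuation of the determinant modulo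
  \<open>2\<close>. Adjacent balls have radii of opposite parity, so a determinant of valuation
  \<open>0\<close> excludes inversions.\<close>

lemma ball_act_parity:
  assumes "det g \<noteq> 0"
  obtains y s where "ball_act g (vball x r) = vball y s" "even (s - r - fls_subdegree (det g))"
proof (rule affine_or_pole[OF assms(1), of x r])
  assume a: "g $ 2 $ 1 * x + g $ 2 $ 2 \<noteq> 0" "vge (fls_subdegree (g $ 2 $ 1 * x + g $ 2 $ 2) - r) (g $ 2 $ 1)"
  show ?thesis using that[OF ball_act_affine[OF assms(1) a]] by simp
next
  assume a: "g $ 2 $ 1 \<noteq> 0" "vge (fls_subdegree (g $ 2 $ 1) + r + 1) (g $ 2 $ 1 * x + g $ 2 $ 2)"
  have "vge (fls_subdegree (g $ 2 $ 1) + r) (g $ 2 $ 1 * x + g $ 2 $ 2)" using a(2) by (rule vge_mono) simp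
  from that[OF ball_act_pole[OF assms(1) a(1) this]] show ?thesis by simp
qed

lemma ball_act_no_inversion:
  assumes g: "det g \<noteq> 0" "fls_subdegree (det g) = 0"
    and e: "e \<in> ball_edges" "B \<in> e" "ball_act g ` e = e"
  shows "ball_act g B = B"
proof -
  obtain x r where xr: "e = {vball x (r + 1), vball x r}" using e(1) by (auto simp: ball_edges_def)
  have swap: "ball_act g (vball x s) \<noteq> vball x t" if "odd (s - t)" for s t
  proof
    assume a: "ball_act g (vball x s) = vball x t"
    obtain y u where "ball_act g (vball x s) = vball y u" "even (u - s - fls_subdegree (det g))"
      using ball_act_parity[OF g(1)] by blast
    then have "even (t - s)" using a g(2) by (simp add: vball_eq_iff)
    then show False using that by simp
  qed
  have "ball_act g B \<in> e" using e by blast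
  then show ?thesis using e(2) swap[of r "r + 1"] swap[of "r + 1" r] unfolding xr by auto
qed

section \<open>Polynomial matrices and inequivalence\<close>

lemma pK_0 [simp]: "poly_to_Kinf 0 = 0"
  by (simp add: poly_to_Kinf_def)

lemma pK_pCons: "poly_to_Kinf (pCons a p) = fls_const a + fls_X_inv * poly_to_Kinf p"
  by (simp add: poly_to_Kinf_def map_poly_pCons)

lemma pK_const: "poly_to_Kinf [:a:] = fls_const a"
  by (simp add: pK_pCons)

lemma pK_1 [simp]: "poly_to_Kinf 1 = 1"
  by (metis one_pCons pK_const fls_const_1)

lemma pK_add: "poly_to_Kinf (p + q) = poly_to_Kinf p + poly_to_Kinf q"
  by (induction p q rule: poly_induct2) (simp_all add: pK_pCons fls_plus_const[symmetric] algebra_simps)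

lemma pK_smult: "poly_to_Kinf (smult a p) = fls_const a * poly_to_Kinf p"
  by (induction p) (simp_all add: pK_pCons algebra_simps flip: fls_const_mult_const)

lemma pK_mult: "poly_to_Kinf (p * q) = poly_to_Kinf p * poly_to_Kinf q"
proof (induction p)
  case (pCons a p)
  have "poly_to_Kinf (pCons a p * q) = poly_to_Kinf (smult a q + pCons 0 (p * q))" by simp
  also have "\<dots> = poly_to_Kinf (pCons a p) * poly_to_Kinf q"
    unfolding pK_add pK_pCons pK_smult pCons.IH by (simp add: algebra_simps)
  finally show ?case .
qed simp

lemma pK_uminus: "poly_to_Kinf (- p) = - poly_to_Kinf p"
  using pK_add[of p "- p"] by (simp add: eq_neg_iff_add_eq_0 add.commute)

lemma pK_diff: "poly_to_Kinf (p - q) = poly_to_Kinf p - poly_to_Kinf q"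
  using pK_add[of p "- q"] by (simp add: pK_uminus)

lemma pK_nth: "fls_nth (poly_to_Kinf p) i = (if i \<le> 0 then coeff p (nat (- i)) else 0)"
proof (induction p arbitrary: i)
  case (pCons a p)
  have "fls_nth (poly_to_Kinf (pCons a p)) i = fls_nth (fls_const a) i + fls_nth (poly_to_Kinf p) (i + 1)"
    by (simp add: pK_pCons fls_X_inv_times_conv_shift)
  also have "\<dots> = (if i \<le> 0 then coeff (pCons a p) (nat (- i)) else 0)"
  proof (cases "i < 0")
    case True
    then have "nat (- i) = Suc (nat (- (i + 1)))" by simp
    then show ?thesis using True by (simp add: pCons.IH)
  qed (simp add: pCons.IH)
  finally show ?case .
qed simp

lemma pK_eq_0_iff [simp]: "poly_to_Kinf p = 0 \<longleftrightarrow> p = 0"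
proof
  assume "poly_to_Kinf p = 0"
  then have "coeff p n = 0" for n using pK_nth[of p "- int n"] by simp
  then show "p = 0" by (intro poly_eqI) simp
qed simp

lemma subdegree_pK: "fls_subdegree (poly_to_Kinf p) = - int (degree p)"
proof (cases "p = 0")
  case False
  show ?thesis
  proof (rule fls_subdegree_eqI)
    show "fls_nth (poly_to_Kinf p) (- int (degree p)) \<noteq> 0" using False by (simp add: pK_nth)
    fix k assume "k < - int (degree p)"
    then show "fls_nth (poly_to_Kinf p) k = 0" by (simp add: pK_nth coeff_eq_0)
  qed
qed simp

lemma vge_pK: "vge k (poly_to_Kinf p) \<longleftrightarrow> p = 0 \<or> k \<le> - int (degree p)"
  by (simp add: vge_def subdegree_pK)

text \<open>The completed field is the sum of the polynomials and the maximal ideal;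
  \<open>p\<close> collects the coefficients at nonnegative powers of \<open>t\<close>.\<close>

lemma polynomial_part: "\<exists>p. vge 1 (y - poly_to_Kinf p)"
proof -
  define K where "K = nat (- fls_subdegree y)"
  define p where "p = Poly (map (\<lambda>i. fls_nth y (- int i)) [0..<Suc K])"
  have p: "coeff p i = (if i \<le> K then fls_nth y (- int i) else 0)" for i
    unfolding p_def coeff_Poly_eq by (auto simp: nth_default_def simp del: upt_Suc)
  have "fls_nth (y - poly_to_Kinf p) i = 0" if "i < 1" for i
  proof -
    have "fls_nth y i = 0" if "K < nat (- i)" using that by (auto simp: K_def)
    then show ?thesis using \<open>i < 1\<close> by (auto simp: pK_nth p not_le)
  qed
  then have "vge 1 (y - poly_to_Kinf p)" by (simp add: vge_nth)
  then show ?thesis by blast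
qed

section \<open>Polynomial matrices acting on balls\<close>

abbreviation pK_matrix :: "'a::field poly ^ 2 ^ 2 \<Rightarrow> 'a fls ^ 2 ^ 2" where
  "pK_matrix \<equiv> map_matrix poly_to_Kinf"

lemma matrix2_eq_iff:
  "A = B \<longleftrightarrow> A $ 1 $ 1 = B $ 1 $ 1 \<and> A $ 1 $ 2 = B $ 1 $ 2 \<and> A $ 2 $ 1 = B $ 2 $ 1 \<and> A $ 2 $ 2 = B $ 2 $ 2"
  for A B :: "'a ^ 2 ^ 2"
  by (auto simp: vec_eq_iff forall_2)

lemma matrix2_mult_nth: "(A ** B) $ i $ j = A $ i $ 1 * B $ 1 $ j + A $ i $ 2 * B $ 2 $ j"
  for A B :: "'a::semiring_1 ^ 2 ^ 2"
  by (simp add: matrix_matrix_mult_def sum_2)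

lemma pK_matrix_nth: "pK_matrix A $ i $ j = poly_to_Kinf (A $ i $ j)"
  by (simp add: map_matrix_def)

lemma pK_matrix_mult: "pK_matrix (A ** B) = pK_matrix A ** pK_matrix B"
  by (simp add: matrix2_eq_iff matrix2_mult_nth pK_matrix_nth pK_add pK_mult)

lemma pK_matrix_one: "pK_matrix (mat 1) = mat 1"
  by (simp add: matrix2_eq_iff pK_matrix_nth mat_def)

lemma det_pK_matrix: "det (pK_matrix A) = poly_to_Kinf (det A)"
  by (simp add: det_2 pK_matrix_nth pK_diff pK_mult)

definition mat2 :: "'a::zero \<Rightarrow> 'a \<Rightarrow> 'a \<Rightarrow> 'a \<Rightarrow> 'a ^ 2 ^ 2" where
  "mat2 a b c d = vector [vector [a, b], vector [c, d]]"

lemma mat2_nth [simp]: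
  "mat2 a b c d $ 1 $ 1 = a" "mat2 a b c d $ 1 $ 2 = b" "mat2 a b c d $ 2 $ 1 = c" "mat2 a b c d $ 2 $ 2 = d"
  by (simp_all add: mat2_def)

lemma mat_1_nth [simp]:
  "(mat 1 :: 'a::semiring_1 ^ 2 ^ 2) $ 1 $ 1 = 1" "(mat 1 :: 'a ^ 2 ^ 2) $ 1 $ 2 = 0"
  "(mat 1 :: 'a ^ 2 ^ 2) $ 2 $ 1 = 0" "(mat 1 :: 'a ^ 2 ^ 2) $ 2 $ 2 = 1"
  by (simp_all add: mat_def)

lemma invertible_det:
  fixes A :: "'a::field poly ^ 2 ^ 2"
  assumes "invertible A"
  shows "det A \<noteq> 0" "degree (det A) = 0"
proof -
  obtain B where "A ** B = mat 1" using assms by (auto simp: invertible_def)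
  then have "det A * det B = 1" by (metis det_mul det_I)
  then have "is_unit (det A)" by (metis dvd_triv_left)
  then show "det A \<noteq> 0" "degree (det A) = 0"
    by (metis not_is_unit_0, metis is_unit_iff_degree not_is_unit_0)
qed

lemma det_pK_invertible:
  assumes "invertible A"
  shows "det (pK_matrix A) \<noteq> 0" "fls_subdegree (det (pK_matrix A)) = 0"
  using invertible_det[OF assms] by (simp_all add: det_pK_matrix subdegree_pK)

definition pact :: "'a::field poly ^ 2 ^ 2 \<Rightarrow> 'a fls set \<Rightarrow> 'a fls set" where
  "pact A = ball_act (pK_matrix A)"

lemma pact_vballs: "invertible A \<Longrightarrow> B \<in> vballs \<Longrightarrow> pact A B \<in> vballs"
  unfolding pact_def by (intro ball_act_vballs det_pK_invertible)

lemma pact_mult: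
  "invertible A \<Longrightarrow> invertible A' \<Longrightarrow> B \<in> vballs \<Longrightarrow> pact (A ** A') B = pact A (pact A' B)"
  unfolding pact_def pK_matrix_mult by (intro ball_act_mult det_pK_invertible)

lemma pact_one: "B \<in> vballs \<Longrightarrow> pact (mat 1) B = B"
  unfolding pact_def pK_matrix_one by (rule ball_act_one)

lemma pact_edge: "invertible A \<Longrightarrow> e \<in> ball_edges \<Longrightarrow> pact A ` e \<in> ball_edges"
  unfolding pact_def by (intro ball_act_edge det_pK_invertible)

lemma invertible_inverse:
  assumes "invertible (A :: 'a::semiring_1 ^ 2 ^ 2)"
  obtains B where "invertible B" "A ** B = mat 1" "B ** A = mat 1"
  using assms by (auto simp: invertible_def)

definition lower :: "'a::comm_ring_1 \<Rightarrow> 'a ^ 2 ^ 2" where "lower m = mat2 1 0 m 1"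
definition upper :: "'a::comm_ring_1 \<Rightarrow> 'a ^ 2 ^ 2" where "upper m = mat2 1 m 0 1"
definition swap :: "'a::comm_ring_1 ^ 2 ^ 2" where "swap = mat2 0 1 1 0"

lemma lower_mult: "lower m ** lower k = lower (m + k)"
  by (simp add: lower_def matrix2_eq_iff matrix2_mult_nth add.commute)

lemma upper_mult: "upper m ** upper k = upper (m + k)"
  by (simp add: upper_def matrix2_eq_iff matrix2_mult_nth add.commute)

lemma swap_mult: "swap ** swap = mat 1"
  by (simp add: swap_def matrix2_eq_iff matrix2_mult_nth)

lemma lower_0: "lower 0 = mat 1" and upper_0: "upper 0 = mat 1"
  by (simp_all add: lower_def upper_def matrix2_eq_iff)

lemma invertible_lower: "invertible (lower m)"
  unfolding invertible_def by (intro exI[of _ "lower (- m)"]) (simp add: lower_mult lower_0)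

lemma invertible_upper: "invertible (upper m)"
  unfolding invertible_def by (intro exI[of _ "upper (- m)"]) (simp add: upper_mult upper_0)

lemma invertible_swap: "invertible swap"
  unfolding invertible_def by (intro exI[of _ swap]) (simp add: swap_mult)

lemma pact_upper: "pact (upper p) (vball 0 r) = vball (poly_to_Kinf p) r"
  unfolding pact_def
  using ball_act_affine[OF det_pK_invertible(1)[OF invertible_upper], of p 0 r]
    det_pK_invertible(2)[OF invertible_upper, of p]
  by (simp add: pK_matrix_nth) (simp add: upper_def)

lemma subdegree_det_swap: "fls_subdegree (det (pK_matrix (swap :: 'a::field poly ^ 2 ^ 2))) = 0"
  by (rule det_pK_invertible(2)[OF invertible_swap])

lemma pact_swap: "pact swap (vball 0 r) = vball (0 :: 'a::field fls) (- r)"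
proof -
  let ?g = "pK_matrix swap :: 'a fls ^ 2 ^ 2"
  have g: "?g $ 1 $ 1 = 0" "?g $ 1 $ 2 = 1" "?g $ 2 $ 1 = 1" "?g $ 2 $ 2 = 0"
    by (simp_all add: pK_matrix_nth) (simp_all add: swap_def)
  show ?thesis
    unfolding pact_def
    using ball_act_pole[of ?g r 0] det_pK_invertible[OF invertible_swap[where 'a = "'a poly"]]
    unfolding g by simp
qed

lemma pact_swap_nonzero:
  fixes x :: "'a::field fls"
  assumes "x \<noteq> 0" "fls_subdegree x \<le> r"
  shows "pact swap (vball (inverse x) (r - 2 * fls_subdegree x)) = vball x r"
proof -
  let ?g = "pK_matrix swap :: 'a fls ^ 2 ^ 2"
  have g: "?g $ 1 $ 1 = 0" "?g $ 1 $ 2 = 1" "?g $ 2 $ 1 = 1" "?g $ 2 $ 2 = 0"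
    by (simp_all add: pK_matrix_nth) (simp_all add: swap_def)
  have v: "fls_subdegree (inverse x) = - fls_subdegree x"
    using assms(1) by simp
  show ?thesis
    unfolding pact_def
    using ball_act_affine[OF det_pK_invertible(1)[OF invertible_swap], of "inverse x" "r - 2 * fls_subdegree x"]
      subdegree_det_swap[where 'a = 'a] assms v
    unfolding g by (simp add: vge_def inverse_eq_divide)
qed

text \<open>The ball contains the pole \<open>-1/M\<close>, of valuation \<open>degree M\<close>, so
  the pole formula applies. The ray from radius \<open>degree M\<close> towards infinity is folded
  onto the ray towards \<open>1/M\<close>, and its initial ball is fixed.\<close>

lemma pact_lower:
  assumes "M \<noteq> 0" "j \<le> int (degree M)"
  shows "pact (lower M) (vball 0 j) = vball (1 / poly_to_Kinf M) (2 * int (degree M) - j)"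
proof -
  let ?g = "pK_matrix (lower M)"
  have g: "?g $ 1 $ 1 = 1" "?g $ 1 $ 2 = 0" "?g $ 2 $ 1 = poly_to_Kinf M" "?g $ 2 $ 2 = 1"
    by (simp_all add: pK_matrix_nth) (simp_all add: lower_def)
  show ?thesis
    unfolding pact_def
    using ball_act_pole[OF det_pK_invertible(1)[OF invertible_lower[of M]], of j 0]
      det_pK_invertible(2)[OF invertible_lower[of M]] assms
    unfolding g by (simp add: vge_def subdegree_pK)
qed

text \<open>The lattices have the diagonal bases \<open>(fls_X_intpow j, 0)\<close>,
  \<open>(0, 1)\<close> and likewise for \<open>j'\<close>. The determinant is constant, so the
  homothety factor has valuation \<open>(j - j') / 2\<close>, and the bounds express integrality of
  \<open>H\<close> in these bases.\<close>

lemma pact_vball_degrees: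
  assumes H: "invertible H" and eq: "pact H (vball 0 j) = vball 0 j'"
  shows "H $ 1 $ 1 = 0 \<or> 2 * int (degree (H $ 1 $ 1)) \<le> j - j'"
    "H $ 1 $ 2 = 0 \<or> 2 * int (degree (H $ 1 $ 2)) \<le> - j - j'"
    "H $ 2 $ 1 = 0 \<or> 2 * int (degree (H $ 2 $ 1)) \<le> j + j'"
    "H $ 2 $ 2 = 0 \<or> 2 * int (degree (H $ 2 $ 2)) \<le> j' - j"
proof -
  define a b c d where abcd: "a = H $ 1 $ 1" "b = H $ 1 $ 2" "c = H $ 2 $ 1" "d = H $ 2 $ 2"
  let ?g = "pK_matrix H"
  have g: "?g $ 1 $ 1 = poly_to_Kinf a" "?g $ 1 $ 2 = poly_to_Kinf b"
    "?g $ 2 $ 1 = poly_to_Kinf c" "?g $ 2 $ 2 = poly_to_Kinf d"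
    by (simp_all add: pK_matrix_nth abcd)
  have det: "a * d = det H + b * c" "b * c = a * d - det H" by (simp_all add: det_2 abcd algebra_simps)
  have deg_det: "degree (det H) = 0" using invertible_det[OF H] by simp
  have goal: "(a = 0 \<or> 2 * int (degree a) \<le> j - j') \<and> (b = 0 \<or> 2 * int (degree b) \<le> - j - j') \<and>
    (c = 0 \<or> 2 * int (degree c) \<le> j + j') \<and> (d = 0 \<or> 2 * int (degree d) \<le> j' - j)"
  proof (rule affine_or_pole[OF det_pK_invertible(1)[OF H], of 0 j])
    assume a1: "?g $ 2 $ 1 * 0 + ?g $ 2 $ 2 \<noteq> 0"
      "vge (fls_subdegree (?g $ 2 $ 1 * 0 + ?g $ 2 $ 2) - j) (?g $ 2 $ 1)"
    have d0: "d \<noteq> 0" using a1 unfolding g by simp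
    have cb: "c = 0 \<or> - int (degree d) - j \<le> - int (degree c)"
      using a1(2) unfolding g by (simp add: vge_pK subdegree_pK)
    have "vball (poly_to_Kinf b / poly_to_Kinf d) (j + 2 * int (degree d)) = vball 0 j'"
      using ball_act_affine[OF det_pK_invertible(1)[OF H] a1] det_pK_invertible(2)[OF H] eq
      unfolding g pact_def by (simp add: subdegree_pK)
    then have j': "j' = j + 2 * int (degree d)"
      and "vge j' (poly_to_Kinf b / poly_to_Kinf d)" by (auto simp: vball_eq_iff)
    then have bb: "b = 0 \<or> j' - int (degree d) \<le> - int (degree b)"
      using d0 by (simp add: vge_divide_iff vge_pK subdegree_pK)
    \<comment> \<open>The image ball controls all entries but \<open>a\<close>. The determinant
      supplies the missing bound: as \<open>b * c\<close> is constant, so is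
      \<open>a * d\<close>.\<close>
    have "degree (b * c) \<le> 0"
      using bb cb j' by (cases "b = 0 \<or> c = 0") (auto simp: degree_mult_eq)
    then have "degree (a * d) \<le> 0" unfolding det(1) using deg_det by (intro degree_add_le) auto
    then have "a = 0 \<or> degree a = 0 \<and> degree d = 0" using d0 by (auto simp: degree_mult_eq)
    then show ?thesis using bb cb j' d0 by auto
  next
    assume a1: "?g $ 2 $ 1 \<noteq> 0" "vge (fls_subdegree (?g $ 2 $ 1) + j + 1) (?g $ 2 $ 1 * 0 + ?g $ 2 $ 2)"
    have c0: "c \<noteq> 0" using a1 unfolding g by simp
    have db: "d = 0 \<or> - int (degree c) + j + 1 \<le> - int (degree d)"
      using a1(2) unfolding g by (simp add: vge_pK subdegree_pK)
    have a2: "vge (fls_subdegree (?g $ 2 $ 1) + j) (?g $ 2 $ 1 * 0 + ?g $ 2 $ 2)"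
      using a1(2) by (rule vge_mono) simp
    have "vball (poly_to_Kinf a / poly_to_Kinf c) (2 * int (degree c) - j) = vball 0 j'"
      using ball_act_pole[OF det_pK_invertible(1)[OF H] a1(1) a2] det_pK_invertible(2)[OF H] eq
      unfolding g pact_def by (simp add: subdegree_pK)
    then have j': "j' = 2 * int (degree c) - j"
      and "vge j' (poly_to_Kinf a / poly_to_Kinf c)" by (auto simp: vball_eq_iff)
    then have ab: "a = 0 \<or> j' - int (degree c) \<le> - int (degree a)"
      using c0 by (simp add: vge_divide_iff vge_pK subdegree_pK)
    have "degree (a * d) \<le> 0"
      using ab db j' by (cases "a = 0 \<or> d = 0") (auto simp: degree_mult_eq)
    then have "degree (b * c) \<le> 0" unfolding det(2) using deg_det by (intro degree_diff_le) auto
    then have "b = 0 \<or> degree b = 0 \<and> degree c = 0" using c0 by (auto simp: degree_mult_eq)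
    then show ?thesis using ab db j' c0 by auto
  qed
  then show "H $ 1 $ 1 = 0 \<or> 2 * int (degree (H $ 1 $ 1)) \<le> j - j'"
    "H $ 1 $ 2 = 0 \<or> 2 * int (degree (H $ 1 $ 2)) \<le> - j - j'"
    "H $ 2 $ 1 = 0 \<or> 2 * int (degree (H $ 2 $ 1)) \<le> j + j'"
    "H $ 2 $ 2 = 0 \<or> 2 * int (degree (H $ 2 $ 2)) \<le> j' - j"
    unfolding abcd by auto
qed

section \<open>Inequivalence of the balls of the subtree\<close>

definition proper_divisors :: "'a::field poly \<Rightarrow> 'a poly set" where
  "proper_divisors N = {M. M dvd N \<and> lead_coeff M = 1 \<and> 0 < degree M \<and> degree M < degree N}"

lemma not_dvd_lower_degree: "p \<noteq> 0 \<Longrightarrow> degree p < degree q \<Longrightarrow> \<not> q dvd p"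
  for p q :: "'a::field poly"
  using dvd_imp_degree_le[of q p] by linarith

lemma monic_dvd_antisym:
  fixes p q :: "'a::field poly"
  assumes "lead_coeff p = 1" "lead_coeff q = 1" "p dvd q" "q dvd p"
  shows "p = q"
proof -
  obtain k where k: "q = p * k" using assms(3) by blast
  have nz: "p \<noteq> 0" "q \<noteq> 0" using assms by auto
  then have "degree p = degree q" using assms dvd_imp_degree_le by (metis le_antisym)
  then have "degree k = 0" using k nz by (auto simp: degree_mult_eq)
  moreover have "lead_coeff k = 1" using assms k by (simp add: lead_coeff_mult)
  ultimately have "k = 1" by (metis degree_eq_zeroE lead_coeff_pCons(2) one_pCons)
  then show ?thesis using k by simp
qed

lemma degree0_mult_dvd_iff:
  fixes p q u :: "'a::field poly"
  assumes "degree u = 0" "u \<noteq> 0"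
  shows "p dvd q * u \<longleftrightarrow> p dvd q"
  using assms is_unit_iff_degree[of u] by (simp add: dvd_mult_unit_iff)

text \<open>Comparing leading coefficients shows that the constants \<open>a\<close> and
  \<open>d\<close> agree, so \<open>c\<close> is a constant multiple of
  \<open>M - M'\<close>.\<close>

lemma monic_diff_degree:
  fixes M M' :: "'a::field poly"
  assumes "lead_coeff M = 1" "lead_coeff M' = 1" "degree M' = degree M" "degree c < degree M"
    and "a \<noteq> 0" "degree a = 0" "degree d = 0" and eq: "M' * a + c = M * d"
  shows "degree (M' - M) \<le> degree c"
proof -
  obtain \<alpha> \<delta> where ad: "a = [:\<alpha>:]" "d = [:\<delta>:]" using assms(6,7) by (metis degree_eq_zeroE)
  have "coeff (M' * a + c) (degree M) = coeff (M * d) (degree M)" using eq by simp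
  then have "\<alpha> = \<delta>" using assms(1-4) by (simp add: ad coeff_eq_0)
  then have "smult \<alpha> (M' - M) = - c" using eq by (simp add: ad smult_diff_right algebra_simps)
  then have "degree (smult \<alpha> (M' - M)) = degree c" by simp
  then show ?thesis using assms(5) by (simp add: ad)
qed

text \<open>The pairs \<open>(M, j)\<close> for which \<open>u\<^sub>M\<close> maps the ball of radius \<open>j\<close> around \<open>0\<close> into the subtree; \<open>M = 0\<close> gives
  the line from \<open>0\<close> to \<open>\<infinity>\<close>, and \<open>j < deg M\<close> excludes the balls already on it.\<close>

definition standard_pair :: "'a::field poly \<Rightarrow> 'a poly \<Rightarrow> int \<Rightarrow> bool" where
  "standard_pair N M j \<longleftrightarrow> M = 0 \<or> M \<in> proper_divisors N \<and> j < int (degree M)"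

text \<open>The polynomial in \<open>cong\<close> is the lower left entry of
  \<open>lower M' ** H ** lower (- M)\<close>. The degree bounds for the two diagonal entries of
  \<open>H\<close> are opposite numbers, and so are those for the other two. Hence some entries
  vanish or are constant, according to the sign of \<open>j\<close>. The second alternative covers
  the common part of the lines to \<open>1/M\<close> and \<open>1/M'\<close>.\<close>

lemma standard_pair_unique:
  fixes N M M' :: "'a::field poly"
  assumes N: "0 < degree N" and M: "standard_pair N M j" and M': "standard_pair N M' j'"
    and H: "invertible H" "pact H (vball 0 j) = vball 0 j'"
    and cong: "N dvd M' * H $ 1 $ 1 + H $ 2 $ 1 - M * M' * H $ 1 $ 2 - M * H $ 2 $ 2"
  shows "j' = j \<and> (M' = M \<or> M \<noteq> 0 \<and> M' \<noteq> 0 \<and> degree M' = degree M \<and> int (degree (M' - M)) \<le> j)"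
proof -
  define a b c d where abcd: "a = H $ 1 $ 1" "b = H $ 1 $ 2" "c = H $ 2 $ 1" "d = H $ 2 $ 2"
  note deg = pact_vball_degrees[OF H, folded abcd]
  have cong: "N dvd M' * a + c - M * M' * b - M * d" using cong by (simp add: abcd)
  have det: "a * d - b * c \<noteq> 0" using invertible_det(1)[OF H(1)] by (simp add: det_2 abcd)
  have div: "M \<in> proper_divisors N" "j < int (degree M)" if "M \<noteq> 0"
    using M that by (auto simp: standard_pair_def)
  have div': "M' \<in> proper_divisors N" "j' < int (degree M')" if "M' \<noteq> 0"
    using M' that by (auto simp: standard_pair_def)
  have pd: "M \<noteq> 0 \<Longrightarrow> M dvd N \<and> lead_coeff M = 1 \<and> 0 < degree M \<and> degree M < degree N"
    using div by (simp add: proper_divisors_def)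
  have pd': "M' \<noteq> 0 \<Longrightarrow> M' dvd N \<and> lead_coeff M' = 1 \<and> 0 < degree M' \<and> degree M' < degree N"
    using div' by (simp add: proper_divisors_def)
  have congM: "M dvd M' * a + c" if "M \<noteq> 0"
  proof -
    have "M dvd M' * a + c - M * M' * b - M * d" using pd[OF that] cong dvd_trans by blast
    moreover have "M' * a + c - M * M' * b - M * d = (M' * a + c) - M * (M' * b + d)"
      by (simp add: algebra_simps)
    ultimately show ?thesis by (metis dvd_diff_left_iff dvd_triv_left)
  qed
  have congM': "M' dvd c - M * d" if "M' \<noteq> 0"
  proof -
    have "M' dvd M' * a + c - M * M' * b - M * d" using pd'[OF that] cong dvd_trans by blast
    moreover have "M' * a + c - M * M' * b - M * d = (c - M * d) - M' * (M * b - a)"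
      by (simp add: algebra_simps)
    ultimately show ?thesis by (metis dvd_diff_left_iff dvd_triv_left)
  qed
  have no_const: False if "q dvd c" "0 < degree q" "c \<noteq> 0" "degree c = 0" for q
    using not_dvd_lower_degree[of c q] that by auto
  have small: False if "N dvd p" "p \<noteq> 0" "degree p < degree N" for p
    using not_dvd_lower_degree[of p N] that by auto
  show ?thesis
  proof (cases "j' = j")
    case False
    \<comment> \<open>For \<open>j' \<noteq> j\<close> one of the opposite bounds on
      \<open>a\<close> and \<open>d\<close> is negative. The determinant then makes \<open>b\<close>
      and \<open>c\<close> nonzero constants, while \<open>c\<close> is a multiple of
      \<open>M'\<close> or \<open>M\<close>, or of \<open>N\<close> if that one is
      \<open>0\<close>.\<close>
    have da: "d = 0 \<or> a = 0" using deg(1,4) False by force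
    then have bc: "b \<noteq> 0" "c \<noteq> 0" using det by auto
    then have c0: "degree c = 0" using deg(2,3) by auto
    from da have False
    proof
      assume "d = 0"
      then show False
        using cong congM' pd' no_const[of N] no_const[of M'] N bc c0 by (cases "M' = 0") auto
    next
      assume "a = 0"
      then show False
        using cong congM pd no_const[of N] no_const[of M] N bc c0 by (cases "M = 0") auto
    qed
    then show ?thesis ..
  next
    case True
    consider "j > 0" | "j < 0" | "j = 0" by linarith
    then have "M' = M \<or> M \<noteq> 0 \<and> M' \<noteq> 0 \<and> degree M' = degree M \<and> int (degree (M' - M)) \<le> j"
    proof cases
      case 1
      have b: "b = 0" using deg(2) True 1 by auto
      then have ad: "a \<noteq> 0" "d \<noteq> 0" using det by auto
      have ad0: "degree a = 0" "degree d = 0" using deg(1,4) ad True by auto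
      have c: "int (degree c) \<le> j" using deg(3) True 1 by auto
      show ?thesis
      proof (cases "M = 0 \<and> M' = 0")
        case False
        then have cN: "degree c < degree N" using c div pd div' pd' True by fastforce
        have Ma: "degree (M' * a) = degree M'" "degree (M * d) = degree M"
          using ad ad0 by (cases "M' = 0", auto simp: degree_mult_eq) (cases "M = 0", auto simp: degree_mult_eq)
        then have "degree (M' * a) < degree N" "degree (M * d) < degree N"
          using pd pd' N by (cases "M' = 0", auto) (cases "M = 0", auto)
        \<comment> \<open>All terms stay below the degree of \<open>N\<close>, so the congruence
          becomes an equation.\<close>
        then have "degree (M' * a + c - M * d) < degree N" using cN by (intro degree_diff_less degree_add_less)
        then have E: "M' * a + c = M * d" using small[of "M' * a + c - M * d"] cong b by auto
        have M0: "M \<noteq> 0"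
        proof
          assume M0: "M = 0"
          then have "M' * a = - c" using E by (simp add: eq_neg_iff_add_eq_0)
          then have "degree M' = degree c" using Ma(1) by simp
          then show False using div' c False M0 True by auto
        qed
        have M'0: "M' \<noteq> 0"
        proof
          assume "M' = 0"
          then have "degree M = degree c" using Ma(2) E by simp
          then show False using div c M0 by auto
        qed
        have cM: "degree c < degree M" using c div M0 by auto
        have "M' * a = M * d + (- c)" using E by (simp add: algebra_simps)
        then have "degree (M' * a) = degree (M * d)"
          using cM Ma by (metis degree_add_eq_left degree_minus)
        then have D: "degree M' = degree M" using Ma by simp
        show ?thesis
          using monic_diff_degree[OF _ _ D cM ad(1) ad0 E] pd[OF M0] pd'[OF M'0] M0 M'0 D c by auto
      qed simp
    next
      case 2
      \<comment> \<open>A negative radius makes \<open>H\<close> upper triangular with constant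
        diagonal. So \<open>M\<close> and \<open>M'\<close> divide each other, or \<open>N\<close>
        divides both when one of them is \<open>0\<close>.\<close>
      have c: "c = 0" using deg(3) True 2 by auto
      then have ad: "a \<noteq> 0" "d \<noteq> 0" using det by auto
      have ad0: "degree a = 0" "degree d = 0" using deg(1,4) ad True by auto
      note unit = degree0_mult_dvd_iff[OF ad0(1) ad(1)] degree0_mult_dvd_iff[OF ad0(2) ad(2)]
      have "M' = M"
      proof (cases "M = 0 \<or> M' = 0")
        case True
        then have "N dvd M'" "N dvd M" using cong c unit by auto
        then show ?thesis using True small[of M] small[of M'] pd pd' by auto
      next
        case False
        then have "M dvd M'" "M' dvd M" using congM congM' c unit by auto
        then show ?thesis using monic_dvd_antisym pd pd' False by metis
      qed
      then show ?thesis ..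
    next
      case 3
      have deg0: "degree a = 0" "degree b = 0" "degree c = 0" "degree d = 0" using deg 3 True by auto
      show ?thesis
      proof (cases "M = 0 \<or> M' = 0")
        case True
        have "M' = M"
        proof (rule ccontr)
          assume ne: "M' \<noteq> M"
          show False
          proof (cases "M = 0")
            case True
            then have M': "M' \<noteq> 0" "N dvd M' * a + c" using ne cong by auto
            show False
            proof (cases "a = 0")
              case True
              then show False using M'(2) det no_const[of N] N deg0 by auto
            next
              case False
              then have "degree (M' * a) = degree M'" using M' deg0 by (simp add: degree_mult_eq)
              then have "degree (M' * a + c) = degree M'"
                using deg0 pd'[OF M'(1)] by (subst degree_add_eq_left) auto
              moreover from this have "M' * a + c \<noteq> 0" using pd'[OF M'(1)] by (metis degree_0 less_irrefl)
              ultimately show False using small[OF M'(2)] pd'[OF M'(1)] by auto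
            qed
          next
            case False
            then have M: "M' = 0" "N dvd c - M * d" using True cong by auto
            show False
            proof (cases "d = 0")
              case True
              then show False using M(2) det no_const[of N] N deg0 by auto
            next
              case d: False
              then have "degree (M * d) = degree M" using False deg0 by (simp add: degree_mult_eq)
              then have "degree (M * d - c) = degree M"
                using deg0 pd[OF False] degree_add_eq_left[of "- c" "M * d"] by auto
              moreover from this have "M * d - c \<noteq> 0" using pd[OF False] by (metis degree_0 less_irrefl)
              moreover have "N dvd M * d - c" using M(2) by (simp add: dvd_diff_commute)
              ultimately show False using small[of "M * d - c"] pd[OF False] by auto
            qed
          qed
        qed
        then show ?thesis ..
      next
        case False
        \<comment> \<open>The term \<open>M * M' * b\<close> can reach the degree of
          \<open>N\<close>, so the congruence is used only modulo \<open>M\<close> and modulo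
          \<open>M'\<close>, where that term disappears.\<close>
        then have M0: "M \<noteq> 0" and M'0: "M' \<noteq> 0" by auto
        have a: "a \<noteq> 0" using congM[OF M0] no_const[of M] pd[OF M0] det deg0 by auto
        have d: "d \<noteq> 0" using congM'[OF M'0] no_const[of M'] pd'[OF M'0] det deg0 by auto
        have Ma: "degree (M' * a) = degree M'" "degree (M * d) = degree M"
          using M0 M'0 a d deg0 by (auto simp: degree_mult_eq)
        then have E: "degree (M' * a + c) = degree M'" "degree (M * d - c) = degree M"
          using deg0 pd[OF M0] pd'[OF M'0] degree_add_eq_left[of c "M' * a"]
            degree_add_eq_left[of "- c" "M * d"] by auto
        have "degree M \<le> degree M'"
          using dvd_imp_degree_le[OF congM[OF M0]] E pd'[OF M'0] by force
        moreover have "M' dvd M * d - c" using congM'[OF M'0] by (simp add: dvd_diff_commute)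
        then have "degree M' \<le> degree M"
          using dvd_imp_degree_le[of M' "M * d - c"] E pd[OF M0] by force
        ultimately have D: "degree M' = degree M" by simp
        obtain k where k: "M' * a + c = M * k" using congM[OF M0] by blast
        then have "k \<noteq> 0" using E pd'[OF M'0] by auto
        then have "degree k = 0" using k E D M0 by (simp add: degree_mult_eq)
        then show ?thesis
          using monic_diff_degree[OF _ _ D _ a deg0(1) _ k] pd[OF M0] pd'[OF M'0] M0 M'0 D deg0 3 by auto
      qed
    qed
    then show ?thesis using True by simp
  qed
qed

section \<open>Half-edges modulo the congruence subgroup\<close>

lemma monic_bezout:
  fixes p q :: "'a::field poly"
  assumes "p \<noteq> 0 \<or> q \<noteq> 0"
  shows "\<exists>M x y. M = x * p + y * q \<and> M dvd p \<and> M dvd q \<and> lead_coeff M = 1"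
  using assms
\<comment> \<open>Since \<open>degree 0 = 0\<close>, the measure separates \<open>0\<close> from
  nonzero constants; otherwise the last division step of the Euclidean algorithm might not decrease
  it.\<close>
proof (induction "if q = 0 then 0 else Suc (degree q)" arbitrary: p q rule: less_induct)
  case less
  show ?case
  proof (cases "q = 0")
    case True
    then have p: "p \<noteq> 0" using less.prems by simp
    define k where "k = [:inverse (lead_coeff p):]"
    have "lead_coeff (k * p) = 1" using p by (simp add: k_def)
    moreover have "p = (k * p) * [:lead_coeff p:]" using p by (simp add: k_def)
    then have "k * p dvd p" by (metis dvd_triv_left)
    ultimately show ?thesis using True by (intro exI[of _ "k * p"] exI[of _ k] exI[of _ 0]) auto
  next
    case False
    have "(if p mod q = 0 then 0 else Suc (degree (p mod q))) < (if q = 0 then 0 else Suc (degree q))"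
      using False degree_mod_less[of q p] by auto
    from less.hyps[OF this] False obtain M x y where
      M: "M = x * q + y * (p mod q)" "M dvd q" "M dvd p mod q" "lead_coeff M = 1" by blast
    have "p = p div q * q + p mod q" by simp
    then have "M dvd p" using M by (metis dvd_add dvd_mult)
    moreover have "M = x * q + y * (p - p div q * q)" using M(1) by (simp only: minus_div_mult_eq_mod)
    then have "M = y * p + (x - y * (p div q)) * q" by (simp add: algebra_simps)
    ultimately show ?thesis using M by blast
  qed
qed

lemma poly_mod_dvd_diff: "N dvd p - p mod N" for N p :: "'a::field poly"
  by (metis dvd_triv_right minus_mod_eq_div_mult)

lemma degree_mod_lt: "0 < degree N \<Longrightarrow> degree (p mod N) < degree N" for N p :: "'a::field poly"
  using degree_mod_less[of N p] by force

text \<open>The square of a common divisor of \<open>M\<close> and \<open>N'\<close> divides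
  \<open>M * N'\<close>. This is where square-freeness enters.\<close>

lemma squarefree_divisor_bezout:
  fixes M N' :: "'a::field poly"
  assumes "squarefree (M * N')" "M \<noteq> 0"
  shows "\<exists>s t. s * M + t * N' = 1"
proof -
  obtain D s t where D: "D = s * M + t * N'" "D dvd M" "D dvd N'" "lead_coeff D = 1"
    using monic_bezout[of M N'] assms(2) by blast
  have "D ^ 2 dvd M * N'" unfolding power2_eq_square using D(2,3) by (rule mult_dvd_mono)
  then have "is_unit D" using assms(1) by (auto simp: squarefree_def)
  then have "D = 1" using D(4) monic_dvd_antisym[of D 1] by simp
  then show ?thesis using D(1) by metis
qed

text \<open>Multiplying by \<open>upper (- \<beta>)\<close> on the right turns the bottom row
  \<open>(c, d)\<close> into \<open>(c, d - c * \<beta>)\<close>. Let \<open>M\<close> be the gcd of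
  \<open>c\<close> and \<open>N\<close>. If \<open>M\<close> is constant, \<open>\<beta>\<close> is
  \<open>d / c\<close> modulo \<open>N\<close>. Otherwise write \<open>c = M * c'\<close> and
  \<open>N = M * N'\<close>: it is enough that \<open>d - c * \<beta>\<close> is \<open>c'\<close>
  modulo \<open>N'\<close>, which is solvable since both \<open>M\<close> and \<open>c'\<close> are
  units there.\<close>

lemma bottom_row_bezout:
  fixes c d N :: "'a::field poly"
  assumes N: "squarefree N" "0 < degree N" and c: "\<not> N dvd c"
  shows "\<exists>\<beta>. degree \<beta> < degree N \<and>
    (N dvd d - c * \<beta> \<or> (\<exists>M\<in>proper_divisors N. N dvd c - M * (d - c * \<beta>)))"
proof -
  have N0: "N \<noteq> 0" using N(2) by auto
  obtain M x y where M: "M = x * c + y * N" "M dvd c" "M dvd N" "lead_coeff M = 1"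
    using monic_bezout[of c N] N0 by blast
  show ?thesis
  proof (cases "degree M = 0")
    case True
    then have M1: "x * c + y * N = 1" using M by (metis degree_eq_zeroE lead_coeff_pCons(2) one_pCons)
    define \<beta> where "\<beta> = (x * d) mod N"
    have "N dvd c * (x * d - \<beta>)" unfolding \<beta>_def using poly_mod_dvd_diff by (rule dvd_mult)
    moreover have "d * (x * c + y * N) = d" using M1 by simp
    then have "d - c * \<beta> = N * (y * d) + c * (x * d - \<beta>)" by (simp add: algebra_simps)
    ultimately have "N dvd d - c * \<beta>" by (metis dvd_add dvd_triv_left)
    moreover have "degree \<beta> < degree N" unfolding \<beta>_def using N(2) by (rule degree_mod_lt)
    ultimately show ?thesis by blast
  next
    case False
    obtain N' where N': "N = M * N'" using M(3) by blast
    obtain c' where c': "c = M * c'" using M(2) by blast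
    have M0: "M \<noteq> 0" using M(4) by auto
    have "degree M < degree N"
    proof (rule ccontr)
      assume "\<not> degree M < degree N"
      then have "degree N' = 0" "N' \<noteq> 0" using N' N0 by (auto simp: degree_mult_eq)
      then have "N dvd M" unfolding N' using degree0_mult_dvd_iff[of N' "M * N'" M] by simp
      then show False using M(2) c dvd_trans by blast
    qed
    then have pd: "M \<in> proper_divisors N" using M False by (simp add: proper_divisors_def)
    obtain s t where st: "s * M + t * N' = 1"
      using squarefree_divisor_bezout[of M N'] N(1) N' M0 by blast
    have "M * (x * c' + y * N') = M * 1" using M(1) unfolding c' N' by (simp add: algebra_simps)
    then have xy: "x * c' + y * N' = 1" using M0 by simp
    \<comment> \<open>\<open>s * x\<close> inverts \<open>c = M * c'\<close> modulo
      \<open>N'\<close>, so \<open>c * \<gamma>\<close> is \<open>d - c'\<close> modulo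
      \<open>N'\<close>.\<close>
    define \<gamma> where "\<gamma> = s * x * (d - c')"
    define \<beta> where "\<beta> = \<gamma> mod N"
    have "N' dvd N" unfolding N' by simp
    then have 1: "N' dvd \<gamma> - \<beta>" unfolding \<beta>_def using poly_mod_dvd_diff dvd_trans by blast
    have "s * M * (x * c') = (1 - t * N') * (1 - y * N')" using st xy by (metis add_diff_cancel_right')
    then have "c * (s * x) = 1 + N' * (t * y * N' - t - y)" unfolding c' by (simp add: algebra_simps)
    then have "c * \<gamma> = (1 + N' * (t * y * N' - t - y)) * (d - c')"
      unfolding \<gamma>_def by (metis mult.assoc)
    then have "c' - (d - c * \<beta>) = N' * ((t * y * N' - t - y) * (d - c')) - c * (\<gamma> - \<beta>)"
      by (simp add: algebra_simps)
    moreover have "N' dvd c * (\<gamma> - \<beta>)" using 1 by (rule dvd_mult)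
    ultimately have "N' dvd c' - (d - c * \<beta>)" by (metis dvd_diff dvd_triv_left)
    then have "N dvd M * (c' - (d - c * \<beta>))" unfolding N' by (rule mult_dvd_mono[OF dvd_refl])
    moreover have "M * (c' - (d - c * \<beta>)) = c - M * (d - c * \<beta>)" by (simp add: c' right_diff_distrib)
    moreover have "degree \<beta> < degree N" unfolding \<beta>_def using N(2) by (rule degree_mod_lt)
    ultimately show ?thesis using pd by auto
  qed
qed

text \<open>The factor \<open>g\<close> is \<open>A ** upper (- \<beta>)\<close> times the inverse
  of \<open>K\<close>. Its lower left entry is exactly the polynomial that
  \<open>bottom_row_bezout\<close> makes divisible by \<open>N\<close>.\<close>

lemma coset_representatives:
  fixes N :: "'a::field poly" and A :: "'a poly ^ 2 ^ 2"
  assumes N: "squarefree N" "0 < degree N" and A: "invertible A"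
  obtains g K \<beta> where "invertible g" "N dvd g $ 2 $ 1" "A = g ** K ** upper \<beta>" "degree \<beta> < degree N"
    "K = swap \<or> (\<exists>M. (M = 0 \<or> M \<in> proper_divisors N) \<and> K = lower M)"
proof -
  let ?c = "A $ 2 $ 1" and ?d = "A $ 2 $ 2"
  have cancel: "A ** upper (- \<beta>) ** L ** K ** upper \<beta> = A" if "L ** K = mat 1" for \<beta> K L
    using that by (simp add: matrix_mul_assoc[symmetric] upper_mult upper_0)
  show ?thesis
  proof (cases "N dvd ?c")
    case True
    moreover have "A = A ** lower 0 ** upper 0" by (simp add: lower_0 upper_0)
    ultimately show ?thesis using that[of A "lower 0" 0] A N by auto
  next
    case False
    from bottom_row_bezout[OF N this, of ?d] obtain \<beta> where \<beta>: "degree \<beta> < degree N"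
      "N dvd ?d - ?c * \<beta> \<or> (\<exists>M\<in>proper_divisors N. N dvd ?c - M * (?d - ?c * \<beta>))" by blast
    from \<beta>(2) show ?thesis
    proof
      assume d: "N dvd ?d - ?c * \<beta>"
      let ?g = "A ** upper (- \<beta>) ** swap"
      have "?g $ 2 $ 1 = ?d - ?c * \<beta>" by (simp add: matrix2_mult_nth upper_def swap_def)
      then show ?thesis
        using that[of ?g swap \<beta>] d \<beta>(1) cancel[of swap swap \<beta>]
        by (simp add: A invertible_mult invertible_upper invertible_swap swap_mult)
    next
      assume "\<exists>M\<in>proper_divisors N. N dvd ?c - M * (?d - ?c * \<beta>)"
      then obtain M where M: "M \<in> proper_divisors N" "N dvd ?c - M * (?d - ?c * \<beta>)" by blast
      let ?g = "A ** upper (- \<beta>) ** lower (- M)"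
      have "?g $ 2 $ 1 = ?c - M * (?d - ?c * \<beta>)"
        by (simp add: matrix2_mult_nth upper_def lower_def algebra_simps)
      then show ?thesis
        using that[of ?g "lower M" \<beta>] M \<beta>(1) cancel[of "lower (- M)" "lower M" \<beta>]
        by (auto simp: A invertible_mult invertible_upper invertible_lower lower_mult lower_0)
    qed
  qed
qed

text \<open>Continued fraction expansion of the centre: remove the polynomial part, leaving
  \<open>y\<close> of valuation at least \<open>1\<close>, and invert. Each inversion lowers the
  radius by twice that valuation, until the radius is at most \<open>0\<close> or the ball contains
  \<open>0\<close>.\<close>

lemma ball_standard_form:
  assumes "B \<in> vballs"
  obtains A m where "invertible A" "B = pact A (vball 0 (- int m))"
proof -
  have "\<exists>A m. invertible A \<and> vball x r = pact A (vball 0 (- int m))" for x :: "'a fls" and r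
  proof (induction "nat r" arbitrary: x r rule: less_induct)
    case less
    obtain p where p: "vge 1 (x - poly_to_Kinf p)" using polynomial_part by blast
    define y where "y = x - poly_to_Kinf p"
    let ?g = "pK_matrix (upper p)"
    have g: "?g $ 1 $ 1 = 1" "?g $ 1 $ 2 = poly_to_Kinf p" "?g $ 2 $ 1 = 0" "?g $ 2 $ 2 = 1"
      by (simp_all add: pK_matrix_nth) (simp_all add: upper_def)
    have shift: "pact (upper p) (vball y r) = vball x r"
      using ball_act_affine[of ?g y r] det_pK_invertible[OF invertible_upper[of p]]
      unfolding pact_def g by (simp add: y_def)
    have "\<exists>A m. invertible A \<and> vball y r = pact A (vball 0 (- int m))"
    proof (cases "r \<le> 0")
      case True
      have "vball y r = vball 0 r"
        using p True by (auto simp: vball_eq_iff y_def intro: vge_mono)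
      then show ?thesis
        using True by (intro exI[of _ "mat 1"] exI[of _ "nat (- r)"])
          (simp add: pact_one invertible_lower[of 0, unfolded lower_0])
    next
      case False
      show ?thesis
      proof (cases "vge r y")
        case True
        then have "vball y r = vball 0 r" by (simp add: vball_eq_iff)
        then show ?thesis
          using False pact_swap[of "- r", where 'a = 'a]
          by (intro exI[of _ swap] exI[of _ "nat r"]) (simp add: invertible_swap)
      next
        case f: False
        then have y: "y \<noteq> 0" "fls_subdegree y < r" "1 \<le> fls_subdegree y"
          using p by (auto simp: vge_def y_def)
        have "nat (r - 2 * fls_subdegree y) < nat r" using y False by auto
        from less[OF this] obtain A m where
          A: "invertible A" "vball (inverse y) (r - 2 * fls_subdegree y) = pact A (vball 0 (- int m))" by blast
        have "vball y r = pact (swap ** A) (vball 0 (- int m))"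
          using pact_swap_nonzero[OF y(1), of r] y A by (simp add: pact_mult invertible_swap)
        then show ?thesis using A(1) invertible_mult[OF invertible_swap] by blast
      qed
    qed
    then obtain A m where "invertible A" "vball y r = pact A (vball 0 (- int m))" by blast
    then have "vball x r = pact (upper p ** A) (vball 0 (- int m))" "invertible (upper p ** A)"
      using shift by (simp_all add: pact_mult invertible_upper invertible_mult)
    then show ?case by blast
  qed
  then show ?thesis using that vball_cases[OF assms] by metis
qed

lemma pact_mult_image:
  assumes "invertible A" "invertible A'" "e \<subseteq> vballs"
  shows "pact (A ** A') ` e = pact A ` pact A' ` e"
  unfolding image_image using pact_mult[OF assms(1,2)] assms(3) by (intro image_cong) auto

text \<open>The larger neighbour is unique. A smaller one has radius \<open>- int m + 1\<close>, at
  most \<open>1\<close>, hence a polynomial centre \<open>p\<close>; \<open>upper p\<close> fixes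
  the given ball and moves the neighbour around \<open>0\<close> to this one.\<close>

lemma half_edge_at_standard:
  fixes e :: "'a::field fls set set"
  assumes "e \<in> ball_edges" "vball 0 (- int m) \<in> e"
  obtains A \<sigma> where "invertible A" "\<sigma> \<in> {-1, 1}" "pact A (vball 0 (- int m)) = vball 0 (- int m)"
    "e = pact A ` {vball 0 (- int m), vball 0 (- int m + \<sigma>)}"
proof -
  obtain y s where e: "e = {vball y (s + 1), vball y s}" using assms(1) by (auto simp: ball_edges_def)
  show ?thesis
  proof (cases "vball 0 (- int m) = vball y s")
    case True
    then have s: "s = - int m" "vge s y" by (auto simp: vball_eq_iff)
    obtain p where p: "vge 1 (y - poly_to_Kinf p)" using polynomial_part by blast
    have p1: "vball y (s + 1) = vball (poly_to_Kinf p) (s + 1)" "vball y s = vball (poly_to_Kinf p) s"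
      using p s by (auto simp: vball_eq_iff intro: vge_mono)
    have "pact (upper p) (vball 0 (- int m)) = vball 0 (- int m)"
      unfolding pact_upper using True s(1) p1(2) by metis
    moreover have "e = pact (upper p) ` {vball 0 (- int m), vball 0 (- int m + 1)}"
      unfolding e image_insert image_empty pact_upper using p1 s(1) by (simp add: insert_commute)
    ultimately show ?thesis using that[of "upper p" 1] invertible_upper by blast
  next
    case False
    then have "vball 0 (- int m) = vball y (s + 1)" using assms(2) e by auto
    then have s: "s + 1 = - int m" "vge (s + 1) y" by (auto simp: vball_eq_iff)
    then have "vge s y" by (auto intro: vge_mono)
    then have "e = {vball 0 (- int m), vball 0 (- int m - 1)}"
      using s unfolding e by (auto simp: vball_eq_iff doubleton_eq_iff)
    then show ?thesis
      using that[of "mat 1" "-1"] by (simp add: pact_one invertible_lower[of 0, unfolded lower_0])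
  qed
qed

lemma half_edge_standard_form:
  fixes e :: "'a::field fls set set"
  assumes e: "e \<in> ball_edges" and v: "v \<in> e"
  obtains A m \<sigma> where "invertible A" "\<sigma> \<in> {-1, 1}" "v = pact A (vball 0 (- int m))"
    "e = pact A ` {vball 0 (- int m), vball 0 (- int m + \<sigma>)}"
proof -
  obtain A m where A: "invertible A" "v = pact A (vball 0 (- int m))"
    using ball_standard_form e v ball_edges_subset by blast
  obtain B where B: "invertible B" "A ** B = mat 1" "B ** A = mat 1"
    using invertible_inverse[OF A(1)] .
  have eV: "e \<subseteq> vballs" using ball_edges_subset[OF e] .
  have eB: "pact B ` e \<in> ball_edges" using pact_edge[OF B(1) e] .
  have "pact B v = vball 0 (- int m)"
    unfolding A(2) using pact_mult[OF B(1) A(1), of "vball 0 (- int m)"] by (simp add: B pact_one)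
  then have "vball 0 (- int m) \<in> pact B ` e" using v by (metis imageI)
  from half_edge_at_standard[OF eB this] obtain C \<sigma> where C: "invertible C" "\<sigma> \<in> {-1, 1}"
    "pact C (vball 0 (- int m)) = vball 0 (- int m)"
    "pact B ` e = pact C ` {vball 0 (- int m), vball 0 (- int m + \<sigma>)}" .
  have "pact A ` pact B ` e = pact (mat 1) ` e"
    using pact_mult_image[OF A(1) B(1) eV] B by simp
  also have "\<dots> = id ` e" using eV by (intro image_cong) (auto simp: pact_one)
  finally have "e = pact (A ** C) ` {vball 0 (- int m), vball 0 (- int m + \<sigma>)}"
    using pact_mult_image[OF A(1) C(1), of "{vball 0 (- int m), vball 0 (- int m + \<sigma>)}"] C(4) by simp
  moreover have "v = pact (A ** C) (vball 0 (- int m))"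
    using A C(1,3) by (simp add: pact_mult)
  ultimately show ?thesis using that[of "A ** C" \<sigma> m] A(1) C invertible_mult by blast
qed

lemma tree_action_congruence_subgroup:
  fixes N :: "'a::field poly"
  shows "tree_action (congruence_subgroup N) ball_act vballs ball_edges edge_act"
proof
  have det: "det g \<noteq> 0 \<and> fls_subdegree (det g) = 0" if "g \<in> congruence_subgroup N" for g
    using that det_pK_invertible by (auto simp: congruence_subgroup_def)
  show "ball_act g B \<in> vballs" if "g \<in> congruence_subgroup N" "B \<in> vballs" for g B
    using det[OF that(1)] that(2) by (simp add: ball_act_vballs)
  show "\<exists>e\<in>congruence_subgroup N. \<forall>B\<in>vballs. ball_act e B = B"
  proof
    have "mat 1 \<in> {A :: 'a poly ^ 2 ^ 2. invertible A \<and> N dvd A $ 2 $ 1}"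
      using invertible_lower[of 0] by (simp add: lower_0)
    then have "pK_matrix (mat 1) \<in> congruence_subgroup N"
      unfolding congruence_subgroup_def by (rule imageI)
    then show "mat 1 \<in> congruence_subgroup N" by (simp only: pK_matrix_one)
  qed (simp add: ball_act_one)
  show "\<exists>k\<in>congruence_subgroup N. \<forall>B\<in>vballs. ball_act k B = ball_act g (ball_act h B)"
    if g: "g \<in> congruence_subgroup N" and h: "h \<in> congruence_subgroup N" for g h
  proof
    obtain A A' where A: "invertible A" "N dvd A $ 2 $ 1" "g = pK_matrix A"
      "invertible A'" "N dvd A' $ 2 $ 1" "h = pK_matrix A'"
      using g h by (auto simp: congruence_subgroup_def)
    then have "invertible (A ** A')" "N dvd (A ** A') $ 2 $ 1"
      by (auto simp: invertible_mult matrix2_mult_nth)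
    then show "g ** h \<in> congruence_subgroup N"
      unfolding congruence_subgroup_def A(3,6) pK_matrix_mult[symmetric] by blast
    show "\<forall>B\<in>vballs. ball_act (g ** h) B = ball_act g (ball_act h B)"
      using det[OF g] det[OF h] by (simp add: ball_act_mult)
  qed
  show "\<exists>h\<in>congruence_subgroup N. \<forall>B\<in>vballs. ball_act h (ball_act g B) = B"
    if g: "g \<in> congruence_subgroup N" for g
  proof -
    obtain A where A: "invertible A" "N dvd A $ 2 $ 1" "g = pK_matrix A"
      using g by (auto simp: congruence_subgroup_def)
    obtain B where B: "invertible B" "A ** B = mat 1" "B ** A = mat 1"
      using invertible_inverse[OF A(1)] .
    \<comment> \<open>After multiplication by the unit \<open>det A\<close>, this vanishing entry
      shows that the lower left entry of the inverse is a multiple of that of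
      \<open>A\<close>.\<close>
    have "(B ** A) $ 2 $ 1 = 0" using B(3) by simp
    then have "B $ 2 $ 1 * A $ 1 $ 1 = - (B $ 2 $ 2 * A $ 2 $ 1)"
      by (simp add: matrix2_mult_nth eq_neg_iff_add_eq_0)
    moreover have "B $ 2 $ 1 * det A = B $ 2 $ 1 * A $ 1 $ 1 * A $ 2 $ 2 - B $ 2 $ 1 * A $ 1 $ 2 * A $ 2 $ 1"
      unfolding det_2 by (simp add: algebra_simps)
    ultimately have "N dvd B $ 2 $ 1 * det A" using A(2) by simp
    then have "N dvd B $ 2 $ 1" using degree0_mult_dvd_iff invertible_det[OF A(1)] by blast
    then have "pK_matrix B \<in> congruence_subgroup N" using B(1) by (auto simp: congruence_subgroup_def)
    moreover have "ball_act (pK_matrix B) (ball_act g C) = C" if "C \<in> vballs" for C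
      using pact_mult[OF B(1) A(1) that] B(3) pact_one[OF that] by (simp add: pact_def A(3))
    ultimately show ?thesis by blast
  qed
  show "\<exists>u v. u \<noteq> v \<and> u \<in> vballs \<and> v \<in> vballs \<and> e = {u, v}" if e: "e \<in> ball_edges" for e :: "'a fls set set"
  proof -
    obtain x r where "e = {vball x (r + 1), vball x r}" using e by (auto simp: ball_edges_def)
    then show ?thesis
      by (intro exI[of _ "vball x (r + 1)"] exI[of _ "vball x r"]) (simp add: vball_eq_iff)
  qed
  show "ball_act g ` e \<in> ball_edges" if "g \<in> congruence_subgroup N" "e \<in> ball_edges" for g e
    using det[OF that(1)] that(2) by (simp add: ball_act_edge)
  show "edge_act g e = ball_act g ` e" for g :: "'a fls ^ 2 ^ 2" and e
    by (simp add: edge_act_def)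
  show "ball_act g B = B"
    if "g \<in> congruence_subgroup N" "e \<in> ball_edges" "B \<in> e" "ball_act g ` e = e" for g e B
    using ball_act_no_inversion det that by blast
  show "graph_connected (induced ball_edges (vballs :: 'a fls set set))"
    using connected_bt_tree by (simp add: bt_tree_eq)
  show "bridged (induced ball_edges (vballs :: 'a fls set set))"
    using bridged_bt_tree by (simp add: bt_tree_eq)
  show "\<exists>e\<in>ball_edges. B \<in> e" if "B \<in> vballs" for B :: "'a fls set"
  proof -
    obtain x r where "B = vball x r" using \<open>B \<in> vballs\<close> by (rule vball_cases)
    then show ?thesis using ball_edgesI[of x r] by blast
  qed
qed

text \<open>The finite ends of the subtree; infinity is implicit in
  \<open>balls_around\<close>.\<close>

definition cusps :: "'a::field poly \<Rightarrow> 'a fls set" where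
  "cusps N = insert 0 ((\<lambda>M. 1 / poly_to_Kinf M) ` proper_divisors N)"

text \<open>Up to radius \<open>degree M\<close>, the valuation of \<open>1/M\<close>, a ball around
  \<open>1/M\<close> is also one around \<open>0\<close> and gets the pair with
  \<open>M = 0\<close>. Beyond that, \<open>j\<close> solves \<open>2 * degree M - j = r\<close> in
  \<open>pact_lower\<close>.\<close>

lemma balls_around_cusps_standard:
  assumes "B \<in> balls_around (cusps N)"
  obtains M j where "standard_pair N M j" "B = pact (lower M) (vball 0 j)"
proof -
  obtain x r where B: "B = vball x r" "x \<in> cusps N" using assms by (auto simp: balls_around_def)
  have zero: thesis if "B = vball 0 s" for s
    using \<open>\<And>M j. standard_pair N M j \<Longrightarrow> B = pact (lower M) (vball 0 j) \<Longrightarrow> thesis\<close>[of 0 s] that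
    by (simp add: standard_pair_def lower_0 pact_one)
  show ?thesis
  proof (cases "x = 0")
    case True
    then show ?thesis using zero B by simp
  next
    case False
    then obtain M where M: "M \<in> proper_divisors N" "x = 1 / poly_to_Kinf M" using B by (auto simp: cusps_def)
    then have M0: "M \<noteq> 0" by (auto simp: proper_divisors_def)
    show ?thesis
    proof (cases "r \<le> int (degree M)")
      case True
      have "vge r (1 / poly_to_Kinf M)"
        using True M0 by (simp add: vge_divide_iff subdegree_pK) (simp add: vge_def)
      then have "B = vball 0 r" using B M by (simp add: vball_eq_iff)
      then show ?thesis by (rule zero)
    next
      case r: False
      have "B = pact (lower M) (vball 0 (2 * int (degree M) - r))"
        using pact_lower[OF M0, of "2 * int (degree M) - r"] r B M by simp
      moreover have "standard_pair N M (2 * int (degree M) - r)"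
        using M r by (simp add: standard_pair_def)
      ultimately show ?thesis using that by blast
    qed
  qed
qed

lemma balls_around_cusps_inequivalent:
  fixes N :: "'a::field poly"
  assumes N: "0 < degree N" and B: "B \<in> balls_around (cusps N)" and A: "invertible A" "N dvd A $ 2 $ 1"
    and AB: "pact A B \<in> balls_around (cusps N)"
  shows "pact A B = B"
proof -
  obtain M j where M: "standard_pair N M j" "B = pact (lower M) (vball 0 j)"
    using balls_around_cusps_standard[OF B] .
  obtain M' j' where M': "standard_pair N M' j'" "pact A B = pact (lower M') (vball 0 j')"
    using balls_around_cusps_standard[OF AB] .
  define H where "H = lower (- M') ** (A ** lower M)"
  have H: "invertible H" by (simp add: H_def invertible_mult invertible_lower A)
  have "pact H (vball 0 j) = pact (lower (- M')) (pact A B)"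
    unfolding H_def M(2) by (simp add: pact_mult invertible_mult invertible_lower A)
  also have "\<dots> = pact (lower (- M') ** lower M') (vball 0 j')"
    unfolding M'(2) by (simp add: pact_mult invertible_lower)
  also have "\<dots> = vball 0 j'" by (simp add: lower_mult lower_0 pact_one)
  finally have "pact H (vball 0 j) = vball 0 j'" .
  moreover have "M' * H $ 1 $ 1 + H $ 2 $ 1 - M * M' * H $ 1 $ 2 - M * H $ 2 $ 2 = A $ 2 $ 1"
    by (simp add: H_def matrix2_mult_nth lower_def algebra_simps)
  ultimately have "j' = j \<and> (M' = M \<or>
      M \<noteq> 0 \<and> M' \<noteq> 0 \<and> degree M' = degree M \<and> int (degree (M' - M)) \<le> j)"
    using standard_pair_unique[OF N M(1) M'(1) H] A(2) by simp
  then consider "j' = j" "M' = M"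
    | "j' = j" "M \<noteq> 0" "M' \<noteq> 0" "degree M' = degree M" "int (degree (M' - M)) \<le> j" by blast
  then show ?thesis
  proof cases
    case 1
    then show ?thesis using M M' by simp
  next
    case 2
    let ?x = "1 / poly_to_Kinf M" and ?y = "1 / poly_to_Kinf M'"
    have j: "j \<le> int (degree M)" using M(1) 2 by (simp add: standard_pair_def)
    \<comment> \<open>Bounding \<open>degree (M' - M)\<close> by \<open>j\<close> gives this
      difference valuation at least \<open>2 * degree M - j\<close>, the radius of both balls, so
      they coincide although \<open>M\<close> and \<open>M'\<close> may differ.\<close>
    have "?x - ?y = poly_to_Kinf (M' - M) / (poly_to_Kinf M * poly_to_Kinf M')"
      using 2 by (simp add: pK_diff diff_divide_distrib)
    then have "vge (2 * int (degree M) - j) (?x - ?y)"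
      using 2 by (simp add: vge_divide_iff subdegree_pK vge_pK)
    then show ?thesis
      using M(2) M'(2) 2 j pact_lower[of M j] pact_lower[of M' j] by (simp add: vball_eq_iff vge_diff_commute)
  qed
qed

section \<open>Finiteness of the remaining half-edge orbits\<close>

lemma finite_poly_degree_less: "finite {p :: 'a::{field,finite} poly. degree p < n}"
proof -
  have "{p :: 'a poly. degree p < n} \<subseteq> Poly ` {xs. set xs \<subseteq> UNIV \<and> length xs \<le> n}"
  proof
    fix p :: "'a poly" assume "p \<in> {p. degree p < n}"
    then have "length (coeffs p) \<le> n" by (cases "p = 0") (auto simp: length_coeffs_degree)
    then show "p \<in> Poly ` {xs. set xs \<subseteq> UNIV \<and> length xs \<le> n}"
      by (intro image_eqI[of _ _ "coeffs p"]) auto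
  qed
  then show ?thesis
    by (rule finite_subset) (intro finite_imageI finite_lists_length_le, rule finite)
qed

lemma finite_image_factor:
  assumes "finite (k ` S)" "\<And>x y. x \<in> S \<Longrightarrow> y \<in> S \<Longrightarrow> k x = k y \<Longrightarrow> f x = f y"
  shows "finite (f ` S)"
proof -
  have "f ` S \<subseteq> (\<lambda>z. f (inv_into S k z)) ` k ` S"
  proof
    fix w assume "w \<in> f ` S"
    then obtain x where x: "x \<in> S" "w = f x" by blast
    then have "f (inv_into S k (k x)) = w"
      using assms(2)[of "inv_into S k (k x)" x] by (simp add: inv_into_into f_inv_into_f)
    then show "w \<in> (\<lambda>z. f (inv_into S k z)) ` k ` S" using x by blast
  qed
  then show ?thesis using assms(1) by (meson finite_imageI finite_subset)
qed

definition half_edge_act :: "'a::field poly ^ 2 ^ 2 \<Rightarrow> 'a fls set \<times> 'a fls set set \<Rightarrow> 'a fls set \<times> 'a fls set set" where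
  "half_edge_act A = sub_eact ball_act edge_act (pK_matrix A)"

lemma half_edge_act_eq: "half_edge_act A (v, e) = (pact A v, pact A ` e)"
  by (simp add: half_edge_act_def sub_eact_def edge_act_def pact_def)

lemma half_edge_act_mult:
  assumes "invertible A" "invertible A'" "v \<in> vballs" "e \<subseteq> vballs"
  shows "half_edge_act (A ** A') (v, e) = half_edge_act A (half_edge_act A' (v, e))"
  using assms by (simp add: half_edge_act_eq pact_mult pact_mult_image)

lemma half_edge_act_closed:
  assumes "invertible A" "e \<in> ball_edges" "v \<in> e"
  shows "half_edge_act A (v, e) \<in> gedges (subdivide (induced ball_edges vballs))"
  using pact_edge[OF assms(1,2)] ball_edges_subset[of "pact A ` e"] assms(3) by (simp add: half_edge_act_eq)

definition standard_half_edge :: "nat \<Rightarrow> int \<Rightarrow> 'a::field fls set \<times> 'a fls set set" where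
  "standard_half_edge m \<sigma> = (vball 0 (- int m), {vball 0 (- int m), vball 0 (- int m + \<sigma>)})"

lemma standard_edge:
  assumes "\<sigma> \<in> {-1, 1}"
  shows "{vball 0 (- int m), vball 0 (- int m + \<sigma>)} \<in> ball_edges"
proof -
  have "{vball 0 (- int m), vball 0 (- int m + - 1)} \<in> ball_edges"
    using ball_edgesI[of 0 "- int m + - 1"] by simp
  moreover have "{vball 0 (- int m), vball 0 (- int m + 1)} \<in> ball_edges"
    using ball_edgesI[of 0 "- int m"] by (simp only: insert_commute)
  ultimately show ?thesis using assms by blast
qed

text \<open>\<open>K\<close> maps the ray from \<open>vball 0 0\<close> towards infinity to a ray
  towards \<open>0\<close> for the swap, towards infinity for \<open>M = 0\<close>, and towards
  \<open>1/M\<close> otherwise.\<close>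

lemma pact_cusp_ray:
  fixes N :: "'a::field poly"
  assumes "K = swap \<or> (\<exists>M. (M = 0 \<or> M \<in> proper_divisors N) \<and> K = lower M)" "s \<le> 0"
  shows "pact K (vball 0 s) \<in> balls_around (cusps N)"
  using assms(1)
proof (elim disjE exE conjE)
  fix M assume M: "M \<in> proper_divisors N" "K = lower M"
  then have "M \<noteq> 0" by (auto simp: proper_divisors_def)
  then show ?thesis using M assms(2) pact_lower[of M s] by (auto simp: cusps_def intro: balls_aroundI)
qed (auto simp: pact_swap lower_0 pact_one cusps_def intro: balls_aroundI)

lemma finitely_many_remaining:
  fixes N :: "'a::{field,finite} poly"
  assumes N: "squarefree N" "0 < degree N"
  defines "oe \<equiv> orbit_of (congruence_subgroup N) (sub_eact ball_act edge_act)"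
  shows "finite (oe ` gedges (subdivide (induced ball_edges vballs)) -
    oe ` gedges (subdivide (induced ball_edges (balls_around (cusps N)))))" (is "finite (?all - ?s)")
proof -
  interpret tree_action "congruence_subgroup N" ball_act vballs ball_edges edge_act
    by (rule tree_action_congruence_subgroup)
  have mult: "oe (half_edge_act g h) = oe h"
    if "invertible g" "N dvd g $ 2 $ 1" "h \<in> gedges (subdivide (induced ball_edges vballs))" for g h
  proof -
    have "pK_matrix g \<in> congruence_subgroup N" using that by (auto simp: congruence_subgroup_def)
    then show ?thesis unfolding oe_def half_edge_act_def by (intro eS.orbit_act that(3))
  qed
  define U :: "('a poly ^ 2 ^ 2) set" where "U = {A. invertible A}"
  have fin: "finite ((\<lambda>A. oe (half_edge_act A (v, e))) ` U)" if ve: "e \<in> ball_edges" "v \<in> e" for v e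
  proof (rule finite_image_factor)
    let ?R = "{p :: 'a poly. degree p < degree N}"
    show "finite ((\<lambda>A. (A $ 2 $ 1 mod N, A $ 2 $ 2 mod N)) ` U)"
    proof (rule finite_subset)
      show "(\<lambda>A. (A $ 2 $ 1 mod N, A $ 2 $ 2 mod N)) ` U \<subseteq> ?R \<times> ?R" using degree_mod_lt[OF N(2)] by auto
      show "finite (?R \<times> ?R)" using finite_poly_degree_less by (intro finite_cartesian_product)
    qed
    fix A A' :: "'a poly ^ 2 ^ 2"
    assume A: "A \<in> U" "A' \<in> U"
      and mod: "(A $ 2 $ 1 mod N, A $ 2 $ 2 mod N) = (A' $ 2 $ 1 mod N, A' $ 2 $ 2 mod N)"
    have inv: "invertible A" "invertible A'" using A by (auto simp: U_def)
    obtain B where B: "invertible B" "A ** B = mat 1" "B ** A = mat 1" using invertible_inverse[OF inv(1)] .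
    have dvd: "N dvd A' $ 2 $ 1 - A $ 2 $ 1" "N dvd A' $ 2 $ 2 - A $ 2 $ 2"
      using mod by (simp_all add: mod_eq_dvd_iff[symmetric])
    have "(A ** B) $ 2 $ 1 = 0" using B by simp
    then have "A $ 2 $ 1 * B $ 1 $ 1 + A $ 2 $ 2 * B $ 2 $ 1 = 0" by (simp add: matrix2_mult_nth)
    \<comment> \<open>The bottom row modulo \<open>N\<close> determines the coset: \<open>A'\<close>
      times the inverse of \<open>A\<close> lies in the congruence subgroup when the rows agree.
      Over a finite field there are finitely many such rows.\<close>
    then have "(A' ** B) $ 2 $ 1 =
        (A' $ 2 $ 1 - A $ 2 $ 1) * B $ 1 $ 1 + (A' $ 2 $ 2 - A $ 2 $ 2) * B $ 2 $ 1"
      by (simp add: matrix2_mult_nth algebra_simps)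
    then have g: "N dvd (A' ** B) $ 2 $ 1" using dvd by simp
    have e: "v \<in> vballs" "e \<subseteq> vballs" using ve ball_edges_subset by blast+
    have "(A' ** B) ** A = A'" using B by (simp add: matrix_mul_assoc[symmetric])
    then have "half_edge_act A' (v, e) = half_edge_act (A' ** B) (half_edge_act A (v, e))"
      using half_edge_act_mult[of "A' ** B" A v e] inv B e by (simp add: invertible_mult)
    then show "oe (half_edge_act A (v, e)) = oe (half_edge_act A' (v, e))"
      using mult[OF _ g half_edge_act_closed[OF inv(1) ve]] inv B by (simp add: invertible_mult)
  qed
  have "?all - ?s \<subseteq> (\<Union>m\<in>{..<degree N}. \<Union>\<sigma>\<in>{-1, 1}. (\<lambda>A. oe (half_edge_act A (standard_half_edge m \<sigma>))) ` U)"
  proof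
    fix h assume h: "h \<in> ?all - ?s"
    then obtain v e where ve: "h = oe (v, e)" "e \<in> ball_edges" "v \<in> e" by auto
    obtain A m \<sigma> where A: "invertible A" "\<sigma> \<in> {-1, 1}" "v = pact A (vball 0 (- int m))"
      "e = pact A ` {vball 0 (- int m), vball 0 (- int m + \<sigma>)}"
      using half_edge_standard_form[OF ve(2,3)] .
    have h_eq: "h = oe (half_edge_act A (standard_half_edge m \<sigma>))"
      unfolding ve(1) standard_half_edge_def half_edge_act_eq A(3,4) ..
    have "m < degree N"
    proof (rule ccontr)
      assume m: "\<not> m < degree N"
      obtain g K \<beta> where g: "invertible g" "N dvd g $ 2 $ 1" "A = g ** K ** upper \<beta>" "degree \<beta> < degree N"
        "K = swap \<or> (\<exists>M. (M = 0 \<or> M \<in> proper_divisors N) \<and> K = lower M)"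
        using coset_representatives[OF N A(1)] .
      have K: "invertible K" using g(5) invertible_swap invertible_lower by blast
      \<comment> \<open>\<open>degree \<beta> \<le> degree N - 1 \<le> m - 1\<close>, so translation
        by \<open>\<beta>\<close> preserves balls around \<open>0\<close> up to radius
        \<open>- int m + 1\<close>; this includes the neighbour on the side of
        \<open>0\<close>.\<close>
      have fix_ball: "pact (upper \<beta>) (vball 0 s) = vball 0 s" if "s \<le> - int m + 1" for s
        using that m g(4) by (simp add: pact_upper vball_eq_iff vge_pK)
      have "half_edge_act (upper \<beta>) (standard_half_edge m \<sigma>) = standard_half_edge m \<sigma>"
        using A(2) by (auto simp: standard_half_edge_def half_edge_act_eq fix_ball)
      moreover define k where "k = half_edge_act K (standard_half_edge m \<sigma>)"
      have "half_edge_act A (standard_half_edge m \<sigma>) =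
          half_edge_act g (half_edge_act K (half_edge_act (upper \<beta>) (standard_half_edge m \<sigma>)))"
        unfolding g(3) standard_half_edge_def
        by (subst half_edge_act_mult, simp_all add: invertible_mult g K invertible_upper)
          (simp add: half_edge_act_eq[of "upper \<beta>"] half_edge_act_mult g K pact_vballs invertible_upper)
      ultimately have "half_edge_act A (standard_half_edge m \<sigma>) = half_edge_act g k"
        by (simp add: k_def)
      moreover have kG: "k \<in> gedges (subdivide (induced ball_edges vballs))"
        unfolding k_def standard_half_edge_def
        using standard_edge[OF A(2)] by (intro half_edge_act_closed K) auto
      ultimately have "h = oe k" using h_eq mult[OF g(1,2)] by simp
      moreover have "k \<in> gedges (subdivide (induced ball_edges (balls_around (cusps N))))"
      proof -
        have "pact K (vball 0 s) \<in> balls_around (cusps N)" if "s \<le> 0" for s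
          using pact_cusp_ray[OF g(5) that] .
        \<comment> \<open>As \<open>m \<ge> degree N \<ge> 1\<close>, the neighbour also has
          nonpositive radius, so \<open>pact_cusp_ray\<close> applies to both ends of the
          edge.\<close>
        moreover have "- int m + \<sigma> \<le> 0" using m N(2) A(2) by auto
        ultimately show ?thesis
          using kG by (auto simp: k_def standard_half_edge_def half_edge_act_eq)
      qed
      ultimately show False using h by blast
    qed
    then show "h \<in> (\<Union>m\<in>{..<degree N}. \<Union>\<sigma>\<in>{-1, 1}. (\<lambda>A. oe (half_edge_act A (standard_half_edge m \<sigma>))) ` U)"
      using h_eq A(1,2) unfolding U_def by blast
  qed
  moreover have "finite (\<Union>m\<in>{..<degree N}. \<Union>\<sigma>\<in>{-1, 1}. (\<lambda>A. oe (half_edge_act A (standard_half_edge m \<sigma>))) ` U)"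
    unfolding standard_half_edge_def by (intro finite_UN_I fin standard_edge) auto
  ultimately show ?thesis by (rule finite_subset)
qed

theorem theorem1p3:
  fixes N :: "'a::{field,finite} poly" and lam :: "nat \<Rightarrow> 'a" and n :: nat
  assumes "n \<ge> 1"
    and "N = (\<Prod>i=1..n. [:- lam i, 1:])"
    and "squarefree N"
  shows "\<exists>\<ss>. smallest_subtree bt_tree
            ({bt_end (Affine 0), bt_end Infinity} \<union>
             {bt_end (Affine (1 / poly_to_Kinf M)) | M.
                M dvd N \<and> lead_coeff M = 1 \<and> 0 < degree M \<and> degree M < degree N}) \<ss> \<and>
           (\<exists>\<ff>. subgraph \<ff> (subdivide bt_tree) \<and> finite_graph \<ff> \<and>
              fundamental_domain (congruence_subgroup N) ball_act edge_act bt_tree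
                (graph_union (subdivide \<ss>) \<ff>))"
proof -
  have "N \<noteq> 0" unfolding assms(2) by simp
  \<comment> \<open>Since \<open>n \<ge> 1\<close>, a linear factor is present and \<open>N\<close>
    has positive degree, as required for both inequivalence and finiteness.\<close>
  moreover have "[:- lam 1, 1:] dvd N" unfolding assms(2) using assms(1) by (intro dvd_prodI) auto
  ultimately have deg: "0 < degree N" using dvd_imp_degree_le[of "[:- lam 1, 1:]" N] by simp
  interpret tree_action "congruence_subgroup N" ball_act vballs ball_edges edge_act
    by (rule tree_action_congruence_subgroup)
  let ?S = "balls_around (cusps N)"
  have ends: "{bt_end (Affine 0), bt_end Infinity} \<union>
      {bt_end (Affine (1 / poly_to_Kinf M)) | M.
         M dvd N \<and> lead_coeff M = 1 \<and> 0 < degree M \<and> degree M < degree N} =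
    {bt_end Infinity} \<union> {bt_end (Affine x) | x. x \<in> cusps N}"
    unfolding cusps_def proper_divisors_def by (auto simp del: bt_end.simps)
  have "inequivalent ?S"
    unfolding inequivalent_def
  proof (intro ballI impI)
    fix B g assume B: "B \<in> ?S" "g \<in> congruence_subgroup N" "ball_act g B \<in> ?S"
    then obtain A where "invertible A" "N dvd A $ 2 $ 1" "g = pK_matrix A"
      by (auto simp: congruence_subgroup_def)
    then show "ball_act g B = B"
      using balls_around_cusps_inequivalent[OF deg B(1), of A] B(3) by (simp add: pact_def)
  qed
  moreover have "?S \<subseteq> vballs" by (auto simp: balls_around_def)
  moreover have "graph_connected (induced ball_edges ?S)"
    by (rule connected_balls_around[of 0]) (simp add: cusps_def)
  ultimately have "\<exists>F. subgraph F (subdivide bt_tree) \<and> finite_graph F \<and>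
     fundamental_domain (congruence_subgroup N) ball_act edge_act bt_tree
       (graph_union (subdivide (induced ball_edges ?S)) F)"
    unfolding bt_tree_eq
    using finitely_many_remaining[OF assms(3) deg] by (intro fundamental_domain_containing)
  moreover have "smallest_subtree bt_tree ({bt_end Infinity} \<union> {bt_end (Affine x) | x. x \<in> cusps N})
      (induced ball_edges ?S)"
    by (rule smallest_subtree_balls_around) (simp add: cusps_def)
  ultimately show ?thesis unfolding ends by blast
qed

end
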